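(* Consider the class of equations $$f(x)u_{tt}=(H(u)u_x)_x+h(x)K(u)u_x$$ for $u=u(t,x)$, with arbitrary elements $f,h,H,K$ (smooth real-valued functions of the indicated variables, $f(x)H(u)\neq0$, $(H_u,K_u)\neq(0,0)$). The usual equivalence transformation group $G_1^{\sim}$ of this class consists of the transformations $$\tilde t=\epsilon_4t+\epsilon_1,\quad \tilde x=\epsilon_5x+\epsilon_2,\quad \tilde u=\epsilon_6u+\epsilon_3,$$ $$\tilde f=\epsilon_4^2\epsilon_5^{-2}\epsilon_7f,\quad \tilde h=\epsilon_8^{-1}h,\quad \tilde H=\epsilon_7H,\quad \tilde K=\epsilon_5^{-1}\epsilon_7\epsilon_8K,$$ where $\epsilon_1,\ldots,\epsilon_8$ are arbitrary constants and $\epsilon_4\epsilon_5\epsilon_6\epsilon_7\epsilon_8\neq0$.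
   Context: The usual equivalence group $G_1^{\sim}$ of the class is the group of nondegenerate point transformations in the space of $(t,x,u,f,h,H,K)$ which are projectible on the space of $(t,x,u)$, i.e. of the form $(\tilde t,\tilde x,\tilde u)=(T^t,T^x,T^u)(t,x,u)$ and $(\tilde f,\tilde h,\tilde H,\tilde K)=(T^f,T^h,T^H,T^K)(t,x,u,f,h,H,K)$, and which transform every equation of the class for $u=u(t,x)$ with arbitrary elements $(f,h,H,K)$ to an equation of the same class for $\tilde u=\tilde u(\tilde t,\tilde x)$ with arbitrary elements $(\tilde f,\tilde h,\tilde H,\tilde K)$, where $\tilde f,\tilde h$ are functions of $\tilde x$ and $\tilde H,\tilde K$ are functions of $\tilde u$. *)

theory Defs
  imports "HOL-Analysis.Analysis"
begin

text \<open>Continuous differentiability of order \<open>k\<close>, intended for open sets \<open>S\<close>: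
  all iterated directional derivatives of order at most \<open>k\<close> are continuous.\<close>

primrec Ck_on :: "nat \<Rightarrow> 'a::euclidean_space set \<Rightarrow> ('a \<Rightarrow> 'b::euclidean_space) \<Rightarrow> bool" where
  "Ck_on 0 S f \<longleftrightarrow> continuous_on S f"
| "Ck_on (Suc k) S f \<longleftrightarrow>
     (\<forall>x\<in>S. f differentiable (at x)) \<and>
     (\<forall>v. Ck_on k S (\<lambda>x. frechet_derivative f (at x) v))"

definition smooth_on :: "'a::euclidean_space set \<Rightarrow> ('a \<Rightarrow> 'b::euclidean_space) \<Rightarrow> bool" where
  "smooth_on S f \<longleftrightarrow> (\<forall>k. Ck_on k S f)"

text \<open>Points are \<open>(t, x, u)\<close>; values of the arbitrary elements are \<open>(f, h, H, K)\<close>.\<close>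

type_synonym point = "real \<times> real \<times> real"
type_synonym elts = "real \<times> real \<times> real \<times> real"

definition x_range :: "point set \<Rightarrow> real set" where
  "x_range \<Omega> = (\<lambda>(t, x, u). x) ` \<Omega>"

definition u_range :: "point set \<Rightarrow> real set" where
  "u_range \<Omega> = (\<lambda>(t, x, u). u) ` \<Omega>"

text \<open>The equation is considered over a domain \<open>\<Omega>\<close> of the space of \<open>(t, x, u)\<close>, so \<open>f\<close>, \<open>h\<close>
  are functions on the projection of \<open>\<Omega>\<close> to the \<open>x\<close>-axis and \<open>H\<close>, \<open>K\<close> on its projection to
  the \<open>u\<close>-axis. The last condition says that the pair of functions \<open>(H\<^sub>u, K\<^sub>u)\<close> is not the
  zero pair.\<close>

definition in_class ::
  "point set \<Rightarrow> (real \<Rightarrow> real) \<Rightarrow> (real \<Rightarrow> real) \<Rightarrow> (real \<Rightarrow> real) \<Rightarrow> (real \<Rightarrow> real) \<Rightarrow> bool" where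
  "in_class \<Omega> f h H K \<longleftrightarrow>
     smooth_on (x_range \<Omega>) f \<and> smooth_on (x_range \<Omega>) h \<and>
     smooth_on (u_range \<Omega>) H \<and> smooth_on (u_range \<Omega>) K \<and>
     (\<forall>x\<in>x_range \<Omega>. \<forall>u\<in>u_range \<Omega>. f x * H u \<noteq> 0) \<and>
     (\<exists>u\<in>u_range \<Omega>. (deriv H u, deriv K u) \<noteq> (0, 0))"

definition Dt :: "(real \<times> real \<Rightarrow> real) \<Rightarrow> real \<times> real \<Rightarrow> real" where
  "Dt v = (\<lambda>(t, x). deriv (\<lambda>s. v (s, x)) t)"

definition Dx :: "(real \<times> real \<Rightarrow> real) \<Rightarrow> real \<times> real \<Rightarrow> real" where
  "Dx v = (\<lambda>(t, x). deriv (\<lambda>y. v (t, y)) x)"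

definition wave_eq ::
  "(real \<Rightarrow> real) \<Rightarrow> (real \<Rightarrow> real) \<Rightarrow> (real \<Rightarrow> real) \<Rightarrow> (real \<Rightarrow> real) \<Rightarrow>
   (real \<times> real \<Rightarrow> real) \<Rightarrow> real \<times> real \<Rightarrow> bool" where
  "wave_eq f h H K u = (\<lambda>(t, x).
     f x * Dt (Dt u) (t, x) =
     Dx (\<lambda>q. H (u q) * Dx u q) (t, x) + h x * K (u (t, x)) * Dx u (t, x))"

text \<open>\<open>P\<close> carries the graph of \<open>u\<close> over \<open>N\<close> into the graph of \<open>u'\<close> over \<open>N'\<close>.\<close>

definition maps_graph ::
  "point set \<Rightarrow> (point \<Rightarrow> point) \<Rightarrow> (real \<times> real) set \<Rightarrow> (real \<times> real \<Rightarrow> real) \<Rightarrow>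
   (real \<times> real) set \<Rightarrow> (real \<times> real \<Rightarrow> real) \<Rightarrow> bool" where
  "maps_graph \<Omega> P N u N' u' \<longleftrightarrow>
     (\<forall>(t, x)\<in>N. (t, x, u (t, x)) \<in> \<Omega> \<and>
       (case P (t, x, u (t, x)) of (t', x', v) \<Rightarrow> (t', x') \<in> N' \<and> u' (t', x') = v))"

text \<open>The change of variables \<open>P\<close> turns the first equation into the second one. As usual for
  point transformations, an equation is identified with the set it defines in the second order
  jet space: the functions \<open>u\<close> are arbitrary (not assumed to be solutions), and the two equations
  are compared at corresponding points. When \<open>P\<close> is a local diffeomorphism, existence of a \<open>C\<^sup>2\<close>
  function \<open>u'\<close> whose graph contains the image of the graph of \<open>u\<close> already entails that
  \<open>(t, x) \<mapsto> (t', x')\<close> is a local diffeomorphism, so that \<open>u\<close> and \<open>P\<close> determine the derivatives of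
  \<open>u'\<close>.\<close>

definition transforms_eq ::
  "point set \<Rightarrow> (point \<Rightarrow> point) \<Rightarrow>
   ((real \<times> real \<Rightarrow> real) \<Rightarrow> real \<times> real \<Rightarrow> bool) \<Rightarrow>
   ((real \<times> real \<Rightarrow> real) \<Rightarrow> real \<times> real \<Rightarrow> bool) \<Rightarrow> bool" where
  "transforms_eq \<Omega> P E E' \<longleftrightarrow>
     (\<forall>N u N' u'. open N \<and> open N' \<and> Ck_on 2 N u \<and> Ck_on 2 N' u' \<and> maps_graph \<Omega> P N u N' u' \<longrightarrow>
       (\<forall>(t, x)\<in>N. case P (t, x, u (t, x)) of (t', x', v) \<Rightarrow>
          E u (t, x) \<longleftrightarrow> E' u' (t', x')))"

definition nondegenerate :: "'a::euclidean_space set \<Rightarrow> ('a \<Rightarrow> 'a) \<Rightarrow> bool" where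
  "nondegenerate D T \<longleftrightarrow>
     smooth_on D T \<and> inj_on T D \<and> (\<forall>p\<in>D. bij (frechet_derivative T (at p)))"

text \<open>\<open>T\<close> is projectible over \<open>\<Omega>\<close> to the transformation \<open>P\<close> of \<open>(t, x, u)\<close>.\<close>

definition projects_to :: "point set \<Rightarrow> (point \<times> elts \<Rightarrow> point \<times> elts) \<Rightarrow> (point \<Rightarrow> point) \<Rightarrow> bool" where
  "projects_to \<Omega> T P \<longleftrightarrow> (\<forall>z\<in>\<Omega>. \<forall>\<theta>. fst (T (z, \<theta>)) = P z)"

text \<open>Usual equivalence transformations over a domain \<open>\<Omega>\<close>; \<open>\<Omega> = UNIV\<close> is the case of
  transformations of the whole space. They act on all values of \<open>(f, h, H, K)\<close>, including those
  with \<open>f H = 0\<close>. Removing that set would make the space disconnected and would admit spurious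
  transformations whose constants depend on the signs of \<open>f\<close> and \<open>H\<close>.\<close>

definition usual_equivalence_group :: "point set \<Rightarrow> (point \<times> elts \<Rightarrow> point \<times> elts) set" where
  "usual_equivalence_group \<Omega> = {T.
     nondegenerate (\<Omega> \<times> UNIV) T \<and>
     (\<exists>P. projects_to \<Omega> T P \<and>
       (\<forall>f h H K. in_class \<Omega> f h H K \<longrightarrow>
         (\<exists>f' h' H' K'.
            in_class (P ` \<Omega>) f' h' H' K' \<and>
            (\<forall>(t, x, u)\<in>\<Omega>. case P (t, x, u) of (t', x', u') \<Rightarrow>
               snd (T ((t, x, u), (f x, h x, H u, K u))) = (f' x', h' x', H' u', K' u')) \<and>
            transforms_eq \<Omega> P (wave_eq f h H K) (wave_eq f' h' H' K'))))}"

end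

theory Submission
  imports Defs
begin

text \<open>Fix a point and the values of the arbitrary elements there. Two functions \<open>u\<close> with the same
  1-jet have transformed 2-jets differing by \<open>J\<^sup>T \<Delta>S' J = \<kappa> \<Delta>S\<close>, with \<open>J\<close> the total Jacobian of
  \<open>(t', x')\<close>, so equivalence of the equations forces \<open>f' dx'\<^sup>2 - H' dt'\<^sup>2\<close> to be proportional to
  \<open>f dx\<^sup>2 - H dt\<^sup>2\<close>. As this holds for all first derivatives of \<open>u\<close> and all values of \<open>f\<close>, \<open>H\<close>, while
  the point transformation does not depend on them, \<open>t'\<close> and \<open>x'\<close> do not depend on \<open>u\<close> and are, up to
  an exchange, functions of \<open>t\<close> and of \<open>x\<close>.

  Since the new \<open>f'\<close>, \<open>h'\<close> depend on \<open>x'\<close> only, the new \<open>H'\<close>, \<open>K'\<close> on \<open>u'\<close> only, and the slopes of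
  \<open>f\<close>, \<open>h\<close>, \<open>H\<close>, \<open>K\<close> at the point are arbitrary, the derivatives of the components of the
  transformation in the unwanted directions vanish. This excludes the exchange, gives \<open>u' = U(u)\<close>,
  \<open>f' = \<mu>(x) f\<close>, \<open>H' = \<lambda>(u) H\<close>, and separation of variables in \<open>\<lambda> t'\<^sub>t\<^sup>2 = \<mu> x'\<^sub>x\<^sup>2\<close> makes \<open>\<lambda>\<close> and \<open>t'\<^sub>t\<close>
  constant. Comparing the terms \<open>u\<^sub>t\<^sup>2\<close> and \<open>u\<^sub>x\<close> yields \<open>U'' = 0\<close> and
  \<open>h' K' x'\<^sub>x\<^sup>2 = \<lambda> (h K x'\<^sub>x + H x'\<^sub>x\<^sub>x)\<close>; the left side is a product of a function of \<open>(f, h)\<close> and one of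
  \<open>(H, K)\<close>, whence \<open>x'\<^sub>x\<^sub>x = 0\<close> and \<open>h'\<close>, \<open>K'\<close> are proportional to \<open>h\<close>, \<open>K\<close>. Values with \<open>f H = 0\<close> are
  reached by continuity.\<close>

section \<open>Calculus of \<open>C\<^sup>k\<close> functions\<close>

text \<open>Three obstacles shape the proof. The hypothesis \<open>transforms_eq\<close> speaks only
  of functions \<open>u\<close>, \<open>u'\<close> whose graphs correspond, so an image function
  must be produced by the inverse function theorem before a jet can be tested. This needs a nonzero
  total Jacobian of (t', x'); the relations found there extend to the other first derivatives by
  continuity. Next, each choice of the old elements brings its own new elements. What ties the
  derivatives of a component of \<open>T\<close> together is the slope of the new element at the
  image point, which is common to the three coordinate directions; this is
  \<open>intertwines\<close>. Finally, the domain is any connected open set and not a product of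
  intervals. Dependence on one variable is therefore expressed by vanishing partial derivatives, and
  constants appear only at the end, through connectedness. Second derivatives are taken along lines
  of the (t, x) plane lifted to the graph, which keeps the chain rule in one real variable; three
  directions determine the quadratic form. Increments of second derivatives leave the 1-jet alone,
  so all lower-order terms cancel in differences.\<close>

abbreviation fd :: "('a::real_normed_vector \<Rightarrow> 'b::real_normed_vector) \<Rightarrow> 'a \<Rightarrow> 'a \<Rightarrow> 'b" where
  "fd f x \<equiv> frechet_derivative f (at x)"

lemma fd_has_derivative: "f differentiable (at x) \<Longrightarrow> (f has_derivative fd f x) (at x)"
  using frechet_derivative_works by blast

lemma fd_eqI: "(f has_derivative f') (at x) \<Longrightarrow> fd f x = f'"
  using frechet_derivative_at by metis

lemma linear_fd: "f differentiable (at x) \<Longrightarrow> linear (fd f x)"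
  by (rule linear_frechet_derivative)

text \<open>\<open>frechet_derivative\<close> is a choice among the derivatives at the point.
  Functions that agree near the point have the same derivatives, so the choices coincide, even where
  no derivative exists.\<close>

lemma fd_transform_open:
  assumes "open S" "x \<in> S" "\<And>y. y \<in> S \<Longrightarrow> f y = g y"
  shows "fd f x = fd g x"
proof -
  have "(f has_derivative f') (at x) \<longleftrightarrow> (g has_derivative f') (at x)" for f'
    using assms has_derivative_transform_within_open[of f f' x UNIV S g]
      has_derivative_transform_within_open[of g f' x UNIV S f] by auto
  then show ?thesis
    by (simp add: frechet_derivative_def)
qed

lemma differentiable_transform_open:
  assumes "open S" "x \<in> S" "\<And>y. y \<in> S \<Longrightarrow> f y = g y" "f differentiable (at x)"
  shows "g differentiable (at x)"
  using assms has_derivative_transform_within_open[of f _ x UNIV S g]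
  unfolding differentiable_def by blast

lemma Ck_on_cong:
  assumes "open S" "\<And>x. x \<in> S \<Longrightarrow> f x = g x" "Ck_on k S f"
  shows "Ck_on k S g"
  using assms(2,3)
proof (induction k arbitrary: f g)
  case 0
  then show ?case by (simp cong: continuous_on_cong)
next
  case (Suc k)
  have "\<forall>x\<in>S. g differentiable (at x)"
    using Suc.prems differentiable_transform_open[OF assms(1), of _ f g] by auto
  moreover have "Ck_on k S (\<lambda>x. fd g x v)" for v
  proof (rule Suc.IH[of "\<lambda>x. fd f x v"])
    show "\<And>x. x \<in> S \<Longrightarrow> fd f x v = fd g x v"
      using fd_transform_open[OF assms(1), of _ f g] Suc.prems(1) by metis
    show "Ck_on k S (\<lambda>x. fd f x v)" using Suc.prems(2) by simp
  qed
  ultimately show ?case by simp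
qed

lemma Ck_on_subset: "Ck_on k S f \<Longrightarrow> S' \<subseteq> S \<Longrightarrow> Ck_on k S' f"
  by (induction k arbitrary: f) (auto intro: continuous_on_subset)

lemma Ck_on_SucD: "Ck_on (Suc k) S f \<Longrightarrow> Ck_on k S f"
proof (induction k arbitrary: f)
  case 0
  then show ?case
    by (auto intro!: continuous_at_imp_continuous_on differentiable_imp_continuous_within)
next
  case (Suc k)
  then show ?case by auto
qed

lemma Ck_on_mono: "Ck_on k S f \<Longrightarrow> j \<le> k \<Longrightarrow> Ck_on j S f"
  by (induction k) (auto simp: le_Suc_eq simp del: Ck_on.simps dest: Ck_on_SucD)

lemma Ck_on_differentiable: "Ck_on k S f \<Longrightarrow> 0 < k \<Longrightarrow> x \<in> S \<Longrightarrow> f differentiable (at x)"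
  by (cases k) auto

lemma Ck_on_fd: "Ck_on (Suc k) S f \<Longrightarrow> Ck_on k S (\<lambda>x. fd f x v)"
  by simp

lemma Ck_on_2_fd_differentiable:
  "Ck_on 2 S f \<Longrightarrow> x \<in> S \<Longrightarrow> (\<lambda>y. fd f y v) differentiable (at x)"
  by (simp add: numeral_2_eq_2)

lemma fd_const: "fd (\<lambda>x. c) x = (\<lambda>v. 0)"
  by (rule fd_eqI) (rule has_derivative_const)

lemma Ck_on_const: "Ck_on k S (\<lambda>x. c)"
proof (induction k arbitrary: c)
  case (Suc k)
  then show ?case using fd_const[of c] by simp
qed simp

lemma Ck_on_bounded_linear_compose:
  assumes "open S" "bounded_linear L" "Ck_on k S f"
  shows "Ck_on k S (\<lambda>x. L (f x))"
  using assms(3)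
proof (induction k arbitrary: f)
  case 0
  then show ?case using bounded_linear.continuous_on[OF assms(2)] by auto
next
  case (Suc k)
  have der: "((\<lambda>x. L (f x)) has_derivative (\<lambda>v. L (fd f x v))) (at x)" if "x \<in> S" for x
    using Suc.prems that
    by (intro bounded_linear.has_derivative[OF assms(2)] fd_has_derivative) auto
  then have "(\<lambda>x. L (f x)) differentiable (at x)" if "x \<in> S" for x
    using that differentiableI by blast
  moreover have "Ck_on k S (\<lambda>x. fd (\<lambda>x. L (f x)) x v)" for v
    by (rule Ck_on_cong[OF assms(1) _ Suc.IH[of "\<lambda>x. fd f x v"]])
      (use fd_eqI[OF der] Suc.prems in auto)
  ultimately show ?case by simp
qed

lemma Ck_on_ident: "Ck_on k S (\<lambda>x. x)"
proof (cases k)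
  case (Suc j)
  have "fd (\<lambda>y. y) x v = v" for x v :: 'a
    using fd_eqI[OF has_derivative_ident, of x] by simp
  then show ?thesis by (simp add: Suc Ck_on_const)
qed simp

lemma Ck_on_bounded_linear: "bounded_linear L \<Longrightarrow> Ck_on k S L"
  using Ck_on_bounded_linear_compose[OF open_UNIV _ Ck_on_ident] Ck_on_subset by blast

lemma Ck_on_add:
  assumes "open S" "Ck_on k S f" "Ck_on k S g"
  shows "Ck_on k S (\<lambda>x. f x + g x)"
  using assms(2,3)
proof (induction k arbitrary: f g)
  case 0
  then show ?case by (auto intro: continuous_on_add)
next
  case (Suc k)
  have der: "((\<lambda>x. f x + g x) has_derivative (\<lambda>v. fd f x v + fd g x v)) (at x)" if "x \<in> S" for x
    using Suc.prems that by (auto intro!: has_derivative_add fd_has_derivative)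
  then have "(\<lambda>x. f x + g x) differentiable (at x)" if "x \<in> S" for x
    using that differentiableI by blast
  moreover have "Ck_on k S (\<lambda>x. fd (\<lambda>x. f x + g x) x v)" for v
    by (rule Ck_on_cong[OF assms(1) _ Suc.IH[of "\<lambda>x. fd f x v" "\<lambda>x. fd g x v"]])
      (use fd_eqI[OF der] Suc.prems in auto)
  ultimately show ?case by simp
qed

lemma Ck_on_sum:
  assumes "open S" "\<And>i. i \<in> I \<Longrightarrow> Ck_on k S (f i)"
  shows "Ck_on k S (\<lambda>x. \<Sum>i\<in>I. f i x)"
  using assms(2)
  by (induction I rule: infinite_finite_induct) (auto intro: Ck_on_const Ck_on_add[OF assms(1)])

text \<open>One Leibniz induction for scalar multiples and real products; in each step the
  undifferentiated factor is used with one order of smoothness less.\<close>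

lemma Ck_on_bilinear:
  assumes "open S" "bounded_bilinear B" "Ck_on k S f" "Ck_on k S g"
  shows "Ck_on k S (\<lambda>x. B (f x) (g x))"
  using assms(3,4)
proof (induction k arbitrary: f g)
  case 0
  then show ?case by (auto intro: bounded_bilinear.continuous_on[OF assms(2)])
next
  case (Suc k)
  have der: "((\<lambda>x. B (f x) (g x)) has_derivative (\<lambda>v. B (f x) (fd g x v) + B (fd f x v) (g x))) (at x)"
    if "x \<in> S" for x
    using Suc.prems that
    by (intro bounded_bilinear.FDERIV[OF assms(2)] fd_has_derivative) auto
  then have "(\<lambda>x. B (f x) (g x)) differentiable (at x)" if "x \<in> S" for x
    using that differentiableI by blast
  moreover have "Ck_on k S (\<lambda>x. fd (\<lambda>x. B (f x) (g x)) x v)" for v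
  proof (rule Ck_on_cong[OF assms(1)])
    show "Ck_on k S (\<lambda>x. B (f x) (fd g x v) + B (fd f x v) (g x))"
      using Suc.prems
      by (intro Ck_on_add[OF assms(1)] Suc.IH) (auto intro: Ck_on_SucD simp del: Ck_on.simps simp: Ck_on_fd)
  qed (use fd_eqI[OF der] in auto)
  ultimately show ?case by simp
qed

lemmas Ck_on_scaleR = Ck_on_bilinear[OF _ bounded_bilinear_scaleR]
lemmas Ck_on_mult = Ck_on_bilinear[OF _ bounded_bilinear_mult]

lemma Ck_on_minus:
  assumes "open S" "Ck_on k S f" shows "Ck_on k S (\<lambda>x. - f x)"
  using Ck_on_bounded_linear_compose[OF assms(1) bounded_linear_minus[OF bounded_linear_ident] assms(2)] .

lemma Ck_on_diff:
  assumes "open S" "Ck_on k S f" "Ck_on k S g" shows "Ck_on k S (\<lambda>x. f x - g x)"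
  using Ck_on_add[OF assms(1,2) Ck_on_minus[OF assms(1,3)]] by simp

text \<open>\<open>Ck_on\<close> controls derivatives in fixed directions only. Expanding in the
  basis handles directions that move with the point, as they do in the chain rule.\<close>

lemma fd_basis_expansion:
  fixes f :: "'a::euclidean_space \<Rightarrow> 'b::real_normed_vector"
  assumes "f differentiable (at x)"
  shows "fd f x v = (\<Sum>b\<in>Basis. (v \<bullet> b) *\<^sub>R fd f x b)"
proof -
  have "fd f x v = fd f x (\<Sum>b\<in>Basis. (v \<bullet> b) *\<^sub>R b)"
    by (simp add: euclidean_representation)
  also have "\<dots> = (\<Sum>b\<in>Basis. (v \<bullet> b) *\<^sub>R fd f x b)"
    by (simp add: linear_sum[OF linear_fd[OF assms]] linear_scale[OF linear_fd[OF assms]])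
  finally show ?thesis .
qed

lemma Ck_on_compose:
  assumes "open S" "Ck_on k T f" "Ck_on k S g" "\<And>x. x \<in> S \<Longrightarrow> g x \<in> T"
  shows "Ck_on k S (\<lambda>x. f (g x))"
  using assms(2,3)
proof (induction k arbitrary: f)
  case 0
  then show ?case using assms(4)
    by (auto intro: continuous_on_compose2[of T f S g])
next
  case (Suc k)
  have df: "f differentiable (at (g x))" and dg: "g differentiable (at x)" if "x \<in> S" for x
    using Suc.prems that assms(4) by auto
  have der: "((\<lambda>x. f (g x)) has_derivative (\<lambda>v. fd f (g x) (fd g x v))) (at x)" if "x \<in> S" for x
    using has_derivative_compose[OF fd_has_derivative[OF dg[OF that]] fd_has_derivative[OF df[OF that]]]
    by (simp add: o_def)
  then have "(\<lambda>x. f (g x)) differentiable (at x)" if "x \<in> S" for x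
    using that differentiableI by blast
  moreover have "Ck_on k S (\<lambda>x. fd (\<lambda>x. f (g x)) x v)" for v
  proof (rule Ck_on_cong[OF assms(1)])
    show "Ck_on k S (\<lambda>x. \<Sum>b\<in>Basis. (fd g x v \<bullet> b) *\<^sub>R fd f (g x) b)"
    proof (intro Ck_on_sum Ck_on_scaleR assms(1))
      fix b
      show "Ck_on k S (\<lambda>x. fd g x v \<bullet> b)"
        using Ck_on_bounded_linear_compose[OF assms(1) bounded_linear_inner_left Ck_on_fd[OF Suc.prems(2)]] .
      show "Ck_on k S (\<lambda>x. fd f (g x) b)"
        by (rule Suc.IH[OF Ck_on_fd[OF Suc.prems(1)] Ck_on_SucD[OF Suc.prems(2)]])
    qed
    show "(\<Sum>b\<in>Basis. (fd g x v \<bullet> b) *\<^sub>R fd f (g x) b) = fd (\<lambda>x. f (g x)) x v" if "x \<in> S" for x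
      using fd_eqI[OF der[OF that]] fd_basis_expansion[OF df[OF that], of "fd g x v"] by simp
  qed
  ultimately show ?case by simp
qed

text \<open>The derivative is a polynomial in the inverse itself and \<open>fd g\<close>, so the
  induction hypothesis applies to the inverse again.\<close>

lemma Ck_on_inverse:
  fixes g :: "'a::euclidean_space \<Rightarrow> real"
  assumes "open S" "Ck_on k S g" "\<And>x. x \<in> S \<Longrightarrow> g x \<noteq> 0"
  shows "Ck_on k S (\<lambda>x. inverse (g x))"
  using assms(2)
proof (induction k)
  case 0
  then show ?case using assms(3) by (auto intro: continuous_on_inverse)
next
  case (Suc k)
  have der: "((\<lambda>x. inverse (g x)) has_derivative (\<lambda>v. - (inverse (g x) * fd g x v * inverse (g x)))) (at x)"
    if "x \<in> S" for x
    using Suc.prems that assms(3) by (intro Deriv.has_derivative_inverse fd_has_derivative) auto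
  then have "(\<lambda>x. inverse (g x)) differentiable (at x)" if "x \<in> S" for x
    using that differentiableI by blast
  moreover have "Ck_on k S (\<lambda>x. fd (\<lambda>x. inverse (g x)) x v)" for v
  proof (rule Ck_on_cong[OF assms(1)])
    have "Ck_on k S (\<lambda>x. inverse (g x))" using Suc Ck_on_SucD by blast
    then show "Ck_on k S (\<lambda>x. - (inverse (g x) * fd g x v * inverse (g x)))"
      by (intro Ck_on_minus Ck_on_mult assms(1) Ck_on_fd[OF Suc.prems])
  qed (use fd_eqI[OF der] in auto)
  ultimately show ?case by simp
qed

lemma Ck_on_Pair:
  assumes "open S" "Ck_on k S f" "Ck_on k S g"
  shows "Ck_on k S (\<lambda>x. (f x, g x))"
proof -
  have "Ck_on k S (\<lambda>x. (f x, 0) + (0, g x))"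
    by (intro Ck_on_add assms(1)
        Ck_on_bounded_linear_compose[where L="\<lambda>y. (y, 0)", OF assms(1) _ assms(2)]
        Ck_on_bounded_linear_compose[where L="\<lambda>y. (0, y)", OF assms(1) _ assms(3)]
        bounded_linear_Pair bounded_linear_ident bounded_linear_zero)
  then show ?thesis by simp
qed

lemma Ck_on_fst: "open S \<Longrightarrow> Ck_on k S f \<Longrightarrow> Ck_on k S (\<lambda>x. fst (f x))"
  by (rule Ck_on_bounded_linear_compose[OF _ bounded_linear_fst])

lemma Ck_on_snd: "open S \<Longrightarrow> Ck_on k S f \<Longrightarrow> Ck_on k S (\<lambda>x. snd (f x))"
  by (rule Ck_on_bounded_linear_compose[OF _ bounded_linear_snd])

section \<open>The inverse function theorem in the plane\<close>

lemma linear_real_prod_expansion: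
  fixes L :: "real \<times> real \<Rightarrow> 'b::real_vector"
  assumes "linear L"
  shows "L (a, b) = a *\<^sub>R L (1, 0) + b *\<^sub>R L (0, 1)"
proof -
  have "(a, b) = a *\<^sub>R (1, 0) + b *\<^sub>R (0, 1::real)" by simp
  then show ?thesis by (metis assms linear_add linear_scale)
qed

text \<open>Cramer's rule. The determinant enters as a factor through \<open>inverse\<close>, the
  shape to which \<open>Ck_on_inverse\<close> and \<open>Ck_on_mult\<close> apply.\<close>

lemma real2_linear_inverse:
  fixes L :: "real \<times> real \<Rightarrow> real \<times> real"
  assumes "linear L"
  defines "a \<equiv> fst (L (1, 0))" and "c \<equiv> snd (L (1, 0))"
    and "b \<equiv> fst (L (0, 1))" and "d \<equiv> snd (L (0, 1))"
  assumes "a * d - b * c \<noteq> 0"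
  defines "M \<equiv> \<lambda>(v, w). ((d * v - b * w) * inverse (a * d - b * c), (a * w - c * v) * inverse (a * d - b * c))"
  shows "L (M y) = y" "M (L y) = y"
proof -
  have L: "L (v, w) = (a * v + b * w, c * v + d * w)" for v w
    unfolding linear_real_prod_expansion[OF assms(1), of v w] a_def b_def c_def d_def
    by (simp add: prod_eq_iff mult.commute)
  define e where "e = inverse (a * d - b * c)"
  have e: "(a * d - b * c) * e = 1" using assms(6) by (simp add: e_def)
  obtain v w where y: "y = (v, w)" by fastforce
  have "a * ((d * v - b * w) * e) + b * ((a * w - c * v) * e) = v * ((a * d - b * c) * e)"
    "c * ((d * v - b * w) * e) + d * ((a * w - c * v) * e) = w * ((a * d - b * c) * e)"
    "(d * (a * v + b * w) - b * (c * v + d * w)) * e = v * ((a * d - b * c) * e)"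
    "(a * (c * v + d * w) - c * (a * v + b * w)) * e = w * ((a * d - b * c) * e)"
    by algebra+
  then show "L (M y) = y" "M (L y) = y"
    unfolding y M_def split_conv L e_def[symmetric] e by simp_all
qed

text \<open>The regularity of the inverse is bootstrapped
  from the expression of its derivative by Cramer's rule.\<close>

lemma Ck_on_local_inverse:
  fixes \<phi> :: "real \<times> real \<Rightarrow> real \<times> real"
  assumes "open U" "Ck_on (Suc k) U \<phi>" "x0 \<in> U"
    and nz: "fst (fd \<phi> x0 (1, 0)) * snd (fd \<phi> x0 (0, 1)) - fst (fd \<phi> x0 (0, 1)) * snd (fd \<phi> x0 (1, 0)) \<noteq> 0"
  obtains N V g where "open N" "N \<subseteq> U" "x0 \<in> N" "open V" "\<And>x. x \<in> N \<Longrightarrow> \<phi> x \<in> V"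
    "\<And>x. x \<in> N \<Longrightarrow> g (\<phi> x) = x" "\<And>y. y \<in> V \<Longrightarrow> g y \<in> N" "\<And>y. y \<in> V \<Longrightarrow> \<phi> (g y) = y"
    "Ck_on (Suc k) V g"
proof -
  \<comment> \<open>The inverse is sought inside \<open>W\<close>, so that Cramer's formula for its
    derivative holds at every point and not only at \<open>x0\<close>.\<close>
  define W where "W = {x \<in> U. fst (fd \<phi> x (1, 0)) * snd (fd \<phi> x (0, 1)) - fst (fd \<phi> x (0, 1)) * snd (fd \<phi> x (1, 0)) \<noteq> 0}"
  let ?f = "\<lambda>x. Blinfun (fd \<phi> x)"
  have diff: "\<phi> differentiable (at x)" if "x \<in> U" for x using assms(2) that by simp
  have app: "blinfun_apply (?f x) = fd \<phi> x" if "x \<in> U" for x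
    using bounded_linear_Blinfun_apply has_derivative_bounded_linear fd_has_derivative diff that by blast
  have contv: "continuous_on U (\<lambda>x. fd \<phi> x v)" for v
    using Ck_on_mono[OF Ck_on_fd[OF assms(2)], of 0] by simp
  \<comment> \<open>The inverse function theorem wants the derivative continuous as an
    operator-valued map; in finite dimension continuity in each fixed direction gives this.\<close>
  have contf: "continuous_on U ?f"
    by (rule continuous_on_blinfun_componentwise) (use contv app in \<open>simp cong: continuous_on_cong\<close>)
  have "W = U \<inter> (\<lambda>x. fst (fd \<phi> x (1, 0)) * snd (fd \<phi> x (0, 1)) - fst (fd \<phi> x (0, 1)) * snd (fd \<phi> x (1, 0))) -` (- {0})"
    by (auto simp: W_def)
  also have "open \<dots>"
    by (intro continuous_open_preimage continuous_intros contv assms(1))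
  finally have W: "open W" "W \<subseteq> U" "x0 \<in> W" using assms nz by (auto simp: W_def)
  have lin: "linear (fd \<phi> x)" if "x \<in> U" for x by (rule linear_fd[OF diff[OF that]])
  define M where "M x y = ((snd (fd \<phi> x (0, 1)) * fst y - fst (fd \<phi> x (0, 1)) * snd y) *
      inverse (fst (fd \<phi> x (1, 0)) * snd (fd \<phi> x (0, 1)) - fst (fd \<phi> x (0, 1)) * snd (fd \<phi> x (1, 0))),
      (fst (fd \<phi> x (1, 0)) * snd y - snd (fd \<phi> x (1, 0)) * fst y) *
      inverse (fst (fd \<phi> x (1, 0)) * snd (fd \<phi> x (0, 1)) - fst (fd \<phi> x (0, 1)) * snd (fd \<phi> x (1, 0))))"
    for x y
  have M: "fd \<phi> x (M x y) = y" "M x (fd \<phi> x y) = y" if "x \<in> W" for x y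
    using real2_linear_inverse[OF lin, of x y] that
    unfolding M_def W_def by (auto simp: case_prod_unfold)
  have "bounded_linear (M x0)"
    unfolding M_def
    by (intro bounded_linear_Pair bounded_linear_mult_const bounded_linear_sub
        bounded_linear_const_mult bounded_linear_fst bounded_linear_snd)
  then have invM: "Blinfun (M x0) o\<^sub>L ?f x0 = id_blinfun"
    using M(2)[OF W(3)] app[OF assms(3)]
    by (intro blinfun_eqI) (simp add: bounded_linear_Blinfun_apply)
  obtain N V g g' where N: "open N" "N \<subseteq> W" "x0 \<in> N" "open V" "\<phi> x0 \<in> V" "homeomorphism N V \<phi> g"
    and g': "\<And>y. y \<in> V \<Longrightarrow> (g has_derivative (g' y)) (at y)"
      "\<And>y. y \<in> V \<Longrightarrow> g' y = inv (blinfun_apply (?f (g y)))"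
  proof (rule inverse_function_theorem[where f=\<phi> and f'="?f" and U=W and ?x0.0=x0 and invf="Blinfun (M x0)"])
    show "(\<phi> has_derivative blinfun_apply (?f x)) (at x)" if "x \<in> W" for x
      using that W(2) app diff fd_has_derivative by (metis subsetD)
    show "continuous_on W ?f" using contf W(2) continuous_on_subset by blast
  qed (use W invM in blast)+
  have gN: "g y \<in> N" if "y \<in> V" for y using N(6) that by (auto simp: homeomorphism_def)
  have "g' y = M (g y)" if "y \<in> V" for y
  proof -
    have "g y \<in> W" using gN[OF that] N(2) by blast
    then have "inv (fd \<phi> (g y)) = M (g y)"
      using M by (intro inv_unique_comp) (auto simp: o_def id_def)
    then show ?thesis using g'(2)[OF that] app \<open>g y \<in> W\<close> W(2) by (metis subsetD)
  qed
  then have dg: "(g has_derivative M (g y)) (at y)" if "y \<in> V" for y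
    using g'(1)[OF that] that by metis
  have "Ck_on j V g" if "j \<le> Suc k" for j
    using that
  proof (induction j)
    case 0
    then show ?case using N(6) by (simp add: homeomorphism_def)
  next
    case (Suc j)
    then have IH: "Ck_on j V g" by simp
    have comp: "Ck_on j V (\<lambda>y. fd \<phi> (g y) v)" for v
      by (rule Ck_on_compose[OF N(4) Ck_on_mono[OF Ck_on_fd[OF assms(2), of v]] IH])
        (use Suc.prems gN N(2) W(2) in auto)
    have "Ck_on j V (\<lambda>y. fd g y v)" for v
    proof (rule Ck_on_cong[OF N(4)])
      show "M (g y) v = fd g y v" if "y \<in> V" for y using fd_eqI[OF dg[OF that]] by simp
      have nz': "fst (fd \<phi> (g y) (1, 0)) * snd (fd \<phi> (g y) (0, 1)) - fst (fd \<phi> (g y) (0, 1)) * snd (fd \<phi> (g y) (1, 0)) \<noteq> 0"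
        if "y \<in> V" for y
        using gN[OF that] N(2) by (auto simp: W_def)
      show "Ck_on j V (\<lambda>y. M (g y) v)"
        unfolding M_def
        by (intro Ck_on_Pair Ck_on_mult Ck_on_diff Ck_on_const Ck_on_inverse Ck_on_fst Ck_on_snd comp N(4) nz')
    qed
    moreover have "g differentiable (at y)" if "y \<in> V" for y
      using dg[OF that] unfolding differentiable_def by blast
    ultimately show ?case by simp
  qed
  then have "Ck_on (Suc k) V g" by blast
  show ?thesis
  proof (rule that[OF N(1) subset_trans[OF N(2) W(2)] N(3,4) _ _ gN _ \<open>Ck_on (Suc k) V g\<close>])
  qed (use N(6) in \<open>auto simp: homeomorphism_def\<close>)
qed

section \<open>Prolongation of point transformations\<close>

lemma has_real_derivative_along:
  fixes F :: "'a::real_normed_vector \<Rightarrow> real"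
  assumes "F differentiable (at (c s))" "(c has_vector_derivative v) (at s)"
  shows "((\<lambda>s. F (c s)) has_real_derivative fd F (c s) v) (at s)"
proof -
  have "((\<lambda>s. F (c s)) has_derivative (\<lambda>h. fd F (c s) (h *\<^sub>R v))) (at s)"
    using has_derivative_compose[OF assms(2)[unfolded has_vector_derivative_def] fd_has_derivative[OF assms(1)]]
    by (simp add: o_def)
  then show ?thesis
    by (simp add: has_field_derivative_def linear_scale[OF linear_fd[OF assms(1)]] mult_commute_abs)
qed

lemma fd_fd_expansion:
  fixes F :: "'a::euclidean_space \<Rightarrow> real"
  assumes "open S" "Ck_on 2 S F" "z \<in> S"
  shows "fd (\<lambda>y. fd F y v) z w = (\<Sum>b\<in>Basis. (v \<bullet> b) * fd (\<lambda>y. fd F y b) z w)"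
proof -
  have "fd (\<lambda>y. fd F y v) z = fd (\<lambda>y. \<Sum>b\<in>Basis. (v \<bullet> b) * fd F y b) z"
    using fd_basis_expansion[of F _ v] Ck_on_differentiable[OF assms(2)]
    by (intro fd_transform_open[OF assms(1,3)]) auto
  also have "\<dots> = (\<lambda>w. \<Sum>b\<in>Basis. (v \<bullet> b) * fd (\<lambda>y. fd F y b) z w)"
    by (intro fd_eqI has_derivative_sum has_derivative_mult_right fd_has_derivative
        Ck_on_2_fd_differentiable[OF assms(2,3)])
  finally show ?thesis by simp
qed

text \<open>The direction \<open>c1 r\<close> moves with the point: it is expanded in the fixed
  basis, differentiated by the product rule and reassembled. The first summand is the second
  derivative of \<open>F\<close> in the velocity, the other one comes from the acceleration
  \<open>c2\<close>.\<close>

lemma second_derivative_along: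
  fixes F :: "'a::euclidean_space \<Rightarrow> real"
  assumes "open S" "Ck_on 2 S F" "\<And>r. r \<in> I \<Longrightarrow> c r \<in> S" "open I" "s \<in> I"
    "(c has_vector_derivative c1 s) (at s)"
    "(c1 has_vector_derivative c2) (at s)"
  shows "((\<lambda>r. fd F (c r) (c1 r)) has_real_derivative
    fd (\<lambda>y. fd F y (c1 s)) (c s) (c1 s) + fd F (c s) c2) (at s)"
proof -
  have cs: "c s \<in> S" using assms(3,5) by blast
  have d: "((\<lambda>r. \<Sum>b\<in>Basis. (c1 r \<bullet> b) * fd F (c r) b) has_real_derivative
      (\<Sum>b\<in>Basis. (c1 s \<bullet> b) * fd (\<lambda>y. fd F y b) (c s) (c1 s) + (c2 \<bullet> b) * fd F (c s) b)) (at s)"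
  proof (rule DERIV_sum)
    fix b :: 'a
    have "((\<lambda>r. c1 r \<bullet> b) has_real_derivative c2 \<bullet> b) (at s)"
      using bounded_linear.has_vector_derivative[OF bounded_linear_inner_left assms(7)]
      by (simp add: has_real_derivative_iff_has_vector_derivative)
    from DERIV_mult[OF this has_real_derivative_along[OF Ck_on_2_fd_differentiable[OF assms(2) cs, of b] assms(6)]]
    show "((\<lambda>r. (c1 r \<bullet> b) * fd F (c r) b) has_real_derivative
      (c1 s \<bullet> b) * fd (\<lambda>y. fd F y b) (c s) (c1 s) + (c2 \<bullet> b) * fd F (c s) b) (at s)"
      by (simp add: algebra_simps)
  qed
  have "((\<lambda>r. fd F (c r) (c1 r)) has_real_derivative
      (\<Sum>b\<in>Basis. (c1 s \<bullet> b) * fd (\<lambda>y. fd F y b) (c s) (c1 s) + (c2 \<bullet> b) * fd F (c s) b)) (at s)"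
  proof (rule has_field_derivative_transform_within_open[OF d assms(4,5)])
    show "(\<Sum>b\<in>Basis. (c1 r \<bullet> b) * fd F (c r) b) = fd F (c r) (c1 r)" if "r \<in> I" for r
      using fd_basis_expansion[of F "c r" "c1 r"] Ck_on_differentiable[OF assms(2)] assms(3)[OF that] by simp
  qed
  also have "(\<Sum>b\<in>Basis. (c1 s \<bullet> b) * fd (\<lambda>y. fd F y b) (c s) (c1 s) + (c2 \<bullet> b) * fd F (c s) b) =
      fd (\<lambda>y. fd F y (c1 s)) (c s) (c1 s) + fd F (c s) c2"
    using fd_fd_expansion[OF assms(1,2) cs, of "c1 s" "c1 s"]
      fd_basis_expansion[of F "c s" c2] Ck_on_differentiable[OF assms(2) _ cs]
    by (simp add: sum.distrib)
  finally show ?thesis .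
qed

text \<open>If \<open>fd F y w\<close> vanishes on \<open>S\<close>, then \<open>F\<close> is
  locally invariant under small translations along \<open>w\<close>, and this invariance passes to
  \<open>fd F y v\<close>. It is the special case of interchanging two derivatives that the proof
  uses.\<close>

lemma fd_direction_invariant:
  fixes F :: "'a::euclidean_space \<Rightarrow> real"
  assumes "open S" "Ck_on 2 S F" "\<And>y. y \<in> S \<Longrightarrow> fd F y w = 0" "z \<in> S"
  shows "fd (\<lambda>y. fd F y v) z w = 0"
proof -
  obtain r where r: "r > 0" "ball z r \<subseteq> S" using assms(1,4) openE by blast
  \<comment> \<open>Half the radius for the base point and half for the shift: the translated point
    stays in the ball.\<close>
  define I where "I = {s. norm (s *\<^sub>R w) < r / 2}"
  have I: "open I"
    unfolding I_def by (intro open_Collect_less continuous_intros)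
  have I0: "0 \<in> I" using r(1) by (simp add: I_def)
  have line: "((\<lambda>\<tau>. y + \<tau> *\<^sub>R w) has_vector_derivative w) (at s)" for y s
    unfolding has_vector_derivative_def by (auto intro!: derivative_eq_intros)
  have inv: "F (y + s *\<^sub>R w) = F y" if "y \<in> ball z (r/2)" "s \<in> I" for y s
  proof -
    have yS: "y + \<tau> *\<^sub>R w \<in> S" if "\<tau> \<in> closed_segment 0 s" for \<tau>
    proof -
      have "\<bar>\<tau>\<bar> \<le> \<bar>s\<bar>" using that by (auto simp: closed_segment_eq_real_ivl split: if_splits)
      then have "norm (\<tau> *\<^sub>R w) \<le> norm (s *\<^sub>R w)" by (simp add: mult_right_mono)
      also have "\<dots> < r/2" using \<open>s \<in> I\<close> by (simp add: I_def)
      finally have "dist y (y + \<tau> *\<^sub>R w) < r/2" by (simp add: dist_norm)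
      moreover have "dist z y < r/2" using \<open>y \<in> ball z (r/2)\<close> by simp
      ultimately have "dist z (y + \<tau> *\<^sub>R w) < r"
        using dist_triangle[of z "y + \<tau> *\<^sub>R w" y] by linarith
      then show ?thesis using r(2) by auto
    qed
    have "((\<lambda>\<tau>. F (y + \<tau> *\<^sub>R w)) has_real_derivative 0) (at \<tau> within closed_segment 0 s)"
      if "\<tau> \<in> closed_segment 0 s" for \<tau>
    proof -
      have "F differentiable (at (y + \<tau> *\<^sub>R w))"
        using Ck_on_differentiable[OF assms(2) _ yS[OF that]] by simp
      from has_real_derivative_along[OF this line] show ?thesis
        unfolding assms(3)[OF yS[OF that]] by (rule has_field_derivative_at_within)
    qed
    then obtain d where "\<And>\<tau>. \<tau> \<in> closed_segment 0 s \<Longrightarrow> F (y + \<tau> *\<^sub>R w) = d"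
      using has_field_derivative_zero_constant[OF convex_closed_segment] by blast
    from this[of 0] this[of s] show ?thesis by simp
  qed
  have zS: "z + s *\<^sub>R w \<in> S" if "s \<in> I" for s
    using that r by (intro subsetD[OF r(2)]) (simp add: I_def dist_norm)
  have const: "fd F (z + s *\<^sub>R w) v = fd F z v" if "s \<in> I" for s
  proof -
    have "((\<lambda>y. y + s *\<^sub>R w) has_derivative (\<lambda>y. y)) (at z)"
      by (auto intro!: derivative_eq_intros)
    from has_derivative_compose[OF this fd_has_derivative[OF Ck_on_differentiable[OF assms(2) _ zS[OF that]]]]
    have "fd (\<lambda>y. F (y + s *\<^sub>R w)) z = fd F (z + s *\<^sub>R w)"
      by (intro fd_eqI) (simp add: o_def)
    moreover have "fd (\<lambda>y. F (y + s *\<^sub>R w)) z = fd F z"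
      using inv that r(1) by (intro fd_transform_open[OF open_ball, of _ z "r/2"]) auto
    ultimately show ?thesis by simp
  qed
  have "((\<lambda>s. fd F (z + s *\<^sub>R w) v) has_real_derivative fd (\<lambda>y. fd F y v) z w) (at 0)"
    using has_real_derivative_along[OF _ line, of "\<lambda>y. fd F y v" z 0]
      Ck_on_2_fd_differentiable[OF assms(2,4)]
    by simp
  moreover have "((\<lambda>s. fd F (z + s *\<^sub>R w) v) has_real_derivative 0) (at 0)"
    by (rule has_field_derivative_transform_within_open[OF DERIV_const I I0, of "fd F z v"]) (simp add: const)
  ultimately show ?thesis by (rule DERIV_unique)
qed

text \<open>The curve \<open>c\<close> lifts the line through (t, x) with direction (a, b) to the
  graph of \<open>u\<close>, and \<open>\<gamma>\<close> is its image in the (t', x') plane. The two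
  claims are the first and second derivatives of \<open>u' (\<gamma> s) = U (c s)\<close> at 0;
  \<open>Q\<close> is the acceleration of the lift.\<close>

lemma graph_jets:
  fixes T X U :: "point \<Rightarrow> real" and a b :: real
  assumes "open \<Omega>" "Ck_on 2 \<Omega> T" "Ck_on 2 \<Omega> X" "Ck_on 2 \<Omega> U"
    and P: "\<forall>z\<in>\<Omega>. P z = (T z, X z, U z)"
    and "open N" "open N'" "Ck_on 2 N u" "Ck_on 2 N' u'" "maps_graph \<Omega> P N u N' u'" "(t, x) \<in> N"
  defines "z \<equiv> (t, x, u (t, x))"
  defines "w \<equiv> (a, b, fd u (t, x) (a, b))" and "Q \<equiv> fd (\<lambda>q. fd u q (a, b)) (t, x) (a, b)"
  defines "w' \<equiv> (fd T z w, fd X z w)"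
  shows "fd u' (T z, X z) w' = fd U z w"
    and "fd (\<lambda>q. fd u' q w') (T z, X z) w' +
       fd u' (T z, X z) (fd (\<lambda>q. fd T q w) z w + fd T z (0, 0, Q), fd (\<lambda>q. fd X q w) z w + fd X z (0, 0, Q))
       = fd (\<lambda>q. fd U q w) z w + fd U z (0, 0, Q)"
proof -
  define c0 where "c0 s = (t + s * a, x + s * b)" for s
  define c where "c s = (t + s * a, x + s * b, u (c0 s))" for s
  define c1 where "c1 s = (a, b, fd u (c0 s) (a, b))" for s
  define \<gamma> where "\<gamma> s = (T (c s), X (c s))" for s
  define \<gamma>1 where "\<gamma>1 s = (fd T (c s) (c1 s), fd X (c s) (c1 s))" for s
  define I where "I = c0 -` N"
  have "open I"
    unfolding I_def c0_def by (intro open_vimage assms(6) continuous_intros)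
  have "0 \<in> I" using assms(11) by (simp add: I_def c0_def)
  have at0: "c 0 = z" "c1 0 = w" "c0 0 = (t, x)" "\<gamma> 0 = (T z, X z)" "\<gamma>1 0 = w'"
    by (simp_all add: c_def c0_def c1_def z_def w_def w'_def \<gamma>_def \<gamma>1_def)
  have graph: "c s \<in> \<Omega>" "\<gamma> s \<in> N'" "u' (\<gamma> s) = U (c s)" if "s \<in> I" for s
  proof -
    show "c s \<in> \<Omega>" using assms(10) that unfolding maps_graph_def I_def c0_def c_def by auto
    then show "\<gamma> s \<in> N'" "u' (\<gamma> s) = U (c s)"
      using assms(10) that bspec[OF P, of "c s"] unfolding maps_graph_def I_def \<gamma>_def by (auto simp: c0_def c_def)
  qed
  note vec = has_real_derivative_iff_has_vector_derivative[THEN iffD1]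
  have affine: "((\<lambda>s. \<alpha> + s * \<beta>) has_vector_derivative \<beta>) (at s)" for \<alpha> \<beta> s :: real
    by (rule vec) (auto intro!: derivative_eq_intros)
  have c0': "(c0 has_vector_derivative (a, b)) (at s)" for s
    unfolding c0_def by (intro has_vector_derivative_Pair affine)
  have c': "(c has_vector_derivative c1 s) (at s)" if "s \<in> I" for s
  proof -
    have "u differentiable (at (c0 s))"
      using Ck_on_differentiable[OF assms(8)] that by (simp add: I_def)
    then show ?thesis
      unfolding c_def c1_def
      by (intro has_vector_derivative_Pair affine vec has_real_derivative_along c0')
  qed
  have Q: "((\<lambda>s. fd u (c0 s) (a, b)) has_real_derivative Q) (at 0)"
    using has_real_derivative_along[OF Ck_on_2_fd_differentiable[OF assms(8), of "c0 0"] c0'[of 0], of "(a, b)"]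
      assms(11) by (simp add: at0 Q_def)
  then have c'': "(c1 has_vector_derivative (0, 0, Q)) (at 0)"
    unfolding c1_def by (intro has_vector_derivative_Pair has_vector_derivative_const vec)
  have along: "((\<lambda>s. F (c s)) has_real_derivative fd F (c s) (c1 s)) (at s)"
    if "Ck_on 2 \<Omega> F" "s \<in> I" for F s
    using has_real_derivative_along[OF Ck_on_differentiable[OF that(1)] c'[OF that(2)]] graph(1)[OF that(2)] by simp
  have along2: "((\<lambda>s. fd F (c s) (c1 s)) has_real_derivative
      fd (\<lambda>q. fd F q w) z w + fd F z (0, 0, Q)) (at 0)" if "Ck_on 2 \<Omega> F" for F
    using second_derivative_along[OF assms(1) that graph(1) \<open>open I\<close> \<open>0 \<in> I\<close> c'[OF \<open>0 \<in> I\<close>] c'']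
    by (simp add: at0)
  have \<gamma>': "(\<gamma> has_vector_derivative \<gamma>1 s) (at s)" if "s \<in> I" for s
    unfolding \<gamma>_def \<gamma>1_def by (intro has_vector_derivative_Pair vec along that assms)
  have \<gamma>'': "(\<gamma>1 has_vector_derivative (fd (\<lambda>q. fd T q w) z w + fd T z (0, 0, Q),
      fd (\<lambda>q. fd X q w) z w + fd X z (0, 0, Q))) (at 0)"
    unfolding \<gamma>1_def by (intro has_vector_derivative_Pair vec along2 assms)
  have first: "fd u' (\<gamma> s) (\<gamma>1 s) = fd U (c s) (c1 s)" if "s \<in> I" for s
  proof (rule DERIV_unique)
    show "((\<lambda>s. u' (\<gamma> s)) has_real_derivative fd u' (\<gamma> s) (\<gamma>1 s)) (at s)"
      using has_real_derivative_along[OF Ck_on_differentiable[OF assms(9)] \<gamma>'[OF that]] graph(2)[OF that] by simp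
    show "((\<lambda>s. u' (\<gamma> s)) has_real_derivative fd U (c s) (c1 s)) (at s)"
      by (rule has_field_derivative_transform_within_open[OF along[OF assms(4) that] \<open>open I\<close> that])
        (simp add: graph(3))
  qed
  from first[OF \<open>0 \<in> I\<close>] show "fd u' (T z, X z) w' = fd U z w" by (simp add: at0)
  have "((\<lambda>s. fd u' (\<gamma> s) (\<gamma>1 s)) has_real_derivative
      fd (\<lambda>q. fd U q w) z w + fd U z (0, 0, Q)) (at 0)"
    by (rule has_field_derivative_transform_within_open[OF along2[OF assms(4)] \<open>open I\<close> \<open>0 \<in> I\<close>])
      (simp add: first)
  from DERIV_unique[OF second_derivative_along[OF assms(7,9) graph(2) \<open>open I\<close> \<open>0 \<in> I\<close> \<gamma>'[OF \<open>0 \<in> I\<close>] \<gamma>''] this]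
  show "fd (\<lambda>q. fd u' q w') (T z, X z) w' +
       fd u' (T z, X z) (fd (\<lambda>q. fd T q w) z w + fd T z (0, 0, Q), fd (\<lambda>q. fd X q w) z w + fd X z (0, 0, Q))
       = fd (\<lambda>q. fd U q w) z w + fd U z (0, 0, Q)"
    by (simp add: at0)
qed

lemma Dt_eq_fd:
  assumes "v differentiable (at (t, x))"
  shows "Dt v (t, x) = fd v (t, x) (1, 0)"
proof -
  have "((\<lambda>s. (s, x)) has_vector_derivative (1, 0)) (at t)"
    by (intro has_vector_derivative_Pair has_vector_derivative_id has_vector_derivative_const)
  from DERIV_imp_deriv[OF has_real_derivative_along[OF assms this]] show ?thesis
    by (simp add: Dt_def)
qed

lemma Dx_eq_fd:
  assumes "v differentiable (at (t, x))"
  shows "Dx v (t, x) = fd v (t, x) (0, 1)"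
proof -
  have "((\<lambda>y. (t, y)) has_vector_derivative (0, 1)) (at x)"
    by (intro has_vector_derivative_Pair has_vector_derivative_id has_vector_derivative_const)
  from DERIV_imp_deriv[OF has_real_derivative_along[OF assms this]] show ?thesis
    by (simp add: Dx_def)
qed

text \<open>Expanding the divergence term as H_u u_x^2 + H u_xx turns the equation at a point into a
  condition on the 2-jet of \<open>u\<close>, in which \<open>H\<close> occurs through its value and
  its slope at one point.\<close>

lemma wave_eq_iff_jet:
  assumes "open N" "Ck_on 2 N u" "(t, x) \<in> N" "(H has_real_derivative H1) (at (u (t, x)))"
  shows "wave_eq f h H K u (t, x) \<longleftrightarrow>
    f x * fd (\<lambda>q. fd u q (1, 0)) (t, x) (1, 0) =
    H1 * (fd u (t, x) (0, 1))\<^sup>2 + H (u (t, x)) * fd (\<lambda>q. fd u q (0, 1)) (t, x) (0, 1) +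
    h x * K (u (t, x)) * fd u (t, x) (0, 1)"
proof -
  have du: "u differentiable (at q)" if "q \<in> N" for q
    using Ck_on_differentiable[OF assms(2)] that by simp
  have ddu: "(\<lambda>q. fd u q v) differentiable (at (t, x))" for v
    by (rule Ck_on_2_fd_differentiable[OF assms(2,3)])
  have Dt: "Dt u q = fd u q (1, 0)" and Dx: "Dx u q = fd u q (0, 1)" if "q \<in> N" for q
    using Dt_eq_fd Dx_eq_fd du[OF that] by (cases q, auto)+
  have "Dt (Dt u) (t, x) = Dt (\<lambda>q. fd u q (1, 0)) (t, x)"
  proof -
    have "Dt u differentiable (at (t, x))"
      by (rule differentiable_transform_open[OF assms(1,3) Dt[symmetric] ddu])
    then show ?thesis
      using Dt_eq_fd[of "Dt u"] Dt_eq_fd[OF ddu] fd_transform_open[OF assms(1,3) Dt] by simp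
  qed
  then have tt: "Dt (Dt u) (t, x) = fd (\<lambda>q. fd u q (1, 0)) (t, x) (1, 0)"
    using Dt_eq_fd[OF ddu] by simp
  let ?G = "\<lambda>q. H (u q) * fd u q (0, 1)"
  have dH: "(H has_derivative (*) H1) (at (u (t, x)))"
    using assms(4) by (simp add: has_field_derivative_def)
  have G: "(?G has_derivative (\<lambda>v. H (u (t, x)) * fd (\<lambda>q. fd u q (0, 1)) (t, x) v +
      H1 * fd u (t, x) v * fd u (t, x) (0, 1))) (at (t, x))"
    using has_derivative_compose[OF fd_has_derivative[OF du[OF assms(3)]] dH]
    by (intro has_derivative_mult fd_has_derivative[OF ddu]) (simp add: o_def)
  then have dG: "?G differentiable (at (t, x))" unfolding differentiable_def by blast
  have eqG: "?G q = H (u q) * Dx u q" if "q \<in> N" for q using Dx[OF that] by simp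
  have "Dx (\<lambda>q. H (u q) * Dx u q) (t, x) = fd ?G (t, x) (0, 1)"
    using Dx_eq_fd[OF differentiable_transform_open[OF assms(1,3) eqG dG]]
      fd_transform_open[OF assms(1,3) eqG] by simp
  also have "\<dots> = H1 * (fd u (t, x) (0, 1))\<^sup>2 + H (u (t, x)) * fd (\<lambda>q. fd u q (0, 1)) (t, x) (0, 1)"
    by (simp add: fd_eqI[OF G] power2_eq_square algebra_simps)
  finally show ?thesis
    using tt Dx[OF assms(3)] by (simp add: wave_eq_def)
qed

text \<open>The Taylor polynomial with the prescribed 2-jet; \<open>w\<close> is the mixed second
  derivative, whence the factor 2.\<close>

lemma quadratic_jets:
  fixes t0 x0 u0 p q r w s :: real
  obtains v :: "real \<times> real \<Rightarrow> real" where "\<And>S. Ck_on 2 S v" "v (t0, x0) = u0"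
    "\<And>a b. fd v (t0, x0) (a, b) = p * a + q * b"
    "\<And>a b. fd (\<lambda>y. fd v y (a, b)) (t0, x0) (a, b) = r * a\<^sup>2 + 2 * w * a * b + s * b\<^sup>2"
proof -
  define v where "v y = u0 + p * (fst y - t0) + q * (snd y - x0) + r / 2 * ((fst y - t0) * (fst y - t0))
    + w * ((fst y - t0) * (snd y - x0)) + s / 2 * ((snd y - x0) * (snd y - x0))" for y
  have fd_v: "fd v y = (\<lambda>h. p * fst h + q * snd h + r * (fst y - t0) * fst h
     + w * (fst h * (snd y - x0) + (fst y - t0) * snd h) + s * (snd y - x0) * snd h)" for y
    unfolding v_def by (rule fd_eqI) (auto intro!: derivative_eq_intros simp: fun_eq_iff algebra_simps)
  show ?thesis
  proof
    show "Ck_on 2 S v" for S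
      unfolding v_def
      by (rule Ck_on_subset[OF _ subset_UNIV])
        (intro Ck_on_add Ck_on_mult Ck_on_diff Ck_on_const Ck_on_fst Ck_on_snd Ck_on_ident open_UNIV)
    show "v (t0, x0) = u0" by (simp add: v_def)
    show "fd v (t0, x0) (a, b) = p * a + q * b" for a b by (simp add: fd_v)
    have "fd (\<lambda>y. fd v y (a, b)) (t0, x0) =
        (\<lambda>h. r * fst h * a + w * (a * snd h + fst h * b) + s * snd h * b)" for a b
      unfolding fd_v by (rule fd_eqI) (auto intro!: derivative_eq_intros simp: fun_eq_iff algebra_simps)
    then show "fd (\<lambda>y. fd v y (a, b)) (t0, x0) (a, b) = r * a\<^sup>2 + 2 * w * a * b + s * b\<^sup>2" for a b
      by (simp add: power2_eq_square algebra_simps)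
  qed
qed

text \<open>A jet can be tested with \<open>transforms_eq\<close> only once the image of the graph
  is a graph again. When the total Jacobian of (t', x') along the graph is nonzero, the plane map
  \<open>\<phi>\<close> has a local inverse \<open>g\<close>, and \<open>U\<close> composed with the
  lift of \<open>g\<close> is the new function.\<close>

lemma image_graph_exists:
  fixes T X U :: "point \<Rightarrow> real"
  assumes "open \<Omega>" "Ck_on 2 \<Omega> T" "Ck_on 2 \<Omega> X" "Ck_on 2 \<Omega> U"
    and P: "\<forall>z\<in>\<Omega>. P z = (T z, X z, U z)"
    and u: "\<And>S. Ck_on 2 S u" and z: "z \<in> \<Omega>" "z = (t, x, u (t, x))"
  defines "a \<equiv> (1, 0, fd u (t, x) (1, 0))" and "b \<equiv> (0, 1, fd u (t, x) (0, 1))"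
  assumes "fd T z a * fd X z b - fd T z b * fd X z a \<noteq> 0"
  obtains N N' u' where "open N" "open N'" "Ck_on 2 N' u'" "(t, x) \<in> N" "maps_graph \<Omega> P N u N' u'"
proof -
  define gr where "gr q = (fst q, snd q, u q)" for q
  define N0 where "N0 = gr -` \<Omega>"
  define \<phi> where "\<phi> q = (T (gr q), X (gr q))" for q
  have gr: "Ck_on 2 S gr" for S
    unfolding gr_def
    by (rule Ck_on_subset[OF _ subset_UNIV])
      (intro Ck_on_Pair Ck_on_fst Ck_on_snd Ck_on_ident u open_UNIV)
  have "continuous_on UNIV gr" using Ck_on_mono[OF gr, of 0 UNIV] by simp
  then have N0: "open N0" unfolding N0_def using assms(1) by (rule open_vimage[rotated])
  have in_N0: "(t, x) \<in> N0" using z by (simp add: N0_def gr_def)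
  have comp: "Ck_on 2 N0 (\<lambda>q. F (gr q))" if "Ck_on 2 \<Omega> F" for F :: "point \<Rightarrow> real"
    by (rule Ck_on_compose[OF N0 that gr]) (simp add: N0_def)
  have \<phi>: "Ck_on (Suc 1) N0 \<phi>"
    unfolding \<phi>_def using Ck_on_Pair[OF N0 comp[OF assms(2)] comp[OF assms(3)]] by (simp add: numeral_2_eq_2)
  have du: "u differentiable (at q)" for q using Ck_on_differentiable[OF u, of q UNIV] by simp
  have grd: "(gr has_derivative (\<lambda>h. (fst h, snd h, fd u (t, x) h))) (at (t, x))"
    unfolding gr_def by (intro has_derivative_Pair has_derivative_fst has_derivative_snd has_derivative_ident fd_has_derivative du)
  have gr0: "gr (t, x) = z" using z by (simp add: gr_def)
  have Fd: "((\<lambda>q. F (gr q)) has_derivative (\<lambda>h. fd F z (fst h, snd h, fd u (t, x) h))) (at (t, x))"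
    if "Ck_on 2 \<Omega> F" for F :: "point \<Rightarrow> real"
    using has_derivative_compose[OF grd, of F "fd F z"] fd_has_derivative[OF Ck_on_differentiable[OF that _ z(1)]]
    by (simp add: o_def gr0)
  have "fd \<phi> (t, x) = (\<lambda>h. (fd T z (fst h, snd h, fd u (t, x) h), fd X z (fst h, snd h, fd u (t, x) h)))"
    unfolding \<phi>_def by (intro fd_eqI has_derivative_Pair Fd assms)
  then have nz: "fst (fd \<phi> (t, x) (1, 0)) * snd (fd \<phi> (t, x) (0, 1)) - fst (fd \<phi> (t, x) (0, 1)) * snd (fd \<phi> (t, x) (1, 0)) \<noteq> 0"
    using assms(11) by (simp add: a_def b_def)
  obtain N V g where N: "open N" "N \<subseteq> N0" "(t, x) \<in> N" "open V" "\<And>q. q \<in> N \<Longrightarrow> \<phi> q \<in> V"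
    "\<And>q. q \<in> N \<Longrightarrow> g (\<phi> q) = q" "\<And>y. y \<in> V \<Longrightarrow> g y \<in> N" "Ck_on (Suc 1) V g"
    using Ck_on_local_inverse[OF N0 \<phi> in_N0 nz] by metis
  define u' where "u' y = U (gr (g y))" for y
  have "Ck_on 2 V u'"
    unfolding u'_def
    by (rule Ck_on_compose[OF N(4) comp[OF assms(4)]]) (use N in \<open>auto simp: numeral_2_eq_2 simp del: Ck_on.simps\<close>)
  moreover have "maps_graph \<Omega> P N u V u'"
    unfolding maps_graph_def
  proof (clarify)
    fix t' x' assume "(t', x') \<in> N"
    then have "gr (t', x') \<in> \<Omega>" "\<phi> (t', x') \<in> V" "u' (\<phi> (t', x')) = U (gr (t', x'))"
      using N by (auto simp: N0_def u'_def)
    then show "(t', x', u (t', x')) \<in> \<Omega> \<and> (case P (t', x', u (t', x')) of (t'', x'', v) \<Rightarrow> (t'', x'') \<in> V \<and> u' (t'', x'') = v)"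
      using P by (simp add: \<phi>_def gr_def)
  qed
  ultimately show ?thesis using that N by blast
qed

lemma linear_point_expansion:
  fixes L :: "point \<Rightarrow> real"
  assumes "linear L"
  shows "L (a, b, c) = a * L (1, 0, 0) + b * L (0, 1, 0) + c * L (0, 0, 1)"
proof -
  have "L (a, b, c) = L (a *\<^sub>R (1, 0, 0) + b *\<^sub>R (0, 1, 0) + c *\<^sub>R (0, 0, 1))" by simp
  then show ?thesis by (simp only: linear_add[OF assms] linear_scale[OF assms] real_scaleR_def)
qed

text \<open>Both mixed derivatives multiply \<open>\<alpha> * \<beta>\<close>, so they enter through
  their sum, which is carried below as the single unknown \<open>S12\<close>.\<close>

lemma fd_fd_plane:
  fixes v :: "real \<times> real \<Rightarrow> real"
  assumes "open N" "Ck_on 2 N v" "y \<in> N"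
  shows "fd (\<lambda>q. fd v q (\<alpha>, \<beta>)) y (\<alpha>, \<beta>) = fd (\<lambda>q. fd v q (1, 0)) y (1, 0) * \<alpha>\<^sup>2 +
    (fd (\<lambda>q. fd v q (1, 0)) y (0, 1) + fd (\<lambda>q. fd v q (0, 1)) y (1, 0)) * (\<alpha> * \<beta>) +
    fd (\<lambda>q. fd v q (0, 1)) y (0, 1) * \<beta>\<^sup>2"
proof -
  have dd: "(\<lambda>q. fd v q b) differentiable (at y)" for b
    by (rule Ck_on_2_fd_differentiable[OF assms(2,3)])
  have "fd v q (\<alpha>, \<beta>) = \<alpha> * fd v q (1, 0) + \<beta> * fd v q (0, 1)" if "q \<in> N" for q
    using linear_real_prod_expansion[OF linear_fd[OF Ck_on_differentiable[OF assms(2) _ that]], of \<alpha> \<beta>] by simp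
  then have "fd (\<lambda>q. fd v q (\<alpha>, \<beta>)) y = fd (\<lambda>q. \<alpha> * fd v q (1, 0) + \<beta> * fd v q (0, 1)) y"
    by (intro fd_transform_open[OF assms(1,3)])
  also have "\<dots> = (\<lambda>h. \<alpha> * fd (\<lambda>q. fd v q (1, 0)) y h + \<beta> * fd (\<lambda>q. fd v q (0, 1)) y h)"
    by (intro fd_eqI has_derivative_add has_derivative_mult_right fd_has_derivative dd)
  finally show ?thesis
    using linear_real_prod_expansion[OF linear_fd[OF dd[of "(1, 0)"]], of \<alpha> \<beta>]
      linear_real_prod_expansion[OF linear_fd[OF dd[of "(0, 1)"]], of \<alpha> \<beta>]
    by (simp add: power2_eq_square algebra_simps)
qed

text \<open>\<open>v1\<close>, \<open>v2\<close> and \<open>S11\<close>, \<open>S12\<close>, \<open>S22\<close> are the first and second derivatives of the transformed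
  function, \<open>S12\<close> being the sum of the two mixed ones; \<open>p\<close>, \<open>q\<close> and \<open>r\<close>, \<open>w\<close>, \<open>s\<close> are those of the
  original function.\<close>

lemma transforms_eq_jets:
  fixes T X U :: "point \<Rightarrow> real"
  assumes "open \<Omega>" "Ck_on 2 \<Omega> T" "Ck_on 2 \<Omega> X" "Ck_on 2 \<Omega> U"
    and P: "\<forall>z\<in>\<Omega>. P z = (T z, X z, U z)"
    and z: "z \<in> \<Omega>" "z = (t, x, u0)"
    and tr: "transforms_eq \<Omega> P (wave_eq f h H K) (wave_eq f' h' H' K')"
    and H: "(H has_real_derivative H1) (at u0)" "(H' has_real_derivative H1') (at (U z))"
    and nz: "fd T z (1, 0, p) * fd X z (0, 1, q) - fd T z (0, 1, q) * fd X z (1, 0, p) \<noteq> 0"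
  obtains v1 v2 S11 S12 S22 where
    "v1 * fd T z (1, 0, p) + v2 * fd X z (1, 0, p) = fd U z (1, 0, p)"
    "v1 * fd T z (0, 1, q) + v2 * fd X z (0, 1, q) = fd U z (0, 1, q)"
    "\<And>a b \<omega> \<sigma>. \<omega> = (a, b, p * a + q * b) \<Longrightarrow> \<sigma> = r * a\<^sup>2 + 2 * w * a * b + s * b\<^sup>2 \<Longrightarrow>
      S11 * (fd T z \<omega>)\<^sup>2 + S12 * (fd T z \<omega> * fd X z \<omega>) + S22 * (fd X z \<omega>)\<^sup>2
      + v1 * (fd (\<lambda>y. fd T y \<omega>) z \<omega> + \<sigma> * fd T z (0, 0, 1))
      + v2 * (fd (\<lambda>y. fd X y \<omega>) z \<omega> + \<sigma> * fd X z (0, 0, 1))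
      = fd (\<lambda>y. fd U y \<omega>) z \<omega> + \<sigma> * fd U z (0, 0, 1)"
    "f x * r = H1 * q\<^sup>2 + H u0 * s + h x * K u0 * q \<longleftrightarrow>
      f' (X z) * S11 = H1' * v2\<^sup>2 + H' (U z) * S22 + h' (X z) * K' (U z) * v2"
proof -
  obtain v where v: "\<And>S. Ck_on 2 S v" "v (t, x) = u0"
    "\<And>a b. fd v (t, x) (a, b) = p * a + q * b"
    "\<And>a b. fd (\<lambda>y. fd v y (a, b)) (t, x) (a, b) = r * a\<^sup>2 + 2 * w * a * b + s * b\<^sup>2"
    using quadratic_jets[of t x u0 p q r w s] by blast
  have z': "z = (t, x, v (t, x))" using z v by simp
  obtain N N' u' where N: "open N" "open N'" "Ck_on 2 N' u'" "(t, x) \<in> N" "maps_graph \<Omega> P N v N' u'"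
    using image_graph_exists[OF assms(1-4) P v(1) z(1) z'] nz by (auto simp: v(3))
  note jets = graph_jets[OF assms(1-4) P N(1,2) v(1) N(3,5,4), folded z']
  have img: "(T z, X z) \<in> N'" "u' (T z, X z) = U z"
    using N(4,5) bspec[OF P z(1)] by (auto simp: maps_graph_def z'[symmetric])
  let ?y = "(T z, X z)"
  let ?v1 = "fd u' ?y (1, 0)" and ?v2 = "fd u' ?y (0, 1)"
  let ?S11 = "fd (\<lambda>q. fd u' q (1, 0)) ?y (1, 0)" and ?S22 = "fd (\<lambda>q. fd u' q (0, 1)) ?y (0, 1)"
  let ?S12 = "fd (\<lambda>q. fd u' q (1, 0)) ?y (0, 1) + fd (\<lambda>q. fd u' q (0, 1)) ?y (1, 0)"
  have du': "fd u' ?y (\<alpha>, \<beta>) = ?v1 * \<alpha> + ?v2 * \<beta>" for \<alpha> \<beta>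
    using linear_real_prod_expansion[OF linear_fd[OF Ck_on_differentiable[OF N(3) _ img(1)]], of \<alpha> \<beta>] by simp
  have vert: "fd F z (0, 0, \<sigma>) = \<sigma> * fd F z (0, 0, 1)" if "Ck_on 2 \<Omega> F" for \<sigma> and F :: "point \<Rightarrow> real"
    using linear_point_expansion[OF linear_fd[OF Ck_on_differentiable[OF that _ z(1)]], of 0 0 \<sigma>] by simp
  show ?thesis
  proof (rule that[of ?v1 ?v2 ?S11 ?S12 ?S22])
    show "?v1 * fd T z (1, 0, p) + ?v2 * fd X z (1, 0, p) = fd U z (1, 0, p)"
      "?v1 * fd T z (0, 1, q) + ?v2 * fd X z (0, 1, q) = fd U z (0, 1, q)"
      using jets(1)[of 1 0] jets(1)[of 0 1]
        du'[of "fd T z (1, 0, p)" "fd X z (1, 0, p)"] du'[of "fd T z (0, 1, q)" "fd X z (0, 1, q)"]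
      by (simp_all add: v(3))
    show "?S11 * (fd T z \<omega>)\<^sup>2 + ?S12 * (fd T z \<omega> * fd X z \<omega>) + ?S22 * (fd X z \<omega>)\<^sup>2
      + ?v1 * (fd (\<lambda>y. fd T y \<omega>) z \<omega> + \<sigma> * fd T z (0, 0, 1))
      + ?v2 * (fd (\<lambda>y. fd X y \<omega>) z \<omega> + \<sigma> * fd X z (0, 0, 1))
      = fd (\<lambda>y. fd U y \<omega>) z \<omega> + \<sigma> * fd U z (0, 0, 1)"
      if "\<omega> = (a, b, p * a + q * b)" "\<sigma> = r * a\<^sup>2 + 2 * w * a * b + s * b\<^sup>2" for a b \<omega> \<sigma>
      using jets(2)[of a b]
      unfolding v(3,4) that[symmetric] fd_fd_plane[OF N(2,3) img(1), of "fd T z \<omega>" "fd X z \<omega>"]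
        du'[of "fd (\<lambda>y. fd T y \<omega>) z \<omega> + \<sigma> * fd T z (0, 0, 1)"]
        vert[OF assms(2), of \<sigma>] vert[OF assms(3), of \<sigma>] vert[OF assms(4), of \<sigma>]
      by (simp only: distrib_left add.assoc)
    have "wave_eq f h H K v (t, x) \<longleftrightarrow> wave_eq f' h' H' K' u' ?y"
    proof -
      have "case P (t, x, v (t, x)) of (t', x', w) \<Rightarrow> wave_eq f h H K v (t, x) \<longleftrightarrow> wave_eq f' h' H' K' u' (t', x')"
        using tr[unfolded transforms_eq_def, rule_format, of N N' v u' "(t, x)"] N v(1) by auto
      then show ?thesis using bspec[OF P z(1)] by (simp add: z'[symmetric])
    qed
    moreover have "wave_eq f h H K v (t, x) \<longleftrightarrow> f x * r = H1 * q\<^sup>2 + H u0 * s + h x * K u0 * q"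
      using wave_eq_iff_jet[OF open_UNIV v(1), of t x H H1 f h K] H(1) v by simp
    moreover have "wave_eq f' h' H' K' u' ?y \<longleftrightarrow>
        f' (X z) * ?S11 = H1' * ?v2\<^sup>2 + H' (U z) * ?S22 + h' (X z) * K' (U z) * ?v2"
      using wave_eq_iff_jet[OF N(2,3) img(1), of H' H1' f' h' K'] H(2) by (simp add: img(2))
    ultimately show "f x * r = H1 * q\<^sup>2 + H u0 * s + h x * K u0 * q \<longleftrightarrow>
      f' (X z) * ?S11 = H1' * ?v2\<^sup>2 + H' (U z) * ?S22 + h' (X z) * K' (U z) * ?v2" by blast
  qed
qed

text \<open>In matrix form the hypotheses say that J^T M J = \<kappa> S, where \<open>J\<close> has
  columns (A, C) and (B, D) and \<open>M12\<close> is twice the off-diagonal entry of M. The third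
  one supplies the mixed entry by polarisation. Multiplying by the adjugate of J on both sides gives
  det(J)^2 M, whose diagonal is the conclusion.\<close>

lemma quadratic_form_pullback:
  fixes A B C D \<kappa> r w s M11 M12 M22 :: real
  assumes "M11 * A\<^sup>2 + M12 * (A * C) + M22 * C\<^sup>2 = \<kappa> * r"
    "M11 * B\<^sup>2 + M12 * (B * D) + M22 * D\<^sup>2 = \<kappa> * s"
    "M11 * (A + B)\<^sup>2 + M12 * ((A + B) * (C + D)) + M22 * (C + D)\<^sup>2 = \<kappa> * (r + 2 * w + s)"
  shows "(A * D - B * C)\<^sup>2 * M11 = \<kappa> * (r * D\<^sup>2 - 2 * w * (C * D) + s * C\<^sup>2)"
    "(A * D - B * C)\<^sup>2 * M22 = \<kappa> * (r * B\<^sup>2 - 2 * w * (A * B) + s * A\<^sup>2)"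
proof -
  have m: "2 * M11 * (A * B) + M12 * (A * D + B * C) + 2 * M22 * (C * D) = 2 * \<kappa> * w"
    using assms by (simp add: power2_eq_square algebra_simps)
  have "(A * D - B * C)\<^sup>2 * M11 = D\<^sup>2 * (M11 * A\<^sup>2 + M12 * (A * C) + M22 * C\<^sup>2)
     - C * D * (2 * M11 * (A * B) + M12 * (A * D + B * C) + 2 * M22 * (C * D))
     + C\<^sup>2 * (M11 * B\<^sup>2 + M12 * (B * D) + M22 * D\<^sup>2)"
    "(A * D - B * C)\<^sup>2 * M22 = B\<^sup>2 * (M11 * A\<^sup>2 + M12 * (A * C) + M22 * C\<^sup>2)
     - A * B * (2 * M11 * (A * B) + M12 * (A * D + B * C) + 2 * M22 * (C * D))
     + A\<^sup>2 * (M11 * B\<^sup>2 + M12 * (B * D) + M22 * D\<^sup>2)"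
    by algebra+
  then show "(A * D - B * C)\<^sup>2 * M11 = \<kappa> * (r * D\<^sup>2 - 2 * w * (C * D) + s * C\<^sup>2)"
    "(A * D - B * C)\<^sup>2 * M22 = \<kappa> * (r * B\<^sup>2 - 2 * w * (A * B) + s * A\<^sup>2)"
    unfolding m assms by (simp_all add: algebra_simps)
qed

text \<open>The total Jacobian is affine in the first derivatives (p, q) and so vanishes at most on
  a line; this lemma carries continuous relations onto that line.\<close>

lemma vanishes_off_line_imp_vanishes:
  fixes G :: "real \<Rightarrow> real \<Rightarrow> real"
  assumes "continuous_on UNIV (\<lambda>(p, q). G p q)" "l0 \<noteq> 0 \<or> l1 \<noteq> 0 \<or> l2 \<noteq> 0"
    "\<And>p q. l0 + p * l1 + q * l2 \<noteq> 0 \<Longrightarrow> G p q = 0"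
  shows "G p q = 0"
proof (cases "l0 + p * l1 + q * l2 = 0")
  case True
  have "l1 \<noteq> 0 \<or> l2 \<noteq> 0" using assms(2) True by auto
  then have pos: "l1\<^sup>2 + l2\<^sup>2 \<noteq> 0" by (simp add: sum_power2_eq_zero_iff)
  \<comment> \<open>The point is approached along the normal (l1, l2) of the line, where the affine
    function equals \<open>s * (l1\<^sup>2 + l2\<^sup>2)\<close>.\<close>
  let ?\<gamma> = "\<lambda>s. G (p + s * l1) (q + s * l2)"
  have "continuous_on UNIV ((\<lambda>(p, q). G p q) \<circ> (\<lambda>s. (p + s * l1, q + s * l2)))"
    by (intro continuous_on_compose continuous_on_subset[OF assms(1)] continuous_on_Pair
        continuous_on_add continuous_on_mult continuous_on_const continuous_on_id subset_UNIV)
  then have "isCont ?\<gamma> 0" by (simp add: o_def continuous_on_eq_continuous_at)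
  then have "(?\<gamma> \<longlongrightarrow> G p q) (at 0)" by (simp add: isCont_def)
  moreover have "\<forall>\<^sub>F s in at 0. ?\<gamma> s = 0"
  proof (rule eventually_mono)
    show "\<forall>\<^sub>F s in at 0. s \<noteq> (0::real)" by (simp add: eventually_at_filter)
    fix s :: real assume "s \<noteq> 0"
    have "l0 + (p + s * l1) * l1 + (q + s * l2) * l2 = s * (l1\<^sup>2 + l2\<^sup>2)"
      using True by (simp add: power2_eq_square algebra_simps)
    also have "\<dots> \<noteq> 0" using \<open>s \<noteq> 0\<close> pos by (metis mult_eq_0_iff)
    finally show "?\<gamma> s = 0" by (rule assms(3))
  qed
  then have "(?\<gamma> \<longlongrightarrow> 0) (at 0)" by (rule tendsto_eventually)
  ultimately show ?thesis by (rule tendsto_unique[OF at_neq_bot])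
qed (simp add: assms(3))

section \<open>The principal symbol\<close>

text \<open>From one 2-jet on the equation, increments (r, w, s) of the second derivatives with
  \<open>f x * r = H u0 * s\<close> lead to further 2-jets on it with the same 1-jet. Subtracting
  the transformed equations leaves only the second-order increments, which
  \<open>quadratic_form_pullback\<close> expresses by (r, w, s).\<close>

lemma wave_symbol:
  fixes T X U :: "point \<Rightarrow> real"
  assumes "open \<Omega>" and C2: "Ck_on 2 \<Omega> T" "Ck_on 2 \<Omega> X" "Ck_on 2 \<Omega> U"
    and P: "\<forall>z\<in>\<Omega>. P z = (T z, X z, U z)"
    and z: "z \<in> \<Omega>" "z = (t, x, u0)"
    and tr: "transforms_eq \<Omega> P (wave_eq f h H K) (wave_eq f' h' H' K')"
    and H: "(H has_real_derivative H1) (at u0)" "(H' has_real_derivative H1') (at (U z))"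
    and nz: "fd T z (1, 0, p) * fd X z (0, 1, q) - fd T z (0, 1, q) * fd X z (1, 0, p) \<noteq> 0"
    and fx: "f x \<noteq> 0" and vert: "fd T z v = 0" "fd X z v = 0" "fd U z v \<noteq> 0"
  shows "f' (X z) * (fd X z (1, 0, p) * fd X z (0, 1, q)) = H' (U z) * (fd T z (1, 0, p) * fd T z (0, 1, q))"
    and "f' (X z) * (H u0 * (fd X z (0, 1, q))\<^sup>2 + f x * (fd X z (1, 0, p))\<^sup>2)
      = H' (U z) * (H u0 * (fd T z (0, 1, q))\<^sup>2 + f x * (fd T z (1, 0, p))\<^sup>2)"
proof -
  define A B C D where "A = fd T z (1, 0, p)" and "B = fd T z (0, 1, q)"
    and "C = fd X z (1, 0, p)" and "D = fd X z (0, 1, q)"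
  have det: "A * D - B * C \<noteq> 0" using nz by (simp add: A_def B_def C_def D_def)
  have lin: "linear (fd F z)" if "Ck_on 2 \<Omega> F" for F :: "point \<Rightarrow> real"
    using linear_fd[OF Ck_on_differentiable[OF that _ z(1)]] by simp
  have sum: "fd F z (1, 1, p + q) = fd F z (1, 0, p) + fd F z (0, 1, q)" if "Ck_on 2 \<Omega> F" for F :: "point \<Rightarrow> real"
    using linear_add[OF lin[OF that], of "(1, 0, p)" "(0, 1, q)"] by simp
  have fd_at: "fd F z (a, b, c) = a * fd F z (1, 0, p) + b * fd F z (0, 1, q) + (c - a * p - b * q) * fd F z (0, 0, 1)"
    if "Ck_on 2 \<Omega> F" for F :: "point \<Rightarrow> real" and a b c
    using linear_point_expansion[OF lin[OF that], of a b c] linear_point_expansion[OF lin[OF that], of 1 0 p]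
      linear_point_expansion[OF lin[OF that], of 0 1 q] by (simp add: algebra_simps)
  \<comment> \<open>With second derivatives (r0, 0, 0) the jet satisfies the original equation; this
    is the base point for all increments.\<close>
  define r0 where "r0 = (H1 * q\<^sup>2 + h x * K u0 * q) / f x"
  have r0: "f x * r0 = H1 * q\<^sup>2 + h x * K u0 * q" using fx by (simp add: r0_def)
  note jets = transforms_eq_jets[OF assms(1) C2 P z tr H nz]
  obtain v1 v2 S11 S12 S22 where j:
    "v1 * A + v2 * C = fd U z (1, 0, p)" "v1 * B + v2 * D = fd U z (0, 1, q)"
    "\<And>a b \<omega> \<sigma>. \<omega> = (a, b, p * a + q * b) \<Longrightarrow> \<sigma> = r0 * a\<^sup>2 + 2 * 0 * a * b + 0 * b\<^sup>2 \<Longrightarrow>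
      S11 * (fd T z \<omega>)\<^sup>2 + S12 * (fd T z \<omega> * fd X z \<omega>) + S22 * (fd X z \<omega>)\<^sup>2
      + v1 * (fd (\<lambda>y. fd T y \<omega>) z \<omega> + \<sigma> * fd T z (0, 0, 1))
      + v2 * (fd (\<lambda>y. fd X y \<omega>) z \<omega> + \<sigma> * fd X z (0, 0, 1))
      = fd (\<lambda>y. fd U y \<omega>) z \<omega> + \<sigma> * fd U z (0, 0, 1)"
    "f x * r0 = H1 * q\<^sup>2 + H u0 * 0 + h x * K u0 * q \<longleftrightarrow>
      f' (X z) * S11 = H1' * v2\<^sup>2 + H' (U z) * S22 + h' (X z) * K' (U z) * v2"
    unfolding A_def B_def C_def D_def by (rule jets[of r0 0 0]) blast
  \<comment> \<open>The factor by which increments of second derivatives are carried over. If it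
    were 0, the differential of \<open>U\<close> would be \<open>v1\<close> times that of
    \<open>T\<close> plus \<open>v2\<close> times that of \<open>X\<close>, against
    \<open>vert\<close>.\<close>
  define \<kappa> where "\<kappa> = fd U z (0, 0, 1) - v1 * fd T z (0, 0, 1) - v2 * fd X z (0, 0, 1)"
  have "\<kappa> \<noteq> 0"
  proof
    assume "\<kappa> = 0"
    obtain a b c where v: "v = (a, b, c)" by (cases v)
    have "fd U z v = v1 * fd T z v + v2 * fd X z v"
    proof -
      have "fd U z (0, 0, 1) = v1 * fd T z (0, 0, 1) + v2 * fd X z (0, 0, 1)"
        using \<open>\<kappa> = 0\<close> by (simp add: \<kappa>_def)
      then show ?thesis
        unfolding v fd_at[OF C2(1), of a b c] fd_at[OF C2(2), of a b c] fd_at[OF C2(3), of a b c]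
        unfolding j(1,2)[symmetric] A_def[symmetric] B_def[symmetric] C_def[symmetric] D_def[symmetric]
        by (simp add: algebra_simps)
    qed
    then show False using vert by simp
  qed
  have base: "f' (X z) * S11 = H1' * v2\<^sup>2 + H' (U z) * S22 + h' (X z) * K' (U z) * v2"
    using j(4) r0 by simp
  have key: "f' (X z) * (r * D\<^sup>2 - 2 * w * (C * D) + s * C\<^sup>2) = H' (U z) * (r * B\<^sup>2 - 2 * w * (A * B) + s * A\<^sup>2)"
    if rs: "f x * r = H u0 * s" for r w s
  proof -
    obtain y1 y2 M11 M12 M22 where k:
      "y1 * A + y2 * C = fd U z (1, 0, p)" "y1 * B + y2 * D = fd U z (0, 1, q)"
      "\<And>a b \<omega> \<sigma>. \<omega> = (a, b, p * a + q * b) \<Longrightarrow> \<sigma> = (r0 + r) * a\<^sup>2 + 2 * w * a * b + s * b\<^sup>2 \<Longrightarrow>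
        M11 * (fd T z \<omega>)\<^sup>2 + M12 * (fd T z \<omega> * fd X z \<omega>) + M22 * (fd X z \<omega>)\<^sup>2
        + y1 * (fd (\<lambda>y. fd T y \<omega>) z \<omega> + \<sigma> * fd T z (0, 0, 1))
        + y2 * (fd (\<lambda>y. fd X y \<omega>) z \<omega> + \<sigma> * fd X z (0, 0, 1))
        = fd (\<lambda>y. fd U y \<omega>) z \<omega> + \<sigma> * fd U z (0, 0, 1)"
      "f x * (r0 + r) = H1 * q\<^sup>2 + H u0 * s + h x * K u0 * q \<longleftrightarrow>
        f' (X z) * M11 = H1' * y2\<^sup>2 + H' (U z) * M22 + h' (X z) * K' (U z) * y2"
      unfolding A_def B_def C_def D_def by (rule jets[of "r0 + r" w s]) blast
    \<comment> \<open>The new first derivatives solve the same linear system in both cases, and its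
      determinant is nonzero, so they agree.\<close>
    have "(y1 - v1) * (A * D - B * C)
        = ((y1 * A + y2 * C) - (v1 * A + v2 * C)) * D - ((y1 * B + y2 * D) - (v1 * B + v2 * D)) * C"
      "(y2 - v2) * (A * D - B * C)
        = ((y1 * B + y2 * D) - (v1 * B + v2 * D)) * A - ((y1 * A + y2 * C) - (v1 * A + v2 * C)) * B"
      by algebra+
    then have "(y1 - v1) * (A * D - B * C) = 0" "(y2 - v2) * (A * D - B * C) = 0"
      unfolding j(1,2) k(1,2) by simp_all
    then have y: "y1 = v1" "y2 = v2" using det by auto
    have "f x * (r0 + r) = H1 * q\<^sup>2 + H u0 * s + h x * K u0 * q"
      by (simp add: distrib_left r0 rs)
    then have "f' (X z) * M11 = H1' * v2\<^sup>2 + H' (U z) * M22 + h' (X z) * K' (U z) * v2"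
      using k(4) y by blast
    with base have diff: "f' (X z) * (M11 - S11) = H' (U z) * (M22 - S22)"
      by (simp add: right_diff_distrib)
    have e1: "(M11 - S11) * A\<^sup>2 + (M12 - S12) * (A * C) + (M22 - S22) * C\<^sup>2 = \<kappa> * r"
      using j(3)[of "(1, 0, p)" 1 0 r0] k(3)[of "(1, 0, p)" 1 0 "r0 + r"]
      unfolding A_def[symmetric] C_def[symmetric] y \<kappa>_def by (simp add: algebra_simps)
    have e2: "(M11 - S11) * B\<^sup>2 + (M12 - S12) * (B * D) + (M22 - S22) * D\<^sup>2 = \<kappa> * s"
      using j(3)[of "(0, 1, q)" 0 1 0] k(3)[of "(0, 1, q)" 0 1 s]
      unfolding B_def[symmetric] D_def[symmetric] y \<kappa>_def by (simp add: algebra_simps)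
    have "fd T z (1, 1, p + q) = A + B" "fd X z (1, 1, p + q) = C + D"
      using sum C2 by (simp_all add: A_def B_def C_def D_def)
    then have e3: "(M11 - S11) * (A + B)\<^sup>2 + (M12 - S12) * ((A + B) * (C + D)) + (M22 - S22) * (C + D)\<^sup>2
        = \<kappa> * (r + 2 * w + s)"
      using j(3)[of "(1, 1, p + q)" 1 1 r0] k(3)[of "(1, 1, p + q)" 1 1 "r0 + r + 2 * w + s"]
      unfolding y \<kappa>_def by (simp add: algebra_simps)
    note pb = quadratic_form_pullback[OF e1 e2 e3]
    have "\<kappa> * (f' (X z) * (r * D\<^sup>2 - 2 * w * (C * D) + s * C\<^sup>2))
        = f' (X z) * ((A * D - B * C)\<^sup>2 * (M11 - S11))"
      unfolding pb(1) by simp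
    also have "\<dots> = H' (U z) * ((A * D - B * C)\<^sup>2 * (M22 - S22))"
      using diff by (simp add: mult.left_commute)
    also have "\<dots> = \<kappa> * (H' (U z) * (r * B\<^sup>2 - 2 * w * (A * B) + s * A\<^sup>2))"
      unfolding pb(2) by simp
    finally show ?thesis using \<open>\<kappa> \<noteq> 0\<close> by simp
  qed
  \<comment> \<open>Two admissible increments: the purely mixed one, (0, 1, 0), and (H, 0, f), which
    solves the linear constraint.\<close>
  show "f' (X z) * (fd X z (1, 0, p) * fd X z (0, 1, q)) = H' (U z) * (fd T z (1, 0, p) * fd T z (0, 1, q))"
    using key[of 0 0 1] unfolding A_def B_def C_def D_def by simp
  show "f' (X z) * (H u0 * (fd X z (0, 1, q))\<^sup>2 + f x * (fd X z (1, 0, p))\<^sup>2)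
      = H' (U z) * (H u0 * (fd T z (0, 1, q))\<^sup>2 + f x * (fd T z (1, 0, p))\<^sup>2)"
    using key[of "H u0" "f x" 0] unfolding A_def B_def C_def D_def by simp
qed

text \<open>The term in \<open>p * q\<close> cancels in the total Jacobian, which is thus affine in
  \<open>p\<close> and \<open>q\<close> with the three minors of \<open>nondeg\<close> as
  coefficients. The relations of \<open>wave_symbol\<close> are polynomial in \<open>p\<close>,
  \<open>q\<close>, so they extend to its zero set.\<close>

lemma wave_symbol_all_jets:
  fixes T X U :: "point \<Rightarrow> real"
  assumes "open \<Omega>" and C2: "Ck_on 2 \<Omega> T" "Ck_on 2 \<Omega> X" "Ck_on 2 \<Omega> U"
    and P: "\<forall>z\<in>\<Omega>. P z = (T z, X z, U z)"
    and z: "z \<in> \<Omega>" "z = (t, x, u0)"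
    and tr: "transforms_eq \<Omega> P (wave_eq f h H K) (wave_eq f' h' H' K')"
    and H: "(H has_real_derivative H1) (at u0)" "(H' has_real_derivative H1') (at (U z))"
    and fx: "f x \<noteq> 0" and vert: "fd T z v = 0" "fd X z v = 0" "fd U z v \<noteq> 0"
  defines "Tt \<equiv> fd T z (1, 0, 0)" and "Tx \<equiv> fd T z (0, 1, 0)" and "Tu \<equiv> fd T z (0, 0, 1)"
    and "Xt \<equiv> fd X z (1, 0, 0)" and "Xx \<equiv> fd X z (0, 1, 0)" and "Xu \<equiv> fd X z (0, 0, 1)"
  assumes nondeg: "Tt * Xx - Tx * Xt \<noteq> 0 \<or> Tu * Xx - Tx * Xu \<noteq> 0 \<or> Tt * Xu - Tu * Xt \<noteq> 0"
  shows "f' (X z) * ((Xt + p * Xu) * (Xx + q * Xu)) = H' (U z) * ((Tt + p * Tu) * (Tx + q * Tu))"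
    and "f' (X z) * (H u0 * (Xx + q * Xu)\<^sup>2 + f x * (Xt + p * Xu)\<^sup>2)
      = H' (U z) * (H u0 * (Tx + q * Tu)\<^sup>2 + f x * (Tt + p * Tu)\<^sup>2)"
proof -
  have ex: "fd F z (1, 0, p) = fd F z (1, 0, 0) + p * fd F z (0, 0, 1)"
    "fd F z (0, 1, q) = fd F z (0, 1, 0) + q * fd F z (0, 0, 1)" if "Ck_on 2 \<Omega> F" for F :: "point \<Rightarrow> real" and p q
    using linear_point_expansion[OF linear_fd[OF Ck_on_differentiable[OF that _ z(1)]], of 1 0 p]
      linear_point_expansion[OF linear_fd[OF Ck_on_differentiable[OF that _ z(1)]], of 0 1 q] by simp_all
  note e = ex[OF C2(1), folded Tt_def Tx_def Tu_def] ex[OF C2(2), folded Xt_def Xx_def Xu_def]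
  have nz: "fd T z (1, 0, p) * fd X z (0, 1, q) - fd T z (0, 1, q) * fd X z (1, 0, p) \<noteq> 0"
    if "(Tt * Xx - Tx * Xt) + p * (Tu * Xx - Tx * Xu) + q * (Tt * Xu - Tu * Xt) \<noteq> 0" for p q
    using that unfolding e by (simp add: algebra_simps)
  note sym = wave_symbol[OF assms(1) C2 P z tr H nz fx vert, unfolded e]
  define G1 where "G1 p q = f' (X z) * ((Xt + p * Xu) * (Xx + q * Xu))
     - H' (U z) * ((Tt + p * Tu) * (Tx + q * Tu))" for p q
  define G2 where "G2 p q = f' (X z) * (H u0 * (Xx + q * Xu)\<^sup>2 + f x * (Xt + p * Xu)\<^sup>2)
     - H' (U z) * (H u0 * (Tx + q * Tu)\<^sup>2 + f x * (Tt + p * Tu)\<^sup>2)" for p q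
  have "continuous_on UNIV (\<lambda>(p, q). G1 p q)"
    unfolding G1_def case_prod_unfold by (intro continuous_intros)
  then have "G1 p q = 0"
    by (rule vanishes_off_line_imp_vanishes[OF _ nondeg]) (simp add: G1_def sym(1))
  then show "f' (X z) * ((Xt + p * Xu) * (Xx + q * Xu)) = H' (U z) * ((Tt + p * Tu) * (Tx + q * Tu))"
    by (simp add: G1_def)
  have "continuous_on UNIV (\<lambda>(p, q). G2 p q)"
    unfolding G2_def case_prod_unfold by (intro continuous_intros)
  then have "G2 p q = 0"
    by (rule vanishes_off_line_imp_vanishes[OF _ nondeg]) (simp add: G2_def sym(2))
  then show "f' (X z) * (H u0 * (Xx + q * Xu)\<^sup>2 + f x * (Xt + p * Xu)\<^sup>2)
      = H' (U z) * (H u0 * (Tx + q * Tu)\<^sup>2 + f x * (Tt + p * Tu)\<^sup>2)"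
    by (simp add: G2_def)
qed

text \<open>Comparing coefficients of \<open>p\<close> and \<open>q\<close> shows that a nonzero
  \<open>Xu\<close> would make the differentials of t' and x' proportional. With the u-derivatives
  gone, a change of the ratio H / f separates the squares and excludes that all four remaining
  entries are nonzero.\<close>

lemma wave_symbol_classification:
  fixes Tt Tx Tu Xt Xx Xu :: real
  assumes sym: "\<And>f H. f \<noteq> 0 \<Longrightarrow> H \<noteq> 0 \<Longrightarrow> \<exists>a b. a \<noteq> 0 \<and> b \<noteq> 0 \<and>
      (\<forall>p q. a * ((Xt + p * Xu) * (Xx + q * Xu)) = b * ((Tt + p * Tu) * (Tx + q * Tu))) \<and>
      a * (H * Xx\<^sup>2 + f * Xt\<^sup>2) = b * (H * Tx\<^sup>2 + f * Tt\<^sup>2)"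
    and nondeg: "Tt * Xx - Tx * Xt \<noteq> 0 \<or> Tu * Xx - Tx * Xu \<noteq> 0 \<or> Tt * Xu - Tu * Xt \<noteq> 0"
  shows "Tu = 0 \<and> Xu = 0 \<and>
    (Xt = 0 \<and> Tx = 0 \<and> Xx \<noteq> 0 \<and> Tt \<noteq> 0 \<or> Xx = 0 \<and> Tt = 0 \<and> Xt \<noteq> 0 \<and> Tx \<noteq> 0)"
proof -
  obtain a b where ab: "a \<noteq> 0" "b \<noteq> 0"
    "\<And>p q. a * ((Xt + p * Xu) * (Xx + q * Xu)) = b * ((Tt + p * Tu) * (Tx + q * Tu))"
    "a * (Xx\<^sup>2 + Xt\<^sup>2) = b * (Tx\<^sup>2 + Tt\<^sup>2)"
    using sym[of 1 1] by auto
  have c00: "a * (Xt * Xx) = b * (Tt * Tx)" using ab(3)[of 0 0] by simp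
  have c10: "a * (Xu * Xx) = b * (Tu * Tx)" using ab(3)[of 1 0] c00 by (simp add: algebra_simps)
  have c01: "a * (Xt * Xu) = b * (Tt * Tu)" using ab(3)[of 0 1] c00 by (simp add: algebra_simps)
  have c11: "a * (Xu * Xu) = b * (Tu * Tu)" using ab(3)[of 1 1] c00 c10 c01 by (simp add: algebra_simps)
  have Xu: "Xu = 0"
  proof (rule ccontr)
    assume Xu: "Xu \<noteq> 0"
    then have Tu: "Tu \<noteq> 0" using c11 ab by auto
    \<comment> \<open>The factor of proportionality between the two rows, forced by
      \<open>c10\<close>, \<open>c01\<close> and \<open>c11\<close>; all minors then vanish.\<close>
    define k where "k = (b * Tu) / (a * Xu)"
    have "Xx = k * Tx" "Xt = k * Tt" "Xu = k * Tu"
      using c10 c01 c11 Xu ab(1) by (simp_all add: k_def field_simps)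
    then show False using nondeg by (simp add: algebra_simps)
  qed
  then have Tu: "Tu = 0" using c11 ab by simp
  have l0: "Tt * Xx - Tx * Xt \<noteq> 0" using nondeg Xu Tu by simp
  have XX: "Xt * Xx = 0"
  proof (rule ccontr)
    assume nz: "Xt * Xx \<noteq> 0"
    then have nz': "Tt * Tx \<noteq> 0" using c00 ab by auto
    \<comment> \<open>A second pair (f, H) with H of the opposite sign. The coefficients may change
      with the pair, but the relation without squares fixes their ratio \<open>\<rho>\<close> for
      both; sum and difference of the remaining relations isolate each square.\<close>
    obtain a' b' where ab': "a' \<noteq> 0" "b' \<noteq> 0" "a' * (Xt * Xx) = b' * (Tt * Tx)"
      "a' * (- Xx\<^sup>2 + Xt\<^sup>2) = b' * (- Tx\<^sup>2 + Tt\<^sup>2)"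
      using sym[of 1 "-1"] Xu Tu by auto
    define \<rho> where "\<rho> = (Tt * Tx) / (Xt * Xx)"
    have "a = b * \<rho>" "a' = b' * \<rho>" using c00 ab'(3) nz by (simp_all add: \<rho>_def field_simps)
    then have "\<rho> * (Xx\<^sup>2 + Xt\<^sup>2) = Tx\<^sup>2 + Tt\<^sup>2" "\<rho> * (- Xx\<^sup>2 + Xt\<^sup>2) = - Tx\<^sup>2 + Tt\<^sup>2"
      using ab(2,4) ab'(2,4) by simp_all
    then have r: "\<rho> * Xt\<^sup>2 = Tt\<^sup>2" "\<rho> * Xx\<^sup>2 = Tx\<^sup>2" by (simp_all add: algebra_simps)
    have r': "\<rho> * (Xt * Xx) = Tt * Tx" using nz by (simp add: \<rho>_def)
    have "(Tt * Xx - Tx * Xt)\<^sup>2 = Tt\<^sup>2 * Xx\<^sup>2 - 2 * (Tt * Tx) * (Xt * Xx) + Tx\<^sup>2 * Xt\<^sup>2"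
      by (simp add: power2_eq_square algebra_simps)
    also have "\<dots> = 0"
      unfolding r[symmetric] r'[symmetric] by (simp add: power2_eq_square algebra_simps)
    finally show False using l0 by simp
  qed
  have "Tt * Tx = 0" using c00 ab(2) unfolding XX by simp
  with XX show ?thesis using Xu Tu l0 by auto
qed

section \<open>Members of the class with prescribed values and slopes at a point\<close>

lemma Ck_on_exp: "Ck_on k S (exp :: real \<Rightarrow> real)"
proof (rule Ck_on_subset[OF _ subset_UNIV])
  have fd_exp: "fd exp x = (\<lambda>v::real. v * exp x)" for x :: real
    by (rule fd_eqI) (auto intro!: derivative_eq_intros)
  show "Ck_on k UNIV (exp :: real \<Rightarrow> real)"
  proof (induction k)
    case 0
    then show ?case by (simp add: continuous_on_exp)
  next
    case (Suc k)
    have "exp differentiable (at x)" for x :: real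
      using field_differentiable_imp_differentiable field_differentiable_within_exp by blast
    moreover have "Ck_on k UNIV (\<lambda>x::real. v * exp x)" for v
      by (intro Ck_on_mult Ck_on_const Suc.IH open_UNIV)
    ultimately show ?case by (simp add: fd_exp)
  qed
qed

lemma range_mem:
  assumes "(t, x, u) \<in> \<Omega>"
  shows "x \<in> x_range \<Omega>" "u \<in> u_range \<Omega>"
  using assms by (force simp: x_range_def u_range_def)+

text \<open>Exponentials attain any nonzero value with any slope and have no zeros, as the class
  demands of \<open>f\<close> and \<open>H\<close>. The free choice of slopes is what later
  separates the derivatives of the transformation.\<close>

lemma class_element_exists:
  fixes f0 h0 H0 K0 f1 h1 H1 K1 :: real
  assumes "open \<Omega>" "(t, x0, u0) \<in> \<Omega>" "f0 \<noteq> 0" "H0 \<noteq> 0"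
  obtains f h H K where "in_class \<Omega> f h H K" "f x0 = f0" "h x0 = h0" "H u0 = H0" "K u0 = K0"
    "(f has_real_derivative f1) (at x0)" "(h has_real_derivative h1) (at x0)"
    "(H has_real_derivative H1) (at u0)" "(K has_real_derivative K1) (at u0)"
proof -
  define f where "f x = f0 * exp (f1 / f0 * (x - x0))" for x
  define H where "H u = H0 * exp (H1 / H0 * (u - u0))" for u
  define h where "h x = h0 + h1 * (x - x0)" for x
  \<comment> \<open>the quadratic term makes \<open>K\<^sub>u\<close> nonzero somewhere even if all prescribed slopes vanish\<close>
  define K where "K u = K0 + K1 * (u - u0) + (u - u0) * (u - u0)" for u
  have K': "(K has_real_derivative K1 + 2 * (u - u0)) (at u)" for u
    unfolding K_def by (auto intro!: derivative_eq_intros)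
  note Ck = Ck_on_add Ck_on_mult Ck_on_diff Ck_on_const Ck_on_ident open_UNIV
  have expo: "Ck_on k UNIV (\<lambda>x::real. c * exp (d * (x - e)))" for k c d e
    by (rule Ck_on_mult[OF open_UNIV Ck_on_const Ck_on_compose[OF open_UNIV Ck_on_exp _ UNIV_I]]) (intro Ck)
  have "Ck_on k UNIV f" "Ck_on k UNIV h" "Ck_on k UNIV H" "Ck_on k UNIV K" for k
    unfolding f_def h_def H_def K_def by (intro expo Ck)+
  then have smooth: "smooth_on S f" "smooth_on S h" "smooth_on S H" "smooth_on S K" for S
    unfolding smooth_on_def using Ck_on_subset[OF _ subset_UNIV] by blast+
  have "open ((\<lambda>s. (t, x0, u0 + s)) -` \<Omega>)"
    by (intro open_vimage assms(1) continuous_intros)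
  moreover have "0 \<in> (\<lambda>s. (t, x0, u0 + s)) -` \<Omega>" using assms(2) by simp
  ultimately obtain e where e: "e > 0" "ball 0 e \<subseteq> (\<lambda>s. (t, x0, u0 + s)) -` \<Omega>"
    using openE by blast
  have "\<exists>u\<in>u_range \<Omega>. deriv K u \<noteq> 0"
  proof (cases "K1 = 0")
    case True
    \<comment> \<open>At \<open>u0\<close> the slope of \<open>K\<close> is 0 here; at
      \<open>u0 + e / 2\<close>, still in the domain, it is \<open>e\<close>.\<close>
    have "e / 2 \<in> ball 0 e" using e(1) by simp
    then have "(t, x0, u0 + e / 2) \<in> \<Omega>" using e(2) by blast
    then show ?thesis
      using range_mem(2) DERIV_imp_deriv[OF K'[of "u0 + e / 2"]] True e(1) by (intro bexI[of _ "u0 + e / 2"]) auto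
  next
    case False
    then show ?thesis
      using range_mem(2)[OF assms(2)] DERIV_imp_deriv[OF K'[of u0]] by (intro bexI[of _ u0]) auto
  qed
  then have "in_class \<Omega> f h H K"
    using smooth assms(3,4) unfolding in_class_def by (auto simp: f_def H_def)
  moreover have "f x0 = f0" "h x0 = h0" "H u0 = H0" "K u0 = K0"
    by (simp_all add: f_def h_def H_def K_def)
  moreover have "(f has_real_derivative f1) (at x0)" "(H has_real_derivative H1) (at u0)"
    unfolding f_def H_def using assms(3,4) by (auto intro!: derivative_eq_intros)
  moreover have "(h has_real_derivative h1) (at x0)"
    unfolding h_def by (auto intro!: derivative_eq_intros)
  moreover have "(K has_real_derivative K1) (at u0)" using K'[of u0] by simp
  ultimately show ?thesis using that by blast
qed

section \<open>Transformation of the arbitrary elements\<close>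

abbreviation e_f :: "point \<times> elts" where "e_f \<equiv> ((0, 0, 0), (1, 0, 0, 0))"
abbreviation e_h :: "point \<times> elts" where "e_h \<equiv> ((0, 0, 0), (0, 1, 0, 0))"
abbreviation e_H :: "point \<times> elts" where "e_H \<equiv> ((0, 0, 0), (0, 0, 1, 0))"
abbreviation e_K :: "point \<times> elts" where "e_K \<equiv> ((0, 0, 0), (0, 0, 0, 1))"
abbreviation e_t :: "point \<times> elts" where "e_t \<equiv> ((1, 0, 0), (0, 0, 0, 0))"
abbreviation e_x :: "point \<times> elts" where "e_x \<equiv> ((0, 1, 0), (0, 0, 0, 0))"
abbreviation e_u :: "point \<times> elts" where "e_u \<equiv> ((0, 0, 1), (0, 0, 0, 0))"

lemma linear_expansion7:
  fixes L :: "point \<times> elts \<Rightarrow> real"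
  assumes "linear L"
  shows "L ((a, b, c), (f, h, H, K)) =
    a * L e_t + b * L e_x + c * L e_u + f * L e_f + h * L e_h + H * L e_H + K * L e_K"
proof -
  have "L ((a, b, c), (f, h, H, K)) = L (a *\<^sub>R e_t + b *\<^sub>R e_x + c *\<^sub>R e_u + f *\<^sub>R e_f + h *\<^sub>R e_h + H *\<^sub>R e_H + K *\<^sub>R e_K)"
    by simp
  then show ?thesis by (simp only: linear_add[OF assms] linear_scale[OF assms] real_scaleR_def)
qed

text \<open>The chain rule on both sides of the identity \<open>eq\<close> in the three coordinate
  directions: \<open>f\<close>, \<open>h\<close> move only with x, and \<open>H\<close>,
  \<open>K\<close> only with u. The slope \<open>g1\<close> of the new element is the same in all
  three.\<close>

lemma component_derivatives:
  fixes C :: "point \<times> elts \<Rightarrow> real" and Y :: "point \<Rightarrow> real"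
  assumes "open \<Omega>" "(t, x, u) \<in> \<Omega>"
    and "(f has_real_derivative f1) (at x)" "(h has_real_derivative h1) (at x)"
    and "(H has_real_derivative H1) (at u)" "(K has_real_derivative K1) (at u)"
    and "(g has_real_derivative g1) (at (Y (t, x, u)))" "Y differentiable (at (t, x, u))"
    and C: "C differentiable (at ((t, x, u), (f x, h x, H u, K u)))"
    and eq: "\<forall>(t, x, u)\<in>\<Omega>. C ((t, x, u), (f x, h x, H u, K u)) = g (Y (t, x, u))"
  defines "\<theta> \<equiv> (f x, h x, H u, K u)"
  shows "fd C ((t, x, u), \<theta>) e_t = g1 * fd Y (t, x, u) (1, 0, 0)"
    and "fd C ((t, x, u), \<theta>) e_x + f1 * fd C ((t, x, u), \<theta>) e_f + h1 * fd C ((t, x, u), \<theta>) e_h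
      = g1 * fd Y (t, x, u) (0, 1, 0)"
    and "fd C ((t, x, u), \<theta>) e_u + H1 * fd C ((t, x, u), \<theta>) e_H + K1 * fd C ((t, x, u), \<theta>) e_K
      = g1 * fd Y (t, x, u) (0, 0, 1)"
proof -
  let ?z = "(t, x, u)"
  have px: "((\<lambda>z::point. fst (snd z)) has_derivative (\<lambda>v. fst (snd v))) (at ?z)"
    and pu: "((\<lambda>z::point. snd (snd z)) has_derivative (\<lambda>v. snd (snd v))) (at ?z)"
    by (auto intro!: derivative_eq_intros)
  have on_x: "((\<lambda>z::point. k (fst (snd z))) has_derivative (\<lambda>v. k1 * fst (snd v))) (at ?z)"
    if "(k has_real_derivative k1) (at x)" for k k1
    using has_derivative_compose[OF px, of k "(*) k1"] that by (simp add: has_field_derivative_def o_def)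
  have on_u: "((\<lambda>z::point. k (snd (snd z))) has_derivative (\<lambda>v. k1 * snd (snd v))) (at ?z)"
    if "(k has_real_derivative k1) (at u)" for k k1
    using has_derivative_compose[OF pu, of k "(*) k1"] that by (simp add: has_field_derivative_def o_def)
  let ?j = "\<lambda>z::point. (z, (f (fst (snd z)), h (fst (snd z)), H (snd (snd z)), K (snd (snd z))))"
  have "(?j has_derivative (\<lambda>v. (v, (f1 * fst (snd v), h1 * fst (snd v), H1 * snd (snd v), K1 * snd (snd v))))) (at ?z)"
    by (intro has_derivative_Pair has_derivative_ident on_x on_u assms)
  from has_derivative_compose[OF this, of C "fd C (?z, \<theta>)"] fd_has_derivative[OF C]
  have l: "((\<lambda>z. C (?j z)) has_derivative
      (\<lambda>v. fd C (?z, \<theta>) (v, (f1 * fst (snd v), h1 * fst (snd v), H1 * snd (snd v), K1 * snd (snd v))))) (at ?z)"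
    by (simp add: \<theta>_def o_def)
  have "((\<lambda>z. g (Y z)) has_derivative (\<lambda>v. g1 * fd Y ?z v)) (at ?z)"
    using has_derivative_compose[OF fd_has_derivative[OF assms(8)], of g "(*) g1"] assms(7)
    by (simp add: has_field_derivative_def o_def)
  moreover have "((\<lambda>z. g (Y z)) has_derivative
      (\<lambda>v. fd C (?z, \<theta>) (v, (f1 * fst (snd v), h1 * fst (snd v), H1 * snd (snd v), K1 * snd (snd v))))) (at ?z)"
    by (rule has_derivative_transform_within_open[OF l assms(1,2)]) (use eq in auto)
  ultimately have "(\<lambda>v. fd C (?z, \<theta>) (v, (f1 * fst (snd v), h1 * fst (snd v), H1 * snd (snd v), K1 * snd (snd v))))
      = (\<lambda>v. g1 * fd Y ?z v)"
    by (rule has_derivative_unique[rotated])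
  then have E: "fd C (?z, \<theta>) ((a, b, c), (f1 * b, h1 * b, H1 * c, K1 * c)) = g1 * fd Y ?z (a, b, c)" for a b c
    by (auto simp: fun_eq_iff)
  have lin: "linear (fd C (?z, \<theta>))" using linear_fd[OF C] by (simp add: \<theta>_def)
  show "fd C (?z, \<theta>) e_t = g1 * fd Y ?z (1, 0, 0)"
    "fd C (?z, \<theta>) e_x + f1 * fd C (?z, \<theta>) e_f + h1 * fd C (?z, \<theta>) e_h = g1 * fd Y ?z (0, 1, 0)"
    "fd C (?z, \<theta>) e_u + H1 * fd C (?z, \<theta>) e_H + K1 * fd C (?z, \<theta>) e_K = g1 * fd Y ?z (0, 0, 1)"
    using E[of 1 0 0] E[of 0 1 0] E[of 0 0 1] linear_expansion7[OF lin, of 0 1 0 f1 h1 0 0]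
      linear_expansion7[OF lin, of 0 0 1 0 0 H1 K1] by simp_all
qed

lemma continuous_eq_zero_extend:
  fixes G :: "elts \<Rightarrow> real"
  assumes "continuous_on UNIV G" "\<And>f h H K. f \<noteq> 0 \<Longrightarrow> H \<noteq> 0 \<Longrightarrow> G (f, h, H, K) = 0"
  shows "G \<theta> = 0"
proof -
  obtain f h H K where \<theta>: "\<theta> = (f, h, H, K)" by (cases \<theta>)
  \<comment> \<open>Shifting \<open>f\<close> and \<open>H\<close> by the same \<open>s\<close>
    leaves the set where one of them vanishes, except at \<open>s = - f\<close> and
    \<open>s = - H\<close>; near 0 neither occurs with \<open>s\<close> nonzero.\<close>
  have "continuous_on UNIV (G \<circ> (\<lambda>s::real. (f + s, h, H + s, K)))"
    by (rule continuous_on_compose[OF _ continuous_on_subset[OF assms(1) subset_UNIV]])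
      (intro continuous_on_Pair continuous_on_add continuous_on_const continuous_on_id)
  then have "isCont (\<lambda>s. G (f + s, h, H + s, K)) 0"
    by (simp add: o_def continuous_on_eq_continuous_at)
  then have "((\<lambda>s. G (f + s, h, H + s, K)) \<longlongrightarrow> G \<theta>) (at 0)" by (simp add: isCont_def \<theta>)
  moreover have "\<forall>\<^sub>F s in at 0. G (f + s, h, H + s, K) = 0"
    using eventually_conj[OF eventually_neq_at_within[of "- f" 0 UNIV] eventually_neq_at_within[of "- H" 0 UNIV]]
    by (rule eventually_mono) (auto intro!: assms(2))
  then have "((\<lambda>s. G (f + s, h, H + s, K)) \<longlongrightarrow> 0) (at 0)" by (rule tendsto_eventually)
  ultimately show ?thesis by (rule tendsto_unique[OF at_neq_bot])
qed

text \<open>The slope \<open>g\<close> is chosen after the old slopes, because the new element may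
  change with the old ones; it is nevertheless shared by the three directions. Eliminating it and
  varying the old slopes kills individual partial derivatives of \<open>C\<close>.\<close>

definition intertwines :: "(point \<times> elts \<Rightarrow> real) \<Rightarrow> (point \<Rightarrow> real) \<Rightarrow> point \<Rightarrow> elts \<Rightarrow> bool" where
  "intertwines C Y z \<theta> \<longleftrightarrow> (\<forall>f1 h1 H1 K1. \<exists>g.
    fd C (z, \<theta>) e_t = g * fd Y z (1, 0, 0) \<and>
    fd C (z, \<theta>) e_x + f1 * fd C (z, \<theta>) e_f + h1 * fd C (z, \<theta>) e_h = g * fd Y z (0, 1, 0) \<and>
    fd C (z, \<theta>) e_u + H1 * fd C (z, \<theta>) e_H + K1 * fd C (z, \<theta>) e_K = g * fd Y z (0, 0, 1))"

lemma intertwines_t: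
  assumes "intertwines C Y z \<theta>" "fd Y z (1, 0, 0) = 0"
  shows "fd C (z, \<theta>) e_t = 0"
  using assms unfolding intertwines_def by auto

lemma intertwines_x:
  assumes "intertwines C Y z \<theta>" "fd Y z (0, 1, 0) = 0"
  shows "fd C (z, \<theta>) e_x = 0" "fd C (z, \<theta>) e_f = 0" "fd C (z, \<theta>) e_h = 0"
proof -
  have *: "fd C (z, \<theta>) e_x + f1 * fd C (z, \<theta>) e_f + h1 * fd C (z, \<theta>) e_h = 0" for f1 h1
    using assms unfolding intertwines_def by (metis mult_zero_right)
  show "fd C (z, \<theta>) e_x = 0" "fd C (z, \<theta>) e_f = 0" "fd C (z, \<theta>) e_h = 0"
    using *[of 0 0] *[of 1 0] *[of 0 1] by simp_all
qed

lemma intertwines_u: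
  assumes "intertwines C Y z \<theta>" "fd Y z (0, 0, 1) = 0"
  shows "fd C (z, \<theta>) e_u = 0" "fd C (z, \<theta>) e_H = 0" "fd C (z, \<theta>) e_K = 0"
proof -
  have *: "fd C (z, \<theta>) e_u + H1 * fd C (z, \<theta>) e_H + K1 * fd C (z, \<theta>) e_K = 0" for H1 K1
    using assms unfolding intertwines_def by (metis mult_zero_right)
  show "fd C (z, \<theta>) e_u = 0" "fd C (z, \<theta>) e_H = 0" "fd C (z, \<theta>) e_K = 0"
    using *[of 0 0] *[of 1 0] *[of 0 1] by simp_all
qed

text \<open>The u-equation determines \<open>g\<close>. Substituted into the others, it yields
  identities whose sides involve disjoint sets of free slopes, so each slope has coefficient
  0.\<close>

lemma intertwines_u_nonzero:
  assumes "intertwines C Y z \<theta>" "fd Y z (0, 0, 1) \<noteq> 0"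
  shows "fd C (z, \<theta>) e_f = 0" "fd C (z, \<theta>) e_h = 0"
    "fd Y z (1, 0, 0) * fd C (z, \<theta>) e_H = 0" "fd Y z (0, 1, 0) * fd C (z, \<theta>) e_H = 0"
proof -
  have *: "fd Y z (0, 0, 1) * (fd C (z, \<theta>) e_x + f1 * fd C (z, \<theta>) e_f + h1 * fd C (z, \<theta>) e_h) =
      fd Y z (0, 1, 0) * (fd C (z, \<theta>) e_u + H1 * fd C (z, \<theta>) e_H + K1 * fd C (z, \<theta>) e_K) \<and>
    fd Y z (0, 0, 1) * fd C (z, \<theta>) e_t =
      fd Y z (1, 0, 0) * (fd C (z, \<theta>) e_u + H1 * fd C (z, \<theta>) e_H + K1 * fd C (z, \<theta>) e_K)" for f1 h1 H1 K1
  proof -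
    obtain g where "fd C (z, \<theta>) e_t = g * fd Y z (1, 0, 0)"
      "fd C (z, \<theta>) e_x + f1 * fd C (z, \<theta>) e_f + h1 * fd C (z, \<theta>) e_h = g * fd Y z (0, 1, 0)"
      "fd C (z, \<theta>) e_u + H1 * fd C (z, \<theta>) e_H + K1 * fd C (z, \<theta>) e_K = g * fd Y z (0, 0, 1)"
      using assms(1) unfolding intertwines_def by metis
    then show ?thesis by (simp only: mult.commute mult.left_commute) 
  qed
  show "fd C (z, \<theta>) e_f = 0" using *[of 0 0 0 0] *[of 1 0 0 0] assms(2) by (simp add: distrib_left)
  show "fd C (z, \<theta>) e_h = 0" using *[of 0 0 0 0] *[of 0 1 0 0] assms(2) by (simp add: distrib_left)
  show "fd Y z (1, 0, 0) * fd C (z, \<theta>) e_H = 0"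
    using *[of 0 0 0 0] *[of 0 0 1 0] by (simp add: distrib_left)
  show "fd Y z (0, 1, 0) * fd C (z, \<theta>) e_H = 0"
    using *[of 0 0 0 0] *[of 0 0 1 0] by (simp add: distrib_left)
qed

lemma fd_section:
  assumes "C differentiable (at (z, \<theta>))"
  shows "fd (\<lambda>z. C (z, \<theta>)) z = (\<lambda>v. fd C (z, \<theta>) (v, 0))"
proof (rule fd_eqI)
  have "((\<lambda>z. (z, \<theta>)) has_derivative (\<lambda>v. (v, 0))) (at z)"
    by (intro has_derivative_Pair has_derivative_ident has_derivative_const)
  from has_derivative_compose[OF this, of C "fd C (z, \<theta>)"] fd_has_derivative[OF assms]
  show "((\<lambda>z. C (z, \<theta>)) has_derivative (\<lambda>v. fd C (z, \<theta>) (v, 0))) (at z)"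
    by (simp add: o_def)
qed

lemma independent_of_HK:
  fixes C :: "point \<times> elts \<Rightarrow> real"
  assumes "\<And>\<theta>. C differentiable (at (z, \<theta>))"
    and "\<And>\<theta>. fd C (z, \<theta>) e_H = 0" "\<And>\<theta>. fd C (z, \<theta>) e_K = 0"
  shows "C (z, (f, h, H, K)) = C (z, (f, h, H', K'))"
proof -
  have "((\<lambda>y. C (z, (f, h, fst y, snd y))) has_derivative (\<lambda>v. 0)) (at y)" for y :: "real \<times> real"
  proof -
    let ?\<theta> = "(f, h, fst y, snd y)"
    have "((\<lambda>y. (z, (f, h, fst y, snd y))) has_derivative (\<lambda>v. (0, (0, 0, fst v, snd v)))) (at y)"
      by (intro has_derivative_Pair has_derivative_const has_derivative_fst has_derivative_snd has_derivative_ident)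
    from has_derivative_compose[OF this, of C "fd C (z, ?\<theta>)"] fd_has_derivative[OF assms(1)]
    have "((\<lambda>y. C (z, (f, h, fst y, snd y))) has_derivative (\<lambda>v. fd C (z, ?\<theta>) (0, (0, 0, fst v, snd v)))) (at y)"
      by (simp add: o_def)
    moreover have "fd C (z, ?\<theta>) (0, (0, 0, fst v, snd v)) = 0" for v
      using linear_expansion7[OF linear_fd[OF assms(1)], of ?\<theta> 0 0 0 0 0 "fst v" "snd v"] assms(2,3)
      by (simp add: zero_prod_def)
    ultimately show ?thesis by simp
  qed
  then have "(\<lambda>y. C (z, (f, h, fst y, snd y))) (H, K) = (\<lambda>y. C (z, (f, h, fst y, snd y))) (H', K')"
    by (intro has_derivative_zero_unique_connected[OF open_UNIV connected_UNIV]) auto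
  then show ?thesis by simp
qed

lemma independent_of_fh:
  fixes C :: "point \<times> elts \<Rightarrow> real"
  assumes "\<And>\<theta>. C differentiable (at (z, \<theta>))"
    and "\<And>\<theta>. fd C (z, \<theta>) e_f = 0" "\<And>\<theta>. fd C (z, \<theta>) e_h = 0"
  shows "C (z, (f, h, H, K)) = C (z, (f', h', H, K))"
proof -
  have "((\<lambda>y. C (z, (fst y, snd y, H, K))) has_derivative (\<lambda>v. 0)) (at y)" for y :: "real \<times> real"
  proof -
    let ?\<theta> = "(fst y, snd y, H, K)"
    have "((\<lambda>y. (z, (fst y, snd y, H, K))) has_derivative (\<lambda>v. (0, (fst v, snd v, 0, 0)))) (at y)"
      by (intro has_derivative_Pair has_derivative_const has_derivative_fst has_derivative_snd has_derivative_ident)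
    from has_derivative_compose[OF this, of C "fd C (z, ?\<theta>)"] fd_has_derivative[OF assms(1)]
    have "((\<lambda>y. C (z, (fst y, snd y, H, K))) has_derivative (\<lambda>v. fd C (z, ?\<theta>) (0, (fst v, snd v, 0, 0)))) (at y)"
      by (simp add: o_def)
    moreover have "fd C (z, ?\<theta>) (0, (fst v, snd v, 0, 0)) = 0" for v
      using linear_expansion7[OF linear_fd[OF assms(1)], of ?\<theta> 0 0 0 "fst v" "snd v" 0 0] assms(2,3)
      by (simp add: zero_prod_def)
    ultimately show ?thesis by simp
  qed
  then have "(\<lambda>y. C (z, (fst y, snd y, H, K))) (f, h) = (\<lambda>y. C (z, (fst y, snd y, H, K))) (f', h')"
    by (intro has_derivative_zero_unique_connected[OF open_UNIV connected_UNIV]) auto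
  then show ?thesis by simp
qed

section \<open>An equivalence transformation and its pointwise data\<close>

locale equivalence_transformation =
  fixes \<Omega> :: "point set" and T :: "point \<times> elts \<Rightarrow> point \<times> elts" and P :: "point \<Rightarrow> point"
  assumes open_dom: "open \<Omega>" and connected_dom: "connected \<Omega>" and nonempty_dom: "\<Omega> \<noteq> {}"
    and nondegenerate: "nondegenerate (\<Omega> \<times> UNIV) T"
    and projects: "projects_to \<Omega> T P"
    and maps_class: "\<And>f h H K. in_class \<Omega> f h H K \<Longrightarrow>
         (\<exists>f' h' H' K'.
            in_class (P ` \<Omega>) f' h' H' K' \<and>
            (\<forall>(t, x, u)\<in>\<Omega>. case P (t, x, u) of (t', x', u') \<Rightarrow>
               snd (T ((t, x, u), (f x, h x, H u, K u))) = (f' x', h' x', H' u', K' u')) \<and>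
            transforms_eq \<Omega> P (wave_eq f h H K) (wave_eq f' h' H' K'))"
begin

text \<open>By \<open>projects_to\<close> the first three components are the same for every value of
  the elements on the domain. Reading them off at 0 makes them sections of \<open>T\<close>, which
  inherit its smoothness.\<close>

definition "\<tau> z = fst (fst (T (z, 0)))"
definition "\<xi> z = fst (snd (fst (T (z, 0))))"
definition "\<upsilon> z = snd (snd (fst (T (z, 0))))"
definition "Tf y = fst (snd (T y))"
definition "Th y = fst (snd (snd (T y)))"
definition "TH y = fst (snd (snd (snd (T y))))"
definition "TK y = snd (snd (snd (snd (T y))))"

lemma open_prod: "open (\<Omega> \<times> (UNIV :: elts set))"
  by (intro open_Times open_dom open_UNIV)

lemma Ck_T: "Ck_on k (\<Omega> \<times> UNIV) T"
  using nondegenerate by (simp add: nondegenerate_def smooth_on_def)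

lemma Ck_components: "Ck_on k (\<Omega> \<times> UNIV) Tf" "Ck_on k (\<Omega> \<times> UNIV) Th"
  "Ck_on k (\<Omega> \<times> UNIV) TH" "Ck_on k (\<Omega> \<times> UNIV) TK"
  unfolding Tf_def Th_def TH_def TK_def by (intro Ck_on_fst Ck_on_snd open_prod Ck_T)+

lemma Ck_section: "Ck_on k \<Omega> (\<lambda>z. C (z, \<theta>))" if "Ck_on k (\<Omega> \<times> UNIV) C" for C :: "point \<times> elts \<Rightarrow> 'c::euclidean_space"
  by (rule Ck_on_compose[OF open_dom that]) (auto intro: Ck_on_Pair open_dom Ck_on_ident Ck_on_const)

lemma Ck_base: "Ck_on k \<Omega> \<tau>" "Ck_on k \<Omega> \<xi>" "Ck_on k \<Omega> \<upsilon>"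
  unfolding \<tau>_def \<xi>_def \<upsilon>_def by (intro Ck_on_fst Ck_on_snd open_dom Ck_section Ck_T)+

lemma P_eq: "\<forall>z\<in>\<Omega>. P z = (\<tau> z, \<xi> z, \<upsilon> z)"
proof
  fix z assume "z \<in> \<Omega>"
  then have "fst (T (z, 0)) = P z" using projects unfolding projects_to_def by blast
  then show "P z = (\<tau> z, \<xi> z, \<upsilon> z)" by (simp add: \<tau>_def \<xi>_def \<upsilon>_def)
qed

lemma fst_T: "z \<in> \<Omega> \<Longrightarrow> fst (T (z, \<theta>)) = (\<tau> z, \<xi> z, \<upsilon> z)"
  using projects P_eq unfolding projects_to_def by metis

lemma base_differentiable:
  "z \<in> \<Omega> \<Longrightarrow> \<tau> differentiable (at z)" "z \<in> \<Omega> \<Longrightarrow> \<xi> differentiable (at z)" "z \<in> \<Omega> \<Longrightarrow> \<upsilon> differentiable (at z)"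
  using Ck_on_differentiable[OF Ck_base(1)[of 1]] Ck_on_differentiable[OF Ck_base(2)[of 1]]
    Ck_on_differentiable[OF Ck_base(3)[of 1]] by auto

lemma component_differentiable:
  assumes "z \<in> \<Omega>"
  shows "Tf differentiable (at (z, \<theta>))" "Th differentiable (at (z, \<theta>))"
    "TH differentiable (at (z, \<theta>))" "TK differentiable (at (z, \<theta>))"
  using assms Ck_on_differentiable[OF Ck_components(1)[of 1], of "(z, \<theta>)"]
    Ck_on_differentiable[OF Ck_components(2)[of 1], of "(z, \<theta>)"]
    Ck_on_differentiable[OF Ck_components(3)[of 1], of "(z, \<theta>)"]
    Ck_on_differentiable[OF Ck_components(4)[of 1], of "(z, \<theta>)"] by auto

text \<open>The first three components of \<open>T\<close> factor through the projection to (t, x,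
  u), so surjectivity of the derivative of \<open>T\<close> descends to the base map.\<close>

lemma base_surj:
  assumes "z \<in> \<Omega>"
  obtains v where "fd \<tau> z v = a" "fd \<xi> z v = b" "fd \<upsilon> z v = c"
proof -
  let ?y = "(z, 0 :: elts)"
  have y: "?y \<in> \<Omega> \<times> UNIV" using assms by simp
  have "surj (fd T ?y)"
    using nondegenerate y unfolding nondegenerate_def by (meson bij_is_surj)
  then obtain w where w: "fd T ?y w = ((a, b, c), 0)" by (metis surjD)
  have dT: "(T has_derivative fd T ?y) (at ?y)"
    using fd_has_derivative[OF Ck_on_differentiable[OF Ck_T[of 1] _ y]] by simp
  have l: "((\<lambda>y. fst (T y)) has_derivative (\<lambda>w. fst (fd T ?y w))) (at ?y)"
    by (intro has_derivative_fst dT)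
  have p: "((\<lambda>y. fst y) has_derivative (\<lambda>w. fst w)) (at ?y)"
    by (intro has_derivative_fst has_derivative_ident)
  have "((\<lambda>y. F (fst y)) has_derivative (\<lambda>w. fd F z (fst w))) (at ?y)" if "F differentiable (at z)"
    for F :: "point \<Rightarrow> real"
    using has_derivative_compose[OF p, of F "fd F z"] fd_has_derivative[OF that] by (simp add: o_def)
  then have "((\<lambda>y::point \<times> elts. (\<tau> (fst y), \<xi> (fst y), \<upsilon> (fst y))) has_derivative
      (\<lambda>w. (fd \<tau> z (fst w), fd \<xi> z (fst w), fd \<upsilon> z (fst w)))) (at ?y)"
    using base_differentiable[OF assms] by (intro has_derivative_Pair)
  moreover have "((\<lambda>y::point \<times> elts. (\<tau> (fst y), \<xi> (fst y), \<upsilon> (fst y))) has_derivative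
      (\<lambda>w. fst (fd T ?y w))) (at ?y)"
    by (rule has_derivative_transform_within_open[OF l open_prod y]) (auto simp: fst_T)
  ultimately have "(\<lambda>w. fst (fd T ?y w)) = (\<lambda>w. (fd \<tau> z (fst w), fd \<xi> z (fst w), fd \<upsilon> z (fst w)))"
    by (rule has_derivative_unique[rotated])
  from fun_cong[OF this, of w] w that[of "fst w"] show ?thesis by simp
qed

text \<open>Everything \<open>maps_class\<close> yields at one point, for prescribed values and
  slopes of the old elements, collected once. The numbers \<open>gf\<close>, \<open>gh\<close>,
  \<open>gH\<close>, \<open>gK\<close> are the slopes of the new elements.\<close>

lemma element_data:
  fixes f0 h0 H0 K0 f1 h1 H1 K1 :: real
  assumes z: "(t, x, u) \<in> \<Omega>" and "f0 \<noteq> 0" "H0 \<noteq> 0"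
  defines "z \<equiv> (t, x, u)" and "\<theta> \<equiv> (f0, h0, H0, K0)"
  obtains f h H K f' h' H' K' gf gh gH gK where
    "f x = f0" "h x = h0" "H u = H0" "K u = K0"
    "(H has_real_derivative H1) (at u)" "(H' has_real_derivative gH) (at (\<upsilon> z))"
    "transforms_eq \<Omega> P (wave_eq f h H K) (wave_eq f' h' H' K')"
    "f' (\<xi> z) = Tf (z, \<theta>)" "h' (\<xi> z) = Th (z, \<theta>)" "H' (\<upsilon> z) = TH (z, \<theta>)" "K' (\<upsilon> z) = TK (z, \<theta>)"
    "Tf (z, \<theta>) \<noteq> 0" "TH (z, \<theta>) \<noteq> 0"
    "\<forall>(C, Y, g) \<in> {(Tf, \<xi>, gf), (Th, \<xi>, gh), (TH, \<upsilon>, gH), (TK, \<upsilon>, gK)}.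
      fd C (z, \<theta>) e_t = g * fd Y z (1, 0, 0) \<and>
      fd C (z, \<theta>) e_x + f1 * fd C (z, \<theta>) e_f + h1 * fd C (z, \<theta>) e_h = g * fd Y z (0, 1, 0) \<and>
      fd C (z, \<theta>) e_u + H1 * fd C (z, \<theta>) e_H + K1 * fd C (z, \<theta>) e_K = g * fd Y z (0, 0, 1)"
proof -
  obtain f h H K where el: "in_class \<Omega> f h H K" "f x = f0" "h x = h0" "H u = H0" "K u = K0"
    "(f has_real_derivative f1) (at x)" "(h has_real_derivative h1) (at x)"
    "(H has_real_derivative H1) (at u)" "(K has_real_derivative K1) (at u)"
    using class_element_exists[OF open_dom z assms(2,3)] by metis
  obtain f' h' H' K' where im: "in_class (P ` \<Omega>) f' h' H' K'"
    "\<forall>(t, x, u)\<in>\<Omega>. case P (t, x, u) of (t', x', u') \<Rightarrow>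
               snd (T ((t, x, u), (f x, h x, H u, K u))) = (f' x', h' x', H' u', K' u')"
    "transforms_eq \<Omega> P (wave_eq f h H K) (wave_eq f' h' H' K')"
    using maps_class[OF el(1)] by blast
  have comp: "Tf ((t, x, u), (f x, h x, H u, K u)) = f' (\<xi> (t, x, u))"
    "Th ((t, x, u), (f x, h x, H u, K u)) = h' (\<xi> (t, x, u))"
    "TH ((t, x, u), (f x, h x, H u, K u)) = H' (\<upsilon> (t, x, u))"
    "TK ((t, x, u), (f x, h x, H u, K u)) = K' (\<upsilon> (t, x, u))" if "(t, x, u) \<in> \<Omega>" for t x u
    using bspec[OF im(2) that] bspec[OF P_eq that] by (simp_all add: Tf_def Th_def TH_def TK_def)
  have "P z \<in> P ` \<Omega>" using z by (simp add: z_def)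
  then have ranges: "\<xi> z \<in> x_range (P ` \<Omega>)" "\<upsilon> z \<in> u_range (P ` \<Omega>)"
    using bspec[OF P_eq z] range_mem by (auto simp: z_def)
  have "\<exists>g. (k has_real_derivative g) (at y)" if "smooth_on S k" "y \<in> S" for S and k :: "real \<Rightarrow> real" and y
  proof -
    have "k differentiable (at y)"
      using that Ck_on_differentiable[of 1 S k y] by (simp add: smooth_on_def del: Ck_on.simps)
    then show ?thesis by (simp add: real_differentiable_def)
  qed
  then obtain gf gh gH gK where g: "(f' has_real_derivative gf) (at (\<xi> z))" "(h' has_real_derivative gh) (at (\<xi> z))"
    "(H' has_real_derivative gH) (at (\<upsilon> z))" "(K' has_real_derivative gK) (at (\<upsilon> z))"
    using im(1) ranges unfolding in_class_def by metis
  have th: "\<theta> = (f x, h x, H u, K u)" by (simp add: el \<theta>_def)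
  have vals: "f' (\<xi> z) = Tf (z, \<theta>)" "h' (\<xi> z) = Th (z, \<theta>)" "H' (\<upsilon> z) = TH (z, \<theta>)" "K' (\<upsilon> z) = TK (z, \<theta>)"
    using comp[OF z] by (simp_all add: z_def th)
  have "f' (\<xi> z) * H' (\<upsilon> z) \<noteq> 0" using im(1) ranges unfolding in_class_def by blast
  then have nz: "Tf (z, \<theta>) \<noteq> 0" "TH (z, \<theta>) \<noteq> 0" using vals by auto
  note cd = component_derivatives[OF open_dom z el(6-9), folded th z_def]
  have zO: "z \<in> \<Omega>" using z by (simp add: z_def)
  have eqs: "\<forall>(t, x, u)\<in>\<Omega>. Tf ((t, x, u), (f x, h x, H u, K u)) = f' (\<xi> (t, x, u))"
    "\<forall>(t, x, u)\<in>\<Omega>. Th ((t, x, u), (f x, h x, H u, K u)) = h' (\<xi> (t, x, u))"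
    "\<forall>(t, x, u)\<in>\<Omega>. TH ((t, x, u), (f x, h x, H u, K u)) = H' (\<upsilon> (t, x, u))"
    "\<forall>(t, x, u)\<in>\<Omega>. TK ((t, x, u), (f x, h x, H u, K u)) = K' (\<upsilon> (t, x, u))"
    using comp by auto
  note der = cd[OF g(1) base_differentiable(2)[OF zO] component_differentiable(1)[OF zO] eqs(1)]
    cd[OF g(2) base_differentiable(2)[OF zO] component_differentiable(2)[OF zO] eqs(2)]
    cd[OF g(3) base_differentiable(3)[OF zO] component_differentiable(3)[OF zO] eqs(3)]
    cd[OF g(4) base_differentiable(3)[OF zO] component_differentiable(4)[OF zO] eqs(4)]
  show ?thesis
    by (rule that[OF el(2-5,8) g(3) im(3) vals nz, of gf gh gK]) (simp only: ball_simps split_conv der simp_thms)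
qed

end

section \<open>The point transformation and the variables its components depend on\<close>

context equivalence_transformation
begin

lemma intertwines_components:
  assumes "z \<in> \<Omega>" "f \<noteq> 0" "H \<noteq> 0"
  shows "intertwines Tf \<xi> z (f, h, H, K)" "intertwines Th \<xi> z (f, h, H, K)"
    "intertwines TH \<upsilon> z (f, h, H, K)" "intertwines TK \<upsilon> z (f, h, H, K)"
proof -
  obtain t x u where z: "z = (t, x, u)" by (cases z)
  define E where "E C Y f1 h1 H1 K1 g \<longleftrightarrow> fd C (z, (f, h, H, K)) e_t = g * fd Y z (1, 0, 0) \<and>
      fd C (z, (f, h, H, K)) e_x + f1 * fd C (z, (f, h, H, K)) e_f + h1 * fd C (z, (f, h, H, K)) e_h = g * fd Y z (0, 1, 0) \<and>
      fd C (z, (f, h, H, K)) e_u + H1 * fd C (z, (f, h, H, K)) e_H + K1 * fd C (z, (f, h, H, K)) e_K = g * fd Y z (0, 0, 1)"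
    for C :: "point \<times> elts \<Rightarrow> real" and Y f1 h1 H1 K1 g
  have "(\<exists>g. E Tf \<xi> f1 h1 H1 K1 g) \<and> (\<exists>g. E Th \<xi> f1 h1 H1 K1 g) \<and>
    (\<exists>g. E TH \<upsilon> f1 h1 H1 K1 g) \<and> (\<exists>g. E TK \<upsilon> f1 h1 H1 K1 g)" for f1 h1 H1 K1
  proof -
    obtain gf gh gH gK where
      "\<forall>(C, Y, g) \<in> {(Tf, \<xi>, gf), (Th, \<xi>, gh), (TH, \<upsilon>, gH), (TK, \<upsilon>, gK)}. E C Y f1 h1 H1 K1 g"
      by (rule element_data[of t x u f H h K H1 f1 h1 K1, folded z, OF assms, folded E_def], rule that, assumption)
    then have "E Tf \<xi> f1 h1 H1 K1 gf \<and> E Th \<xi> f1 h1 H1 K1 gh \<and> E TH \<upsilon> f1 h1 H1 K1 gH \<and> E TK \<upsilon> f1 h1 H1 K1 gK"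
      by simp
    then show ?thesis by blast
  qed
  then show "intertwines Tf \<xi> z (f, h, H, K)" "intertwines Th \<xi> z (f, h, H, K)"
    "intertwines TH \<upsilon> z (f, h, H, K)" "intertwines TK \<upsilon> z (f, h, H, K)"
    unfolding intertwines_def E_def[symmetric] by simp_all
qed

text \<open>By \<open>base_surj\<close> there are vectors on which the differentials of
  \<open>\<tau>\<close> and \<open>\<xi>\<close> take the values (1, 0) and (0, 1). The determinant
  of these values is 1 and expands by the Cauchy-Binet formula into the three minors.\<close>

lemma minors_nonzero:
  assumes "z \<in> \<Omega>"
  shows "fd \<tau> z (1, 0, 0) * fd \<xi> z (0, 1, 0) - fd \<tau> z (0, 1, 0) * fd \<xi> z (1, 0, 0) \<noteq> 0 \<or>
    fd \<tau> z (0, 0, 1) * fd \<xi> z (0, 1, 0) - fd \<tau> z (0, 1, 0) * fd \<xi> z (0, 0, 1) \<noteq> 0 \<or>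
    fd \<tau> z (1, 0, 0) * fd \<xi> z (0, 0, 1) - fd \<tau> z (0, 0, 1) * fd \<xi> z (1, 0, 0) \<noteq> 0"
proof (rule ccontr)
  define Tt Tx Tu Xt Xx Xu where d: "Tt = fd \<tau> z (1, 0, 0)" "Tx = fd \<tau> z (0, 1, 0)" "Tu = fd \<tau> z (0, 0, 1)"
    "Xt = fd \<xi> z (1, 0, 0)" "Xx = fd \<xi> z (0, 1, 0)" "Xu = fd \<xi> z (0, 0, 1)"
  assume "\<not> ?thesis"
  then have m: "Tt * Xx - Tx * Xt = 0" "Tu * Xx - Tx * Xu = 0" "Tt * Xu - Tu * Xt = 0" by (simp_all add: d)
  have ex: "fd \<tau> z (a, b, c) = a * Tt + b * Tx + c * Tu" "fd \<xi> z (a, b, c) = a * Xt + b * Xx + c * Xu" for a b c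
    using linear_point_expansion[OF linear_fd[OF base_differentiable(1)[OF assms]], of a b c]
      linear_point_expansion[OF linear_fd[OF base_differentiable(2)[OF assms]], of a b c] by (simp_all add: d)
  obtain a b c where v: "fd \<tau> z (a, b, c) = 1" "fd \<xi> z (a, b, c) = 0"
    using base_surj[OF assms, of 1 0 0] by (metis prod.collapse)
  obtain a' b' c' where v': "fd \<tau> z (a', b', c') = 0" "fd \<xi> z (a', b', c') = 1"
    using base_surj[OF assms, of 0 1 0] by (metis prod.collapse)
  have "1 = (a * Tt + b * Tx + c * Tu) * (a' * Xt + b' * Xx + c' * Xu)
      - (a' * Tt + b' * Tx + c' * Tu) * (a * Xt + b * Xx + c * Xu)"
    using v v' by (simp add: ex)
  also have "\<dots> = (a * b' - b * a') * (Tt * Xx - Tx * Xt) - (b * c' - c * b') * (Tu * Xx - Tx * Xu)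
      + (a * c' - c * a') * (Tt * Xu - Tu * Xt)"
    by algebra
  finally show False using m by simp
qed

lemma symbol_relations:
  assumes "z \<in> \<Omega>" "f \<noteq> 0" "H \<noteq> 0"
  shows "Tf (z, (f, h, H, K)) * ((fd \<xi> z (1, 0, 0) + p * fd \<xi> z (0, 0, 1)) * (fd \<xi> z (0, 1, 0) + q * fd \<xi> z (0, 0, 1)))
      = TH (z, (f, h, H, K)) * ((fd \<tau> z (1, 0, 0) + p * fd \<tau> z (0, 0, 1)) * (fd \<tau> z (0, 1, 0) + q * fd \<tau> z (0, 0, 1)))"
    and "Tf (z, (f, h, H, K)) * (H * (fd \<xi> z (0, 1, 0))\<^sup>2 + f * (fd \<xi> z (1, 0, 0))\<^sup>2)
      = TH (z, (f, h, H, K)) * (H * (fd \<tau> z (0, 1, 0))\<^sup>2 + f * (fd \<tau> z (1, 0, 0))\<^sup>2)"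
    and "Tf (z, (f, h, H, K)) \<noteq> 0" "TH (z, (f, h, H, K)) \<noteq> 0"
proof -
  obtain t x u where z: "z = (t, x, u)" by (cases z)
  \<comment> \<open>The vector required by hypothesis \<open>vert\<close> of
    \<open>wave_symbol\<close>, which keeps \<open>\<kappa>\<close> away from 0.\<close>
  obtain v where v: "fd \<tau> z v = 0" "fd \<xi> z v = 0" "fd \<upsilon> z v = 1"
    using base_surj[OF assms(1)] by metis
  then have v3: "fd \<upsilon> z v \<noteq> 0" by simp
  have "Tf (z, (f, h, H, K)) * ((fd \<xi> z (1, 0, 0) + p * fd \<xi> z (0, 0, 1)) * (fd \<xi> z (0, 1, 0) + q * fd \<xi> z (0, 0, 1)))
      = TH (z, (f, h, H, K)) * ((fd \<tau> z (1, 0, 0) + p * fd \<tau> z (0, 0, 1)) * (fd \<tau> z (0, 1, 0) + q * fd \<tau> z (0, 0, 1))) \<and>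
    Tf (z, (f, h, H, K)) * (H * (fd \<xi> z (0, 1, 0) + 0 * fd \<xi> z (0, 0, 1))\<^sup>2 + f * (fd \<xi> z (1, 0, 0) + 0 * fd \<xi> z (0, 0, 1))\<^sup>2)
      = TH (z, (f, h, H, K)) * (H * (fd \<tau> z (0, 1, 0) + 0 * fd \<tau> z (0, 0, 1))\<^sup>2 + f * (fd \<tau> z (1, 0, 0) + 0 * fd \<tau> z (0, 0, 1))\<^sup>2) \<and>
    Tf (z, (f, h, H, K)) \<noteq> 0 \<and> TH (z, (f, h, H, K)) \<noteq> 0"
  proof (rule element_data[of t x u f H h K 0 0 0 0, folded z, OF assms], goal_cases)
    case el: (1 fe he He Ke f' h' H' K' gf gh gH gK)
    have fe: "fe x \<noteq> 0" using el(1) assms by simp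
    note sym = wave_symbol_all_jets[OF open_dom Ck_base P_eq assms(1) z el(7,5,6) fe v(1,2) v3 minors_nonzero[OF assms(1)],
        unfolded el(1,3,8,10)]
    show ?case by (intro conjI sym el(12,13))
  qed
  then show "Tf (z, (f, h, H, K)) * ((fd \<xi> z (1, 0, 0) + p * fd \<xi> z (0, 0, 1)) * (fd \<xi> z (0, 1, 0) + q * fd \<xi> z (0, 0, 1)))
      = TH (z, (f, h, H, K)) * ((fd \<tau> z (1, 0, 0) + p * fd \<tau> z (0, 0, 1)) * (fd \<tau> z (0, 1, 0) + q * fd \<tau> z (0, 0, 1)))"
    "Tf (z, (f, h, H, K)) * (H * (fd \<xi> z (0, 1, 0))\<^sup>2 + f * (fd \<xi> z (1, 0, 0))\<^sup>2)
      = TH (z, (f, h, H, K)) * (H * (fd \<tau> z (0, 1, 0))\<^sup>2 + f * (fd \<tau> z (1, 0, 0))\<^sup>2)"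
    "Tf (z, (f, h, H, K)) \<noteq> 0" "TH (z, (f, h, H, K)) \<noteq> 0"
    by simp_all
qed

lemma base_classification:
  assumes "z \<in> \<Omega>"
  shows "fd \<tau> z (0, 0, 1) = 0 \<and> fd \<xi> z (0, 0, 1) = 0 \<and>
    (fd \<xi> z (1, 0, 0) = 0 \<and> fd \<tau> z (0, 1, 0) = 0 \<and> fd \<xi> z (0, 1, 0) \<noteq> 0 \<and> fd \<tau> z (1, 0, 0) \<noteq> 0 \<or>
     fd \<xi> z (0, 1, 0) = 0 \<and> fd \<tau> z (1, 0, 0) = 0 \<and> fd \<xi> z (1, 0, 0) \<noteq> 0 \<and> fd \<tau> z (0, 1, 0) \<noteq> 0)"
proof (rule wave_symbol_classification[OF _ minors_nonzero[OF assms]])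
  fix f H :: real assume "f \<noteq> 0" "H \<noteq> 0"
  note s = symbol_relations[OF assms this, of 0 0]
  show "\<exists>a b. a \<noteq> 0 \<and> b \<noteq> 0 \<and>
     (\<forall>p q. a * ((fd \<xi> z (1, 0, 0) + p * fd \<xi> z (0, 0, 1)) * (fd \<xi> z (0, 1, 0) + q * fd \<xi> z (0, 0, 1)))
       = b * ((fd \<tau> z (1, 0, 0) + p * fd \<tau> z (0, 0, 1)) * (fd \<tau> z (0, 1, 0) + q * fd \<tau> z (0, 0, 1)))) \<and>
     a * (H * (fd \<xi> z (0, 1, 0))\<^sup>2 + f * (fd \<xi> z (1, 0, 0))\<^sup>2)
      = b * (H * (fd \<tau> z (0, 1, 0))\<^sup>2 + f * (fd \<tau> z (1, 0, 0))\<^sup>2)"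
    using s by (intro exI[of _ "Tf (z, (f, 0, H, 0))"] exI[of _ "TH (z, (f, 0, H, 0))"]) blast
qed

text \<open>The common kernel of the differentials of \<open>\<tau>\<close> and \<open>\<xi>\<close>
  is the u-direction, and surjectivity of the base map forces \<open>\<upsilon>\<close> to vary
  along it.\<close>

lemma upsilon_u:
  assumes "z \<in> \<Omega>"
  shows "fd \<upsilon> z (0, 0, 1) \<noteq> 0"
proof
  assume u0: "fd \<upsilon> z (0, 0, 1) = 0"
  note c = base_classification[OF assms]
  have ex: "fd Y z (a, b, c) = a * fd Y z (1, 0, 0) + b * fd Y z (0, 1, 0) + c * fd Y z (0, 0, 1)"
    if "Y differentiable (at z)" for Y :: "point \<Rightarrow> real" and a b c
    by (rule linear_point_expansion[OF linear_fd[OF that]])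
  obtain a b d where v: "fd \<tau> z (a, b, d) = 0" "fd \<xi> z (a, b, d) = 0" "fd \<upsilon> z (a, b, d) = 1"
    using base_surj[OF assms, of 0 0 1] by (metis prod.collapse)
  have "a = 0 \<and> b = 0"
    using v(1,2) c ex[OF base_differentiable(1)[OF assms], of a b d] ex[OF base_differentiable(2)[OF assms], of a b d]
    by auto
  then show False using v(3) ex[OF base_differentiable(3)[OF assms], of a b d] u0 by simp
qed

lemma has_real_derivative_theta:
  fixes C :: "point \<times> elts \<Rightarrow> real"
  assumes "C differentiable (at (z, c s))" "(c has_vector_derivative v) (at s)"
  shows "((\<lambda>s. C (z, c s)) has_real_derivative fd C (z, c s) (0, v)) (at s)"
  using has_real_derivative_along[of C "\<lambda>s. (z, c s)", OF assms(1)
      has_vector_derivative_Pair[OF has_vector_derivative_const assms(2)]] .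

text \<open>The transformations exchanging the roles of \<open>t\<close> and \<open>x\<close> are excluded: the transformed \<open>f\<close> and
  \<open>H\<close> would not depend on the value of \<open>f\<close>, although their ratio is proportional to \<open>1 / f\<close>.\<close>

lemma base_derivatives:
  assumes "z \<in> \<Omega>"
  shows "fd \<tau> z (0, 1, 0) = 0" "fd \<tau> z (0, 0, 1) = 0" "fd \<xi> z (1, 0, 0) = 0" "fd \<xi> z (0, 0, 1) = 0"
    "fd \<tau> z (1, 0, 0) \<noteq> 0" "fd \<xi> z (0, 1, 0) \<noteq> 0"
proof -
  have "\<not> (fd \<xi> z (0, 1, 0) = 0 \<and> fd \<tau> z (1, 0, 0) = 0 \<and> fd \<xi> z (1, 0, 0) \<noteq> 0)"
  proof
    assume sw: "fd \<xi> z (0, 1, 0) = 0 \<and> fd \<tau> z (1, 0, 0) = 0 \<and> fd \<xi> z (1, 0, 0) \<noteq> 0"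
    let ?\<theta> = "\<lambda>s. (s, 0, 1, 0) :: elts"
    have c: "(?\<theta> has_vector_derivative (1, 0, 0, 0)) (at 1)"
      by (intro has_vector_derivative_Pair has_vector_derivative_id has_vector_derivative_const)
    have one: "(1::real) \<noteq> 0" by simp
    have "fd Tf (z, ?\<theta> 1) e_f = 0" "fd TH (z, ?\<theta> 1) e_f = 0"
      using intertwines_x(2)[OF intertwines_components(1)[OF assms one one, of 0 0]] sw
        intertwines_u_nonzero(1)[OF intertwines_components(3)[OF assms one one, of 0 0] upsilon_u[OF assms]]
      by simp_all
    then have d: "((\<lambda>s. Tf (z, ?\<theta> s)) has_real_derivative 0) (at 1)" "((\<lambda>s. TH (z, ?\<theta> s)) has_real_derivative 0) (at 1)"
      using has_real_derivative_theta[OF component_differentiable(1)[OF assms] c]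
        has_real_derivative_theta[OF component_differentiable(3)[OF assms] c] by (simp_all add: zero_prod_def)
    \<comment> \<open>The symbol relation is differentiated in the value of \<open>f\<close> at 1.
      Both components are stationary there, so only the explicit factor \<open>s\<close> contributes
      on this side and nothing on the other.\<close>
    have l: "((\<lambda>s. Tf (z, ?\<theta> s) * (s * (fd \<xi> z (1, 0, 0))\<^sup>2)) has_real_derivative
        Tf (z, ?\<theta> 1) * (fd \<xi> z (1, 0, 0))\<^sup>2) (at 1)"
      by (auto intro!: derivative_eq_intros d)
    have "((\<lambda>s. TH (z, ?\<theta> s) * (fd \<tau> z (0, 1, 0))\<^sup>2) has_real_derivative 0) (at 1)"
      by (auto intro!: derivative_eq_intros d)
    then have r: "((\<lambda>s. Tf (z, ?\<theta> s) * (s * (fd \<xi> z (1, 0, 0))\<^sup>2)) has_real_derivative 0) (at 1)"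
    proof (rule has_field_derivative_transform_within_open[of _ _ _ "- {0}"])
      show "TH (z, ?\<theta> s) * (fd \<tau> z (0, 1, 0))\<^sup>2 = Tf (z, ?\<theta> s) * (s * (fd \<xi> z (1, 0, 0))\<^sup>2)"
        if "s \<in> - {0}" for s
        using symbol_relations(2)[OF assms _ one, of s 0 0] that sw by simp
    qed auto
    from DERIV_unique[OF l r] have "Tf (z, ?\<theta> 1) = 0" using sw by simp
    then show False using symbol_relations(3)[OF assms one one, of 0 0] by simp
  qed
  then show "fd \<tau> z (0, 1, 0) = 0" "fd \<tau> z (0, 0, 1) = 0" "fd \<xi> z (1, 0, 0) = 0" "fd \<xi> z (0, 0, 1) = 0"
    "fd \<tau> z (1, 0, 0) \<noteq> 0" "fd \<xi> z (0, 1, 0) \<noteq> 0"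
    using base_classification[OF assms] by auto
qed

lemma continuous_component:
  fixes C :: "point \<times> elts \<Rightarrow> 'c::euclidean_space"
  assumes "z \<in> \<Omega>" "Ck_on k (\<Omega> \<times> UNIV) C"
  shows "continuous_on UNIV (\<lambda>\<theta>. C (z, \<theta>))"
proof (rule continuous_on_compose2[of "\<Omega> \<times> UNIV" C])
  show "continuous_on (\<Omega> \<times> UNIV) C" using Ck_on_mono[OF assms(2), of 0] by simp
  show "continuous_on UNIV (\<lambda>\<theta>::elts. (z, \<theta>))" by (intro continuous_on_Pair continuous_on_const continuous_on_id)
qed (use assms(1) in auto)

text \<open>Since \<open>\<xi>\<close> does not vary with u, \<open>intertwines_u\<close> applies to
  \<open>Tf\<close> and \<open>Th\<close>; since \<open>\<upsilon>\<close> does,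
  \<open>intertwines_u_nonzero\<close> applies to \<open>TH\<close> and \<open>TK\<close>.
  Continuity of the partial derivatives reaches all values of the elements.\<close>

lemma component_partials:
  assumes "z \<in> \<Omega>"
  shows "fd Tf (z, \<theta>) e_H = 0" "fd Tf (z, \<theta>) e_K = 0" "fd Th (z, \<theta>) e_H = 0" "fd Th (z, \<theta>) e_K = 0"
    "fd TH (z, \<theta>) e_f = 0" "fd TH (z, \<theta>) e_h = 0" "fd TK (z, \<theta>) e_f = 0" "fd TK (z, \<theta>) e_h = 0"
proof -
  have cont: "continuous_on UNIV (\<lambda>\<theta>. fd C (z, \<theta>) e)" if "Ck_on 1 (\<Omega> \<times> UNIV) C" for C :: "point \<times> elts \<Rightarrow> real" and e
  proof -
    have "Ck_on 0 (\<Omega> \<times> UNIV) (\<lambda>y. fd C y e)" by (rule Ck_on_fd) (use that in simp)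
    from continuous_component[OF assms this] show ?thesis .
  qed
  note it = intertwines_components[OF assms]
  note u = base_derivatives(4)[OF assms] and v = upsilon_u[OF assms]
  show "fd Tf (z, \<theta>) e_H = 0" "fd Tf (z, \<theta>) e_K = 0" "fd Th (z, \<theta>) e_H = 0" "fd Th (z, \<theta>) e_K = 0"
    by (rule continuous_eq_zero_extend[OF cont[OF Ck_components(1)]], rule intertwines_u[OF it(1) u], assumption+)
      (rule continuous_eq_zero_extend[OF cont[OF Ck_components(1)]], rule intertwines_u[OF it(1) u], assumption+,
       rule continuous_eq_zero_extend[OF cont[OF Ck_components(2)]], rule intertwines_u[OF it(2) u], assumption+,
       rule continuous_eq_zero_extend[OF cont[OF Ck_components(2)]], rule intertwines_u[OF it(2) u], assumption+)
  show "fd TH (z, \<theta>) e_f = 0" "fd TH (z, \<theta>) e_h = 0" "fd TK (z, \<theta>) e_f = 0" "fd TK (z, \<theta>) e_h = 0"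
    by (rule continuous_eq_zero_extend[OF cont[OF Ck_components(3)]], rule intertwines_u_nonzero[OF it(3) v], assumption+)
      (rule continuous_eq_zero_extend[OF cont[OF Ck_components(3)]], rule intertwines_u_nonzero[OF it(3) v], assumption+,
       rule continuous_eq_zero_extend[OF cont[OF Ck_components(4)]], rule intertwines_u_nonzero[OF it(4) v], assumption+,
       rule continuous_eq_zero_extend[OF cont[OF Ck_components(4)]], rule intertwines_u_nonzero[OF it(4) v], assumption+)
qed

lemma component_independence:
  assumes "z \<in> \<Omega>"
  shows "Tf (z, (f, h, H, K)) = Tf (z, (f, h, H', K'))" "Th (z, (f, h, H, K)) = Th (z, (f, h, H', K'))"
    "TH (z, (f, h, H, K)) = TH (z, (f', h', H, K))" "TK (z, (f, h, H, K)) = TK (z, (f', h', H, K))"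
  using component_differentiable[OF assms] component_partials[OF assms]
  by (intro independent_of_HK independent_of_fh; blast)+

text \<open>The factors \<lambda> and \<mu> of the overview, read off at f = H = 1.\<close>

definition "scale_H z = TH (z, (1, 0, 1, 0))"
definition "scale_f z = Tf (z, (1, 0, 1, 0))"

text \<open>The symbol relation equates \<open>Tf\<close> times H and \<open>TH\<close> times f up
  to the factors \<open>?a\<close>, \<open>?b\<close>. As \<open>Tf\<close> ignores H, K and
  \<open>TH\<close> ignores f, h, setting H = 1 makes \<open>Tf\<close> linear in f, and setting f =
  1 makes \<open>TH\<close> linear in H.\<close>

lemma Tf_TH_linear:
  assumes "z \<in> \<Omega>"
  shows "scale_H z * (fd \<tau> z (1, 0, 0))\<^sup>2 = scale_f z * (fd \<xi> z (0, 1, 0))\<^sup>2"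
    and "Tf (z, (f, h, H, K)) = scale_f z * f" and "TH (z, (f, h, H, K)) = scale_H z * H"
proof -
  let ?a = "(fd \<tau> z (1, 0, 0))\<^sup>2" and ?b = "(fd \<xi> z (0, 1, 0))\<^sup>2"
  note b = base_derivatives[OF assms]
  have *: "Tf (z, (f, h, H, K)) * (H * ?b) = TH (z, (f, h, H, K)) * (f * ?a)" if "f \<noteq> 0" "H \<noteq> 0" for f h H K
    using symbol_relations(2)[OF assms that, of h K] b by simp
  have "Tf (z, \<theta>) * (fst (snd (snd \<theta>)) * ?b) - TH (z, \<theta>) * (fst \<theta> * ?a) = 0" for \<theta>
    by (rule continuous_eq_zero_extend)
      (auto intro!: continuous_intros continuous_component[OF assms Ck_components(1)]
        continuous_component[OF assms Ck_components(3)] simp: *)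
  from this[of "(f, h, H, K)" for f h H K]
  have all: "Tf (z, (f, h, H, K)) * (H * ?b) = TH (z, (f, h, H, K)) * (f * ?a)" for f h H K by simp
  show l: "scale_H z * ?a = scale_f z * ?b"
    using all[of 1 0 1 0] by (simp add: scale_H_def scale_f_def)
  have "Tf (z, (f, h, H, K)) * ?b = Tf (z, (f, h, 1, 0)) * ?b"
    using component_independence(1)[OF assms] by metis
  also have "\<dots> = TH (z, (1, 0, 1, 0)) * (f * ?a)"
    using all[of f h 1 0] component_independence(3)[OF assms, of f h 1 0 1 0] by simp
  also have "\<dots> = scale_f z * f * ?b" using l by (simp add: scale_H_def mult.left_commute mult.commute)
  finally show "Tf (z, (f, h, H, K)) = scale_f z * f" using b(6) by simp
  have "TH (z, (f, h, H, K)) * ?a = TH (z, (1, 0, H, K)) * ?a"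
    using component_independence(3)[OF assms] by metis
  also have "\<dots> = Tf (z, (1, 0, 1, 0)) * (H * ?b)"
    using all[of 1 0 H K] component_independence(1)[OF assms, of 1 0 H K 1 0] by simp
  also have "\<dots> = scale_H z * H * ?a" using l by (simp add: scale_f_def mult.left_commute mult.commute)
  finally show "TH (z, (f, h, H, K)) = scale_H z * H" using b(5) by simp
qed

lemma scale_H_nonzero: "z \<in> \<Omega> \<Longrightarrow> scale_H z \<noteq> 0"
  using symbol_relations(4)[of z 1 1 0 0] by (simp add: scale_H_def)

text \<open>The component \<open>TH\<close> does depend on H, with slope \<open>scale_H\<close>, so
  the products in \<open>intertwines_u_nonzero\<close> can vanish only through the derivatives of
  \<open>\<upsilon>\<close>.\<close>

lemma upsilon_derivatives:
  assumes "z \<in> \<Omega>"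
  shows "fd \<upsilon> z (1, 0, 0) = 0" "fd \<upsilon> z (0, 1, 0) = 0"
proof -
  have c: "((\<lambda>s. (1, 0, s, 0) :: elts) has_vector_derivative (0, 0, 1, 0)) (at 1)"
    by (intro has_vector_derivative_Pair has_vector_derivative_id has_vector_derivative_const)
  have "((\<lambda>s. TH (z, (1, 0, s, 0))) has_real_derivative fd TH (z, (1, 0, 1, 0)) e_H) (at 1)"
    using has_real_derivative_theta[OF component_differentiable(3)[OF assms] c] by (simp add: zero_prod_def)
  moreover have "((\<lambda>s. TH (z, (1, 0, s, 0))) has_real_derivative scale_H z) (at 1)"
    unfolding Tf_TH_linear(3)[OF assms] by (auto intro!: derivative_eq_intros)
  ultimately have "fd TH (z, (1, 0, 1, 0)) e_H = scale_H z" by (rule DERIV_unique)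
  then show "fd \<upsilon> z (1, 0, 0) = 0" "fd \<upsilon> z (0, 1, 0) = 0"
    using intertwines_u_nonzero(3,4)[OF intertwines_components(3)[OF assms] upsilon_u[OF assms], of 1 1 0 0] scale_H_nonzero[OF assms]
    by simp_all
qed

end

section \<open>Separation of variables and the lower-order terms\<close>

lemma constant_on_open_connected:
  fixes F :: "'a::euclidean_space \<Rightarrow> real"
  assumes "open S" "connected S" "\<And>z. z \<in> S \<Longrightarrow> F differentiable (at z)" "\<And>z v. z \<in> S \<Longrightarrow> fd F z v = 0"
  shows "\<exists>c. \<forall>z\<in>S. F z = c"
proof -
  have "(F has_derivative (\<lambda>v. 0)) (at z)" if "z \<in> S" for z
  proof -
    have "fd F z = (\<lambda>v. 0)" using assms(4)[OF that] by auto
    with fd_has_derivative[OF assms(3)[OF that]] show ?thesis by simp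
  qed
  then have "F z = F z'" if "z \<in> S" "z' \<in> S" for z z'
    using has_derivative_zero_unique_connected[OF assms(1,2) _ that] by blast
  then show ?thesis by metis
qed

lemma fd_point_zero:
  fixes F :: "point \<Rightarrow> real"
  assumes "F differentiable (at z)" "fd F z (1, 0, 0) = 0" "fd F z (0, 1, 0) = 0" "fd F z (0, 0, 1) = 0"
  shows "fd F z v = 0"
proof -
  obtain a b c where v: "v = (a, b, c)" by (cases v)
  show ?thesis
    unfolding v linear_point_expansion[OF linear_fd[OF assms(1)], of a b c] assms(2-4) by simp
qed

context equivalence_transformation
begin

lemma scale_differentiable:
  assumes "z \<in> \<Omega>"
  shows "scale_H differentiable (at z)" "scale_f differentiable (at z)"
proof -
  have "Ck_on 1 \<Omega> scale_H" "Ck_on 1 \<Omega> scale_f"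
    unfolding scale_H_def scale_f_def by (intro Ck_section Ck_components)+
  then show "scale_H differentiable (at z)" "scale_f differentiable (at z)"
    using Ck_on_differentiable[of 1] assms by auto
qed

lemma section_derivatives:
  assumes "z \<in> \<Omega>" "f \<noteq> 0" "H \<noteq> 0"
  shows "fd (\<lambda>z. Tf (z, (f, h, H, K))) z (1, 0, 0) = 0" "fd (\<lambda>z. Tf (z, (f, h, H, K))) z (0, 0, 1) = 0"
    "fd (\<lambda>z. Th (z, (f, h, H, K))) z (1, 0, 0) = 0" "fd (\<lambda>z. Th (z, (f, h, H, K))) z (0, 0, 1) = 0"
    "fd (\<lambda>z. TH (z, (f, h, H, K))) z (1, 0, 0) = 0" "fd (\<lambda>z. TH (z, (f, h, H, K))) z (0, 1, 0) = 0"
    "fd (\<lambda>z. TK (z, (f, h, H, K))) z (1, 0, 0) = 0" "fd (\<lambda>z. TK (z, (f, h, H, K))) z (0, 1, 0) = 0"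
proof -
  note it = intertwines_components[OF assms, of h K]
  note b = base_derivatives[OF assms(1)] and u = upsilon_derivatives[OF assms(1)]
  note s = component_differentiable[OF assms(1), of "(f, h, H, K)", THEN fd_section]
  show "fd (\<lambda>z. Tf (z, (f, h, H, K))) z (1, 0, 0) = 0" "fd (\<lambda>z. Tf (z, (f, h, H, K))) z (0, 0, 1) = 0"
    "fd (\<lambda>z. Th (z, (f, h, H, K))) z (1, 0, 0) = 0" "fd (\<lambda>z. Th (z, (f, h, H, K))) z (0, 0, 1) = 0"
    "fd (\<lambda>z. TH (z, (f, h, H, K))) z (1, 0, 0) = 0" "fd (\<lambda>z. TH (z, (f, h, H, K))) z (0, 1, 0) = 0"
    "fd (\<lambda>z. TK (z, (f, h, H, K))) z (1, 0, 0) = 0" "fd (\<lambda>z. TK (z, (f, h, H, K))) z (0, 1, 0) = 0"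
    unfolding s zero_prod_def
    using intertwines_t[OF it(1) b(3)] intertwines_u(1)[OF it(1) b(4)]
      intertwines_t[OF it(2) b(3)] intertwines_u(1)[OF it(2) b(4)]
      intertwines_t[OF it(3) u(1)] intertwines_x(1)[OF it(3) u(2)]
      intertwines_t[OF it(4) u(1)] intertwines_x(1)[OF it(4) u(2)] by simp_all
qed

lemma second_derivatives:
  assumes "z \<in> \<Omega>"
  shows "fd (\<lambda>y. fd \<tau> y v) z (0, 1, 0) = 0" "fd (\<lambda>y. fd \<tau> y v) z (0, 0, 1) = 0"
    "fd (\<lambda>y. fd \<xi> y v) z (1, 0, 0) = 0" "fd (\<lambda>y. fd \<xi> y v) z (0, 0, 1) = 0"
    "fd (\<lambda>y. fd \<upsilon> y v) z (1, 0, 0) = 0" "fd (\<lambda>y. fd \<upsilon> y v) z (0, 1, 0) = 0"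
  by (intro fd_direction_invariant[OF open_dom] Ck_base base_derivatives upsilon_derivatives assms; assumption)+

lemma fd_base_differentiable:
  assumes "z \<in> \<Omega>"
  shows "(\<lambda>y. fd \<tau> y v) differentiable (at z)" "(\<lambda>y. fd \<xi> y v) differentiable (at z)"
    "(\<lambda>y. fd \<upsilon> y v) differentiable (at z)"
  using Ck_on_2_fd_differentiable[OF Ck_base(1) assms] Ck_on_2_fd_differentiable[OF Ck_base(2) assms]
    Ck_on_2_fd_differentiable[OF Ck_base(3) assms] by blast+

text \<open>Separation of variables done on differentials, which works on any open domain and not
  only on boxes: in direction t only \<open>\<tau>\<close> can contribute to the differentiated
  identity, in direction u only \<open>scale_H\<close>, and nothing on the other side balances
  either.\<close>

lemma fd_tau_t_scale_H_zero:
  assumes "z \<in> \<Omega>"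
  shows "fd (\<lambda>y. fd \<tau> y (1, 0, 0)) z v = 0" "fd scale_H z v = 0"
proof -
  define a where "a = (\<lambda>y. fd \<tau> y (1, 0, 0))"
  define b where "b = (\<lambda>y. fd \<xi> y (0, 1, 0))"
  have da: "a differentiable (at z)" "b differentiable (at z)"
    unfolding a_def b_def by (rule fd_base_differentiable[OF assms])+
  note a0 = second_derivatives(1,2)[OF assms, of "(1, 0, 0)", folded a_def]
  note b0 = second_derivatives(3,4)[OF assms, of "(0, 1, 0)", folded b_def]
  note sd = section_derivatives[OF assms one_neq_zero one_neq_zero, of 0 0]
  have sH: "fd scale_H z (1, 0, 0) = 0" "fd scale_H z (0, 1, 0) = 0"
    and sf: "fd scale_f z (1, 0, 0) = 0" "fd scale_f z (0, 0, 1) = 0"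
    using sd unfolding scale_H_def scale_f_def by simp_all
  have l: "((\<lambda>y. scale_H y * (a y * a y)) has_derivative
      (\<lambda>v. scale_H z * (a z * fd a z v + fd a z v * a z) + fd scale_H z v * (a z * a z))) (at z)"
    by (intro has_derivative_mult fd_has_derivative da scale_differentiable assms)
  have r: "((\<lambda>y. scale_f y * (b y * b y)) has_derivative
      (\<lambda>v. scale_f z * (b z * fd b z v + fd b z v * b z) + fd scale_f z v * (b z * b z))) (at z)"
    by (intro has_derivative_mult fd_has_derivative da scale_differentiable assms)
  have "((\<lambda>y. scale_H y * (a y * a y)) has_derivative
      (\<lambda>v. scale_f z * (b z * fd b z v + fd b z v * b z) + fd scale_f z v * (b z * b z))) (at z)"
    by (rule has_derivative_transform_within_open[OF r open_dom assms])
      (use Tf_TH_linear(1) in \<open>simp add: a_def b_def power2_eq_square\<close>)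
  from has_derivative_unique[OF l this]
  have eq: "scale_H z * (a z * fd a z v + fd a z v * a z) + fd scale_H z v * (a z * a z)
      = scale_f z * (b z * fd b z v + fd b z v * b z) + fd scale_f z v * (b z * b z)" for v
    by (rule fun_cong)
  have nz: "a z \<noteq> 0" "scale_H z \<noteq> 0"
    using base_derivatives(5)[OF assms] scale_H_nonzero[OF assms] by (simp_all add: a_def)
  have "fd a z (1, 0, 0) = 0" using eq[of "(1, 0, 0)"] sH sf b0 nz by simp
  then show "fd (\<lambda>y. fd \<tau> y (1, 0, 0)) z v = 0"
    using fd_point_zero[OF da(1)] a0 by (simp add: a_def)
  have "fd scale_H z (0, 0, 1) = 0" using eq[of "(0, 0, 1)"] sH sf b0 a0 nz by simp
  then show "fd scale_H z v = 0"
    using fd_point_zero[OF scale_differentiable(1)[OF assms]] sH by simp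
qed

lemma fd_fd_along:
  assumes "z \<in> \<Omega>"
  shows "fd (\<lambda>y. fd \<tau> y (a, b, c)) z (a, b, c) = 0"
    "fd (\<lambda>y. fd \<xi> y (a, b, c)) z (a, b, c) = b\<^sup>2 * fd (\<lambda>y. fd \<xi> y (0, 1, 0)) z (0, 1, 0)"
    "fd (\<lambda>y. fd \<upsilon> y (a, b, c)) z (a, b, c) = c\<^sup>2 * fd (\<lambda>y. fd \<upsilon> y (0, 0, 1)) z (0, 0, 1)"
proof -
  have sc: "fd (\<lambda>y. fd F y (a, b, c)) z v = k * fd (\<lambda>y. fd F y e) z v"
    if "\<And>y. y \<in> \<Omega> \<Longrightarrow> fd F y (a, b, c) = k * fd F y e" "(\<lambda>y. fd F y e) differentiable (at z)"
    for F :: "point \<Rightarrow> real" and k e v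
  proof -
    have "fd (\<lambda>y. fd F y (a, b, c)) z = fd (\<lambda>y. k * fd F y e) z"
      by (rule fd_transform_open[OF open_dom assms that(1)])
    also have "\<dots> = (\<lambda>v. k * fd (\<lambda>y. fd F y e) z v)"
      by (intro fd_eqI has_derivative_mult_right fd_has_derivative that(2))
    finally show ?thesis by simp
  qed
  have t: "fd \<tau> y (a, b, c) = a * fd \<tau> y (1, 0, 0)" "fd \<xi> y (a, b, c) = b * fd \<xi> y (0, 1, 0)"
    "fd \<upsilon> y (a, b, c) = c * fd \<upsilon> y (0, 0, 1)" if "y \<in> \<Omega>" for y
    unfolding linear_point_expansion[OF linear_fd[OF base_differentiable(1)[OF that]], of a b c]
      linear_point_expansion[OF linear_fd[OF base_differentiable(2)[OF that]], of a b c]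
      linear_point_expansion[OF linear_fd[OF base_differentiable(3)[OF that]], of a b c]
    using base_derivatives[OF that] upsilon_derivatives[OF that] by simp_all
  note d = fd_base_differentiable[OF assms]
  show "fd (\<lambda>y. fd \<tau> y (a, b, c)) z (a, b, c) = 0"
    using sc[OF t(1) d(1)] fd_tau_t_scale_H_zero(1)[OF assms] by simp
  show "fd (\<lambda>y. fd \<xi> y (a, b, c)) z (a, b, c) = b\<^sup>2 * fd (\<lambda>y. fd \<xi> y (0, 1, 0)) z (0, 1, 0)"
    using sc[OF t(2) d(2), of "(a, b, c)"] second_derivatives(3,4)[OF assms, of "(0, 1, 0)"]
      linear_point_expansion[OF linear_fd[OF d(2)[of "(0, 1, 0)"]], of a b c]
    by (simp add: power2_eq_square)
  show "fd (\<lambda>y. fd \<upsilon> y (a, b, c)) z (a, b, c) = c\<^sup>2 * fd (\<lambda>y. fd \<upsilon> y (0, 0, 1)) z (0, 0, 1)"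
    using sc[OF t(3) d(3), of "(a, b, c)"] second_derivatives(5,6)[OF assms, of "(0, 0, 1)"]
      linear_point_expansion[OF linear_fd[OF d(3)[of "(0, 0, 1)"]], of a b c]
    by (simp add: power2_eq_square)
qed

text \<open>The transformed equation is evaluated on a jet that satisfies the original one. The
  first derivatives \<open>p\<close>, \<open>q\<close> stay free, so the coefficients of
  \<open>p\<^sup>2\<close> and of \<open>q\<close> can be read off afterwards.\<close>

lemma lower_order_terms:
  assumes "z \<in> \<Omega>" "f \<noteq> 0" "H \<noteq> 0"
  defines "b \<equiv> fd \<xi> z (0, 1, 0)" and "c \<equiv> fd \<upsilon> z (0, 0, 1)"
    and "bx \<equiv> fd (\<lambda>y. fd \<xi> y (0, 1, 0)) z (0, 1, 0)" and "cu \<equiv> fd (\<lambda>y. fd \<upsilon> y (0, 0, 1)) z (0, 0, 1)"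
  shows "scale_H z * (f * p\<^sup>2 * cu * b + h * K * q * c * b) = scale_H z * H * (q\<^sup>2 * cu * b - q * c * bx)
    + Th (z, (f, h, H, K)) * TK (z, (f, h, H, K)) * (q * c * b\<^sup>2)"
proof -
  obtain t x u where z: "z = (t, x, u)" by (cases z)
  define a where "a = fd \<tau> z (1, 0, 0)"
  have ex: "fd \<tau> z (\<alpha>, \<beta>, \<gamma>) = \<alpha> * a" "fd \<xi> z (\<alpha>, \<beta>, \<gamma>) = \<beta> * b" "fd \<upsilon> z (\<alpha>, \<beta>, \<gamma>) = \<gamma> * c" for \<alpha> \<beta> \<gamma>
    unfolding linear_point_expansion[OF linear_fd[OF base_differentiable(1)[OF assms(1)]], of \<alpha> \<beta> \<gamma>]
      linear_point_expansion[OF linear_fd[OF base_differentiable(2)[OF assms(1)]], of \<alpha> \<beta> \<gamma>]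
      linear_point_expansion[OF linear_fd[OF base_differentiable(3)[OF assms(1)]], of \<alpha> \<beta> \<gamma>]
    using base_derivatives[OF assms(1)] upsilon_derivatives[OF assms(1)] by (simp_all add: a_def b_def c_def)
  have nz: "a \<noteq> 0" "b \<noteq> 0" "c \<noteq> 0"
    using base_derivatives[OF assms(1)] upsilon_u[OF assms(1)] by (simp_all add: a_def b_def c_def)
  then have det: "fd \<tau> z (1, 0, p) * fd \<xi> z (0, 1, q) - fd \<tau> z (0, 1, q) * fd \<xi> z (1, 0, p) \<noteq> 0"
    by (simp add: ex)
  show ?thesis
  proof (rule element_data[of t x u f H h K 0 0 0 0, folded z, OF assms(1-3)], goal_cases)
    case el: (1 fe he He Ke f' h' H' K' gf gh gH gK)
    \<comment> \<open>The slope of \<open>H\<close> was prescribed as 0 and \<open>scale_H\<close>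
      is constant, so the slope \<open>gH\<close> of the new element is 0 as well and its quadratic
      term disappears.\<close>
    have "fd TH (z, (f, h, H, K)) e_u + 0 * fd TH (z, (f, h, H, K)) e_H + 0 * fd TH (z, (f, h, H, K)) e_K
        = gH * fd \<upsilon> z (0, 0, 1)"
      using el(14) by simp
    moreover have "fd TH (z, (f, h, H, K)) e_u = 0"
    proof -
      have "fd TH (z, (f, h, H, K)) e_u = fd (\<lambda>z. TH (z, (f, h, H, K))) z (0, 0, 1)"
        using fd_section[OF component_differentiable(3)[OF assms(1)]] by (simp add: zero_prod_def)
      also have "fd (\<lambda>z. TH (z, (f, h, H, K))) z = fd (\<lambda>z. scale_H z * H) z"
        by (rule fd_transform_open[OF open_dom assms(1) Tf_TH_linear(3)])
      also have "\<dots> = (\<lambda>v. fd scale_H z v * H)"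
        by (intro fd_eqI has_derivative_mult_left fd_has_derivative scale_differentiable assms(1))
      finally show ?thesis using fd_tau_t_scale_H_zero(2)[OF assms(1)] by simp
    qed
    ultimately have gH: "gH = 0" using nz by (simp add: c_def)
    \<comment> \<open>This value of u_tt puts the jet with vanishing u_tx and u_xx on the original
      equation.\<close>
    define r where "r = h * K * q / f"
    obtain v1 v2 S11 S12 S22 where j:
      "v1 * fd \<tau> z (1, 0, p) + v2 * fd \<xi> z (1, 0, p) = fd \<upsilon> z (1, 0, p)"
      "v1 * fd \<tau> z (0, 1, q) + v2 * fd \<xi> z (0, 1, q) = fd \<upsilon> z (0, 1, q)"
      "\<And>a b \<omega> \<sigma>. \<omega> = (a, b, p * a + q * b) \<Longrightarrow> \<sigma> = r * a\<^sup>2 + 2 * 0 * a * b + 0 * b\<^sup>2 \<Longrightarrow>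
        S11 * (fd \<tau> z \<omega>)\<^sup>2 + S12 * (fd \<tau> z \<omega> * fd \<xi> z \<omega>) + S22 * (fd \<xi> z \<omega>)\<^sup>2
        + v1 * (fd (\<lambda>y. fd \<tau> y \<omega>) z \<omega> + \<sigma> * fd \<tau> z (0, 0, 1))
        + v2 * (fd (\<lambda>y. fd \<xi> y \<omega>) z \<omega> + \<sigma> * fd \<xi> z (0, 0, 1))
        = fd (\<lambda>y. fd \<upsilon> y \<omega>) z \<omega> + \<sigma> * fd \<upsilon> z (0, 0, 1)"
      "fe x * r = 0 * q\<^sup>2 + He u * 0 + he x * Ke u * q \<longleftrightarrow>
        f' (\<xi> z) * S11 = gH * v2\<^sup>2 + H' (\<upsilon> z) * S22 + h' (\<xi> z) * K' (\<upsilon> z) * v2"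
      by (rule transforms_eq_jets[OF open_dom Ck_base P_eq assms(1) z el(7,5,6) det, of r 0 0]) blast
    have v2: "v2 * b = q * c" using j(2) by (simp add: ex)
    have S11: "S11 * a\<^sup>2 = p\<^sup>2 * cu + r * c"
      using j(3)[of "(1, 0, p)" 1 0 r] fd_fd_along[OF assms(1), of 1 0 p] by (simp add: ex cu_def)
    have S22: "S22 * b\<^sup>2 + v2 * bx = q\<^sup>2 * cu"
      using j(3)[of "(0, 1, q)" 0 1 0] fd_fd_along[OF assms(1), of 0 1 q] by (simp add: ex cu_def bx_def)
    have fr: "f * r = h * K * q" using assms(2) by (simp add: r_def)
    then have "f' (\<xi> z) * S11 = gH * v2\<^sup>2 + H' (\<upsilon> z) * S22 + h' (\<xi> z) * K' (\<upsilon> z) * v2"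
      using j(4) by (simp add: el(1-4))
    then have main: "scale_f z * f * S11 = scale_H z * H * S22 + Th (z, (f, h, H, K)) * TK (z, (f, h, H, K)) * v2"
      unfolding el(8-11) Tf_TH_linear(2,3)[OF assms(1)] gH by simp
    have l: "scale_H z * a\<^sup>2 = scale_f z * b\<^sup>2"
      using Tf_TH_linear(1)[OF assms(1)] by (simp add: a_def b_def)
    \<comment> \<open>Multiplied by the cube of \<open>b\<close>, the transformed equation contains
      the unknowns only as \<open>S22 * b\<^sup>2\<close> and \<open>v2 * b\<close>, both of which
      are known.\<close>
    have "scale_H z * (f * p\<^sup>2 * cu * b + h * K * q * c * b) = scale_H z * f * (p\<^sup>2 * cu + r * c) * b"
      unfolding fr[symmetric] by (simp add: algebra_simps)
    also have "\<dots> = (scale_H z * a\<^sup>2) * (f * S11 * b)"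
      unfolding S11[symmetric] by (simp add: algebra_simps)
    also have "\<dots> = (scale_f z * f * S11) * (b\<^sup>2 * b)"
      unfolding l by (simp add: algebra_simps)
    also have "\<dots> = scale_H z * H * ((S22 * b\<^sup>2) * b) + Th (z, (f, h, H, K)) * TK (z, (f, h, H, K)) * ((v2 * b) * b\<^sup>2)"
      unfolding main by (simp add: algebra_simps)
    also have "S22 * b\<^sup>2 = q\<^sup>2 * cu - v2 * bx" using S22 by simp
    also have "(q\<^sup>2 * cu - v2 * bx) * b = q\<^sup>2 * cu * b - (v2 * b) * bx" by (simp add: algebra_simps)
    finally show ?case unfolding v2 by (simp add: algebra_simps)
  qed
qed

text \<open>The jet p = 1, q = 0 isolates the term in u_t^2, which the right-hand side cannot
  balance.\<close>

lemma fd_upsilon_u_zero: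
  assumes "z \<in> \<Omega>"
  shows "fd (\<lambda>y. fd \<upsilon> y (0, 0, 1)) z v = 0"
proof -
  have "fd (\<lambda>y. fd \<upsilon> y (0, 0, 1)) z (0, 0, 1) = 0"
    using lower_order_terms[OF assms one_neq_zero one_neq_zero, of 1 0 0 0]
      scale_H_nonzero[OF assms] base_derivatives(6)[OF assms] by simp
  then show ?thesis
    using fd_point_zero[OF fd_base_differentiable(3)[OF assms, of "(0, 0, 1)"]] second_derivatives(5,6)[OF assms] by simp
qed

text \<open>The jet p = 0, q = 1 isolates the term in u_x; a polynomial identity in the values of
  the elements then extends to f H = 0 by continuity.\<close>

lemma Th_TK:
  assumes "z \<in> \<Omega>"
  defines "b \<equiv> fd \<xi> z (0, 1, 0)" and "bx \<equiv> fd (\<lambda>y. fd \<xi> y (0, 1, 0)) z (0, 1, 0)"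
  shows "Th (z, (f, h, H, K)) * TK (z, (f, h, H, K)) * b\<^sup>2 = scale_H z * (h * K * b + H * bx)"
proof -
  have *: "Th (z, (f, h, H, K)) * TK (z, (f, h, H, K)) * b\<^sup>2 = scale_H z * (h * K * b + H * bx)"
    if "f \<noteq> 0" "H \<noteq> 0" for f h H K
  proof -
    have "fd \<upsilon> z (0, 0, 1) * (Th (z, (f, h, H, K)) * TK (z, (f, h, H, K)) * b\<^sup>2)
        = fd \<upsilon> z (0, 0, 1) * (scale_H z * (h * K * b + H * bx))"
      using lower_order_terms[OF assms(1) that, of 0 h K 1]
      by (simp add: fd_upsilon_u_zero[OF assms(1)] b_def bx_def algebra_simps)
    then show ?thesis using upsilon_u[OF assms(1)] by simp
  qed
  have "Th (z, \<theta>) * TK (z, \<theta>) * b\<^sup>2 - scale_H z * (fst (snd \<theta>) * snd (snd (snd \<theta>)) * b + fst (snd (snd \<theta>)) * bx) = 0" for \<theta>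
    by (rule continuous_eq_zero_extend)
      (auto intro!: continuous_intros continuous_component[OF assms(1) Ck_components(2)]
        continuous_component[OF assms(1) Ck_components(4)] simp: *)
  from this[of "(f, h, H, K)"] show ?thesis by simp
qed

text \<open>The right-hand side of \<open>Th_TK\<close> must be a function of (f, h) times one of
  (H, K). At K = 1, H = 0 it vanishes for h = 0 but not for h = 1, so \<open>Th\<close> vanishes at
  h = 0; then the value at h = 0, H = 1, K = 0 forces the second derivative of \<open>\<xi>\<close>
  to be 0. The values with H = 0 are available because \<open>Th_TK\<close> covers them.\<close>

lemma fd_xi_x_zero:
  assumes "z \<in> \<Omega>"
  shows "fd (\<lambda>y. fd \<xi> y (0, 1, 0)) z v = 0"
proof -
  let ?b = "fd \<xi> z (0, 1, 0)" and ?bx = "fd (\<lambda>y. fd \<xi> y (0, 1, 0)) z (0, 1, 0)"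
  note nz = scale_H_nonzero[OF assms] base_derivatives(6)[OF assms]
  note Th = component_independence(2)[OF assms] and TK = component_independence(4)[OF assms]
  have 1: "Th (z, (1, 0, 1, 0)) * TK (z, (1, 0, 1, 0)) * ?b\<^sup>2 = scale_H z * ?bx"
    using Th_TK[OF assms, of 1 0 1 0] by simp
  have 2: "Th (z, (1, 0, 1, 0)) * TK (z, (1, 0, 0, 1)) = 0"
    using Th_TK[OF assms, of 1 0 0 1] nz Th[of 1 0 1 0 0 1] by simp
  have 3: "Th (z, (1, 1, 0, 1)) * TK (z, (1, 0, 0, 1)) \<noteq> 0"
    using Th_TK[OF assms, of 1 1 0 1] nz TK[of 1 1 0 1 1 0] by auto
  then have "Th (z, (1, 0, 1, 0)) = 0" using 2 by auto
  then have "?bx = 0" using 1 nz by simp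
  then show ?thesis
    using fd_point_zero[OF fd_base_differentiable(2)[OF assms, of "(0, 1, 0)"]] second_derivatives(3,4)[OF assms] by simp
qed

end

section \<open>Constants and the canonical form\<close>

context equivalence_transformation
begin

lemma affine_on_dom:
  fixes F L :: "point \<Rightarrow> real"
  assumes "bounded_linear L" "\<And>z. z \<in> \<Omega> \<Longrightarrow> F differentiable (at z)"
    and "\<And>z v. z \<in> \<Omega> \<Longrightarrow> fd F z v = k * L v"
  shows "\<exists>d. \<forall>z\<in>\<Omega>. F z = k * L z + d"
proof -
  have "((\<lambda>z. F z - k * L z) has_derivative (\<lambda>v. 0)) (at z)" if "z \<in> \<Omega>" for z
  proof -
    have "((\<lambda>z. F z - k * L z) has_derivative (\<lambda>v. fd F z v - k * L v)) (at z)"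
      by (intro has_derivative_diff fd_has_derivative assms(2) that has_derivative_mult_right
          bounded_linear_imp_has_derivative assms(1))
    then show ?thesis by (simp add: assms(3)[OF that])
  qed
  then have "F z - k * L z = F z' - k * L z'" if "z \<in> \<Omega>" "z' \<in> \<Omega>" for z z'
    using has_derivative_zero_unique_connected[OF open_dom connected_dom _ that, of "\<lambda>z. F z - k * L z"] by blast
  moreover obtain z0 where "z0 \<in> \<Omega>" using nonempty_dom by blast
  ultimately have "F z = k * L z + (F z0 - k * L z0)" if "z \<in> \<Omega>" for z
    using that by (metis add.commute diff_add_cancel)
  then show ?thesis by blast
qed

lemma Th_TK_product:
  assumes "z \<in> \<Omega>"
  shows "Th (z, (f, h, H, K)) * TK (z, (f, h, H, K)) = scale_H z * inverse (fd \<xi> z (0, 1, 0)) * (h * K)"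
proof -
  let ?b = "fd \<xi> z (0, 1, 0)"
  have b: "?b \<noteq> 0" by (rule base_derivatives(6)[OF assms])
  have "Th (z, (f, h, H, K)) * TK (z, (f, h, H, K)) * ?b\<^sup>2 = scale_H z * (h * K * ?b)"
    using Th_TK[OF assms, of f h H K] by (simp only: fd_xi_x_zero[OF assms] mult_zero_right add_0_right)
  also have "\<dots> = (scale_H z * inverse ?b * (h * K)) * ?b\<^sup>2"
    using b by (simp add: power2_eq_square)
  finally have "Th (z, (f, h, H, K)) * TK (z, (f, h, H, K)) * ?b\<^sup>2 = (scale_H z * inverse ?b * (h * K)) * ?b\<^sup>2" .
  moreover have "?b\<^sup>2 \<noteq> 0" using b by simp
  ultimately show ?thesis by (rule mult_right_cancel[THEN iffD1, rotated])
qed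

text \<open>The product of a function of (f, h) and one of (H, K) equals \<open>c * (h * K)\<close>
  with \<open>c\<close> nonzero. Setting h = 1 or K = 1 determines each factor up to a scalar, and
  the two scalars multiply to \<open>c\<close>.\<close>

lemma Th_TK_linear:
  assumes "z \<in> \<Omega>"
  defines "\<alpha> \<equiv> Th (z, (1, 1, 1, 0))" and "c \<equiv> scale_H z * inverse (fd \<xi> z (0, 1, 0))"
  shows "\<alpha> \<noteq> 0" "Th (z, (f, h, H, K)) = \<alpha> * h" "TK (z, (f, h, H, K)) = c * inverse \<alpha> * K"
    "\<alpha> * TK (z, (1, 0, 1, 1)) = c"
proof -
  have c: "c \<noteq> 0" using scale_H_nonzero[OF assms(1)] base_derivatives(6)[OF assms(1)] by (simp add: c_def)
  define \<beta> where "\<beta> = TK (z, (1, 0, 1, 1))"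
  note p = Th_TK_product[OF assms(1), folded c_def]
  note Th = component_independence(2)[OF assms(1)] and TK = component_independence(4)[OF assms(1)]
  have Th': "Th (z, (f, h, H, K)) * \<beta> = c * h" for f h H K
    using p[of f h 1 1] Th[of f h H K 1 1] TK[of f h 1 1 1 0] by (simp add: \<beta>_def)
  have TK': "\<alpha> * TK (z, (f, h, H, K)) = c * K" for f h H K
    using p[of 1 1 H K] Th[of 1 1 H K 1 0] TK[of f h H K 1 1] by (simp add: \<alpha>_def)
  show ab: "\<alpha> * TK (z, (1, 0, 1, 1)) = c" using TK'[of 1 0 1 1] by simp
  then show a: "\<alpha> \<noteq> 0" using c by auto
  have b: "\<beta> \<noteq> 0" using ab c by (auto simp: \<beta>_def)
  have "Th (z, (f, h, H, K)) * \<beta> = \<alpha> * h * \<beta>" using Th' ab by (simp add: \<beta>_def)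
  then show "Th (z, (f, h, H, K)) = \<alpha> * h" using b by simp
  have "\<alpha> * TK (z, (f, h, H, K)) = \<alpha> * (c * inverse \<alpha> * K)" using TK'[of f h H K] a by simp
  then show "TK (z, (f, h, H, K)) = c * inverse \<alpha> * K" using a by (rule mult_left_cancel[THEN iffD1, rotated])
qed

text \<open>The first factor \<open>\<alpha>\<close> varies only with x and the second,
  \<open>\<beta>\<close>, not with x; as their product is the nonzero constant \<open>c\<close>, the
  factor \<open>\<alpha>\<close> cannot vary at all.\<close>

lemma fd_Th_scale_zero:
  assumes "z \<in> \<Omega>"
    and const: "\<And>z. z \<in> \<Omega> \<Longrightarrow> scale_H z * inverse (fd \<xi> z (0, 1, 0)) = c"
  shows "fd (\<lambda>z. Th (z, (1, 1, 1, 0))) z v = 0"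
proof -
  define \<alpha> where "\<alpha> = (\<lambda>z. Th (z, (1, 1, 1, 0)))"
  define \<beta> where "\<beta> = (\<lambda>z. TK (z, (1, 0, 1, 1)))"
  have "Ck_on 1 \<Omega> \<alpha>" "Ck_on 1 \<Omega> \<beta>" unfolding \<alpha>_def \<beta>_def by (intro Ck_section Ck_components)+
  then have d: "\<alpha> differentiable (at z)" "\<beta> differentiable (at z)"
    using Ck_on_differentiable[of 1] assms(1) by auto
  have prod: "\<alpha> y * \<beta> y = c" if "y \<in> \<Omega>" for y
    using Th_TK_linear(4)[OF that] const[OF that] by (simp add: \<alpha>_def \<beta>_def)
  have "((\<lambda>y. \<alpha> y * \<beta> y) has_derivative (\<lambda>v. \<alpha> z * fd \<beta> z v + fd \<alpha> z v * \<beta> z)) (at z)"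
    by (intro has_derivative_mult fd_has_derivative d)
  moreover have "((\<lambda>y. \<alpha> y * \<beta> y) has_derivative (\<lambda>v. 0)) (at z)"
    by (rule has_derivative_transform_within_open[OF has_derivative_const open_dom assms(1), of c]) (simp add: prod)
  ultimately have "(\<lambda>v. \<alpha> z * fd \<beta> z v + fd \<alpha> z v * \<beta> z) = (\<lambda>v. 0)" by (rule has_derivative_unique)
  from fun_cong[OF this, of "(0, 1, 0)"] have "\<alpha> z * fd \<beta> z (0, 1, 0) + fd \<alpha> z (0, 1, 0) * \<beta> z = 0" .
  moreover have "fd \<beta> z (0, 1, 0) = 0"
    unfolding \<beta>_def by (rule section_derivatives(8)[OF assms(1) one_neq_zero one_neq_zero])
  moreover have "\<beta> z \<noteq> 0"
  proof
    assume "\<beta> z = 0"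
    then have "scale_H z * inverse (fd \<xi> z (0, 1, 0)) = 0"
      using Th_TK_linear(4)[OF assms(1)] by (simp add: \<beta>_def)
    then show False using scale_H_nonzero[OF assms(1)] base_derivatives(6)[OF assms(1)] by simp
  qed
  ultimately have x: "fd \<alpha> z (0, 1, 0) = 0" by simp
  have tu: "fd \<alpha> z (1, 0, 0) = 0" "fd \<alpha> z (0, 0, 1) = 0"
    unfolding \<alpha>_def by (rule section_derivatives(3,4)[OF assms(1) one_neq_zero one_neq_zero])+
  have "fd \<alpha> z v = 0" by (rule fd_point_zero[OF d(1) tu(1) x tu(2)])
  then show ?thesis by (simp add: \<alpha>_def)
qed

lemma canonical_form:
  "\<exists>\<epsilon>1 \<epsilon>2 \<epsilon>3 \<epsilon>4 \<epsilon>5 \<epsilon>6 \<epsilon>7 \<epsilon>8 :: real.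
        \<epsilon>4 * \<epsilon>5 * \<epsilon>6 * \<epsilon>7 * \<epsilon>8 \<noteq> 0 \<and>
        (\<forall>(t, x, u)\<in>\<Omega>. \<forall>f h H K.
           T ((t, x, u), (f, h, H, K)) =
             ((\<epsilon>4 * t + \<epsilon>1, \<epsilon>5 * x + \<epsilon>2, \<epsilon>6 * u + \<epsilon>3),
              (\<epsilon>4 ^ 2 * inverse (\<epsilon>5 ^ 2) * \<epsilon>7 * f,
               inverse \<epsilon>8 * h,
               \<epsilon>7 * H,
               inverse \<epsilon>5 * \<epsilon>7 * \<epsilon>8 * K)))"
proof -
  obtain z0 where z0: "z0 \<in> \<Omega>" using nonempty_dom by blast
  note const = constant_on_open_connected[OF open_dom connected_dom]
  obtain \<epsilon>4 where "\<forall>z\<in>\<Omega>. fd \<tau> z (1, 0, 0) = \<epsilon>4"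
    using const[OF fd_base_differentiable(1) fd_tau_t_scale_H_zero(1)] by (rule exE)
  note e4 = this[rule_format]
  obtain \<epsilon>5 where "\<forall>z\<in>\<Omega>. fd \<xi> z (0, 1, 0) = \<epsilon>5"
    using const[OF fd_base_differentiable(2) fd_xi_x_zero] by (rule exE)
  note e5 = this[rule_format]
  obtain \<epsilon>6 where "\<forall>z\<in>\<Omega>. fd \<upsilon> z (0, 0, 1) = \<epsilon>6"
    using const[OF fd_base_differentiable(3) fd_upsilon_u_zero] by (rule exE)
  note e6 = this[rule_format]
  obtain \<epsilon>7 where "\<forall>z\<in>\<Omega>. scale_H z = \<epsilon>7"
    using const[OF scale_differentiable(1) fd_tau_t_scale_H_zero(2)] by (rule exE)
  note e7 = this[rule_format]
  have "(\<lambda>z. Th (z, (1, 1, 1, 0))) differentiable (at z)" if "z \<in> \<Omega>" for z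
    using Ck_on_differentiable[OF Ck_section[OF Ck_components(2)[of 1]] _ that] by simp
  moreover have "fd (\<lambda>z. Th (z, (1, 1, 1, 0))) z v = 0" if "z \<in> \<Omega>" for z v
    by (rule fd_Th_scale_zero[OF that, of "\<epsilon>7 * inverse \<epsilon>5"]) (simp add: e5 e7)
  ultimately have "\<exists>\<alpha>. \<forall>z\<in>\<Omega>. Th (z, (1, 1, 1, 0)) = \<alpha>" by (rule const)
  then obtain \<alpha> where "\<forall>z\<in>\<Omega>. Th (z, (1, 1, 1, 0)) = \<alpha>" by (rule exE)
  note al = this[rule_format]
  have nz: "\<epsilon>4 \<noteq> 0" "\<epsilon>5 \<noteq> 0" "\<epsilon>6 \<noteq> 0" "\<epsilon>7 \<noteq> 0" "\<alpha> \<noteq> 0"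
    using base_derivatives(5,6)[OF z0] upsilon_u[OF z0] scale_H_nonzero[OF z0] Th_TK_linear(1)[OF z0]
    by (simp_all add: e4[OF z0] e5[OF z0] e6[OF z0] e7[OF z0] al[OF z0])
  have fds: "fd \<tau> z v = \<epsilon>4 * fst v" "fd \<xi> z v = \<epsilon>5 * fst (snd v)" "fd \<upsilon> z v = \<epsilon>6 * snd (snd v)"
    if "z \<in> \<Omega>" for z v
  proof -
    obtain a b c where v: "v = (a, b, c)" by (cases v)
    show "fd \<tau> z v = \<epsilon>4 * fst v" "fd \<xi> z v = \<epsilon>5 * fst (snd v)" "fd \<upsilon> z v = \<epsilon>6 * snd (snd v)"
      unfolding v linear_point_expansion[OF linear_fd[OF base_differentiable(1)[OF that]], of a b c]
        linear_point_expansion[OF linear_fd[OF base_differentiable(2)[OF that]], of a b c]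
        linear_point_expansion[OF linear_fd[OF base_differentiable(3)[OF that]], of a b c]
      using base_derivatives[OF that] upsilon_derivatives[OF that] by (simp_all add: e4[OF that] e5[OF that] e6[OF that])
  qed
  obtain \<epsilon>1 where "\<forall>z\<in>\<Omega>. \<tau> z = \<epsilon>4 * fst z + \<epsilon>1"
    using affine_on_dom[OF bounded_linear_fst base_differentiable(1) fds(1)] by (rule exE)
  note e1 = this[rule_format]
  obtain \<epsilon>2 where "\<forall>z\<in>\<Omega>. \<xi> z = \<epsilon>5 * fst (snd z) + \<epsilon>2"
    using affine_on_dom[OF bounded_linear_compose[OF bounded_linear_fst bounded_linear_snd] base_differentiable(2) fds(2)] by (rule exE)
  note e2 = this[rule_format]
  obtain \<epsilon>3 where "\<forall>z\<in>\<Omega>. \<upsilon> z = \<epsilon>6 * snd (snd z) + \<epsilon>3"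
    using affine_on_dom[OF bounded_linear_compose[OF bounded_linear_snd bounded_linear_snd] base_differentiable(3) fds(3)] by (rule exE)
  note e3 = this[rule_format]
  have sf: "scale_f z = \<epsilon>4\<^sup>2 * inverse (\<epsilon>5\<^sup>2) * \<epsilon>7" if "z \<in> \<Omega>" for z
    using Tf_TH_linear(1)[OF that] nz by (simp add: e4[OF that] e5[OF that] e7[OF that] field_simps)
  \<comment> \<open>The witness for \<open>\<epsilon>8\<close> is \<open>inverse \<alpha>\<close>,
    hence the double inverse in front of h.\<close>
  have "T ((t, x, u), (f, h, H, K)) =
             ((\<epsilon>4 * t + \<epsilon>1, \<epsilon>5 * x + \<epsilon>2, \<epsilon>6 * u + \<epsilon>3),
              (\<epsilon>4 ^ 2 * inverse (\<epsilon>5 ^ 2) * \<epsilon>7 * f, inverse (inverse \<alpha>) * h, \<epsilon>7 * H,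
               inverse \<epsilon>5 * \<epsilon>7 * inverse \<alpha> * K))" if z: "(t, x, u) \<in> \<Omega>" for t x u f h H K
  proof -
    let ?y = "((t, x, u), (f, h, H, K))"
    have "fst (T ?y) = (\<epsilon>4 * t + \<epsilon>1, \<epsilon>5 * x + \<epsilon>2, \<epsilon>6 * u + \<epsilon>3)"
      using fst_T[OF z] by (simp add: e1[OF z] e2[OF z] e3[OF z])
    moreover have "Tf ?y = \<epsilon>4 ^ 2 * inverse (\<epsilon>5 ^ 2) * \<epsilon>7 * f" "TH ?y = \<epsilon>7 * H"
      using Tf_TH_linear(2,3)[OF z] by (simp_all add: sf[OF z] e7[OF z])
    moreover have "Th ?y = inverse (inverse \<alpha>) * h" "TK ?y = inverse \<epsilon>5 * \<epsilon>7 * inverse \<alpha> * K"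
      using Th_TK_linear(2,3)[OF z] by (simp_all add: al[OF z] e5[OF z] e7[OF z])
    ultimately show ?thesis by (simp add: prod_eq_iff Tf_def Th_def TH_def TK_def)
  qed
  moreover have "\<epsilon>4 * \<epsilon>5 * \<epsilon>6 * \<epsilon>7 * inverse \<alpha> \<noteq> 0" using nz by simp
  ultimately show ?thesis by blast
qed

end

section \<open>The affine transformations\<close>

text \<open>The linear part of an affine transformation of the seven coordinates; nondegeneracy is
  read off from its invertibility.\<close>

definition diag_map :: "real \<Rightarrow> real \<Rightarrow> real \<Rightarrow> real \<Rightarrow> real \<Rightarrow> real \<Rightarrow> real \<Rightarrow> point \<times> elts \<Rightarrow> point \<times> elts" where
  "diag_map a b c d e k l = (\<lambda>((t, x, u), (f, h, H, K)). ((a * t, b * x, c * u), (d * f, e * h, k * H, l * K)))"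

lemma bounded_linear_diag_map: "bounded_linear (diag_map a b c d e k l)"
proof -
  have "diag_map a b c d e k l = (\<lambda>y. ((a * fst (fst y), b * fst (snd (fst y)), c * snd (snd (fst y))),
    (d * fst (snd y), e * fst (snd (snd y)), k * fst (snd (snd (snd y))), l * snd (snd (snd (snd y))))))"
    by (auto simp: diag_map_def fun_eq_iff)
  moreover have "bounded_linear \<dots>"
    by (intro bounded_linear_Pair bounded_linear_const_mult bounded_linear_fst_comp bounded_linear_snd_comp
        bounded_linear_ident)
  ultimately show ?thesis by simp
qed

lemma diag_map_inverse:
  assumes "a \<noteq> 0" "b \<noteq> 0" "c \<noteq> 0" "d \<noteq> 0" "e \<noteq> 0" "k \<noteq> 0" "l \<noteq> 0"
  shows "diag_map a b c d e k l (diag_map (inverse a) (inverse b) (inverse c) (inverse d) (inverse e) (inverse k) (inverse l) y) = y"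
    "diag_map (inverse a) (inverse b) (inverse c) (inverse d) (inverse e) (inverse k) (inverse l) (diag_map a b c d e k l y) = y"
  using assms by (auto simp: diag_map_def split: prod.splits)

lemma bij_diag_map:
  assumes "a \<noteq> 0" "b \<noteq> 0" "c \<noteq> 0" "d \<noteq> 0" "e \<noteq> 0" "k \<noteq> 0" "l \<noteq> 0"
  shows "bij (diag_map a b c d e k l)"
  using diag_map_inverse[OF assms]
  by (intro bij_betw_byWitness[where f' = "diag_map (inverse a) (inverse b) (inverse c) (inverse d) (inverse e) (inverse k) (inverse l)"]) auto

lemma nondegenerate_translated_bijection:
  fixes T L :: "'a::euclidean_space \<Rightarrow> 'a"
  assumes "open D" "bounded_linear L" "bij L" "\<And>y. y \<in> D \<Longrightarrow> T y = L y + w"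
  shows "nondegenerate D T"
proof -
  have Ck: "Ck_on k D T" for k
  proof (rule Ck_on_cong[OF assms(1)])
    show "Ck_on k D (\<lambda>y. L y + w)"
      by (intro Ck_on_add Ck_on_bounded_linear Ck_on_const assms)
  qed (simp add: assms(4))
  have "fd T y = L" if "y \<in> D" for y
  proof -
    have "fd T y = fd (\<lambda>y. L y + w) y" by (rule fd_transform_open[OF assms(1) that assms(4)])
    also have "\<dots> = L"
      by (rule fd_eqI) (auto intro!: derivative_eq_intros bounded_linear_imp_has_derivative assms(2))
    finally show ?thesis .
  qed
  moreover have "inj_on T D"
    using assms(3,4) by (auto simp: inj_on_def bij_def)
  ultimately show ?thesis using Ck assms(3) by (simp add: nondegenerate_def smooth_on_def)
qed

text \<open>New elements are rescaled old ones composed with the inverse affine change. The image of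
  \<open>S\<close> is the preimage under that inverse, hence open.\<close>

lemma smooth_on_affine_compose:
  fixes g :: "real \<Rightarrow> real"
  assumes "open S" "smooth_on S g" "m \<noteq> 0"
  shows "smooth_on ((\<lambda>x. m * x + d) ` S) (\<lambda>y. k * g ((y - d) / m))"
proof -
  have eq: "(\<lambda>x. m * x + d) ` S = (\<lambda>y. (y - d) / m) -` S"
  proof (intro equalityI subsetI)
    fix y assume "y \<in> (\<lambda>y. (y - d) / m) -` S"
    then show "y \<in> (\<lambda>x. m * x + d) ` S"
      using assms(3) by (intro image_eqI[of _ _ "(y - d) / m"]) auto
  qed (use assms(3) in auto)
  have op: "open ((\<lambda>y. (y - d) / m) -` S)"
    using assms(3) by (intro open_vimage assms(1) continuous_intros) auto
  have "Ck_on j ((\<lambda>y. (y - d) / m) -` S) (\<lambda>y. g ((y - d) / m))" for j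
  proof (rule Ck_on_compose[OF op, where T = S and f = g and g = "\<lambda>y. (y - d) / m"])
    show "Ck_on j S g" using assms(2) by (simp add: smooth_on_def)
    have "Ck_on j ((\<lambda>y. (y - d) / m) -` S) (\<lambda>y. (y - d) * inverse m)"
      by (intro Ck_on_mult Ck_on_diff Ck_on_ident Ck_on_const op)
    then show "Ck_on j ((\<lambda>y. (y - d) / m) -` S) (\<lambda>y. (y - d) / m)" by (simp add: divide_inverse)
  qed auto
  then show ?thesis
    unfolding eq smooth_on_def by (intro allI Ck_on_mult Ck_on_const op)
qed

lemma open_x_range: "open \<Omega> \<Longrightarrow> open (x_range \<Omega>)"
proof -
  assume "open \<Omega>"
  then have "open (fst ` snd ` \<Omega>)" by (intro open_image_fst open_image_snd)
  moreover have "fst ` snd ` \<Omega> = x_range \<Omega>" by (force simp: x_range_def)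
  ultimately show ?thesis by simp
qed

lemma open_u_range: "open \<Omega> \<Longrightarrow> open (u_range \<Omega>)"
proof -
  assume "open \<Omega>"
  then have "open (snd ` snd ` \<Omega>)" by (intro open_image_snd)
  moreover have "snd ` snd ` \<Omega> = u_range \<Omega>" by (force simp: u_range_def)
  ultimately show ?thesis by simp
qed

lemma smooth_on_has_real_derivative:
  fixes g :: "real \<Rightarrow> real"
  assumes "smooth_on S g" "x \<in> S"
  shows "(g has_real_derivative deriv g x) (at x)"
proof -
  have "g differentiable (at x)"
    using assms Ck_on_differentiable[of 1 S g x] by (simp add: smooth_on_def del: Ck_on.simps)
  then show ?thesis using DERIV_deriv_iff_real_differentiable by blast
qed

locale affine_change =
  fixes \<Omega> :: "point set" and \<epsilon>1 \<epsilon>2 \<epsilon>3 \<epsilon>4 \<epsilon>5 \<epsilon>6 \<epsilon>7 \<epsilon>8 :: real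
  assumes open_dom: "open \<Omega>" and nz: "\<epsilon>4 * \<epsilon>5 * \<epsilon>6 * \<epsilon>7 * \<epsilon>8 \<noteq> 0"
begin

definition P :: "point \<Rightarrow> point" where "P = (\<lambda>(t, x, u). (\<epsilon>4 * t + \<epsilon>1, \<epsilon>5 * x + \<epsilon>2, \<epsilon>6 * u + \<epsilon>3))"

lemma nz': "\<epsilon>4 \<noteq> 0" "\<epsilon>5 \<noteq> 0" "\<epsilon>6 \<noteq> 0" "\<epsilon>7 \<noteq> 0" "\<epsilon>8 \<noteq> 0"
  using nz by auto

lemma ranges: "x_range (P ` \<Omega>) = (\<lambda>x. \<epsilon>5 * x + \<epsilon>2) ` x_range \<Omega>" "u_range (P ` \<Omega>) = (\<lambda>u. \<epsilon>6 * u + \<epsilon>3) ` u_range \<Omega>"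
  by (force simp: x_range_def u_range_def P_def)+

context
  fixes f h H K f' h' H' K' :: "real \<Rightarrow> real"
  assumes el: "in_class \<Omega> f h H K"
    and f': "f' = (\<lambda>y. \<epsilon>4 ^ 2 * inverse (\<epsilon>5 ^ 2) * \<epsilon>7 * f ((y - \<epsilon>2) / \<epsilon>5))"
    and h': "h' = (\<lambda>y. inverse \<epsilon>8 * h ((y - \<epsilon>2) / \<epsilon>5))"
    and H': "H' = (\<lambda>v. \<epsilon>7 * H ((v - \<epsilon>3) / \<epsilon>6))"
    and K': "K' = (\<lambda>v. inverse \<epsilon>5 * \<epsilon>7 * \<epsilon>8 * K ((v - \<epsilon>3) / \<epsilon>6))"
begin

lemma image_values: "f' (\<epsilon>5 * x + \<epsilon>2) = \<epsilon>4 ^ 2 * inverse (\<epsilon>5 ^ 2) * \<epsilon>7 * f x" "h' (\<epsilon>5 * x + \<epsilon>2) = inverse \<epsilon>8 * h x"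
  "H' (\<epsilon>6 * u + \<epsilon>3) = \<epsilon>7 * H u" "K' (\<epsilon>6 * u + \<epsilon>3) = inverse \<epsilon>5 * \<epsilon>7 * \<epsilon>8 * K u"
  using nz' by (simp_all add: f' h' H' K')

lemma rescaled_derivative:
  assumes "(g has_real_derivative g1) (at u)"
  shows "((\<lambda>v. k * g ((v - \<epsilon>3) / \<epsilon>6)) has_real_derivative k * g1 / \<epsilon>6) (at (\<epsilon>6 * u + \<epsilon>3))"
proof -
  have "((\<lambda>v. (v - \<epsilon>3) / \<epsilon>6) has_real_derivative 1 / \<epsilon>6) (at (\<epsilon>6 * u + \<epsilon>3))"
    using nz' by (auto intro!: derivative_eq_intros)
  from DERIV_cmult[OF DERIV_chain2[OF _ this, of g g1], of k] assms show ?thesis using nz' by simp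
qed

lemma in_class_image: "in_class (P ` \<Omega>) f' h' H' K'"
proof -
  have sm: "smooth_on (x_range \<Omega>) f" "smooth_on (x_range \<Omega>) h" "smooth_on (u_range \<Omega>) H" "smooth_on (u_range \<Omega>) K"
    and nzr: "\<forall>x\<in>x_range \<Omega>. \<forall>u\<in>u_range \<Omega>. f x * H u \<noteq> 0"
    using el by (simp_all add: in_class_def)
  obtain u where u: "u \<in> u_range \<Omega>" "(deriv H u, deriv K u) \<noteq> (0, 0)"
    using el unfolding in_class_def by blast
  have "deriv H' (\<epsilon>6 * u + \<epsilon>3) = \<epsilon>7 * deriv H u / \<epsilon>6"
    "deriv K' (\<epsilon>6 * u + \<epsilon>3) = inverse \<epsilon>5 * \<epsilon>7 * \<epsilon>8 * deriv K u / \<epsilon>6"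
    unfolding H' K'
    by (rule DERIV_imp_deriv[OF rescaled_derivative[OF smooth_on_has_real_derivative]], rule sm u(1), rule u(1))+
  then have "(deriv H' (\<epsilon>6 * u + \<epsilon>3), deriv K' (\<epsilon>6 * u + \<epsilon>3)) \<noteq> (0, 0)"
    using u(2) nz' by simp
  then have ex: "\<exists>v\<in>u_range (P ` \<Omega>). (deriv H' v, deriv K' v) \<noteq> (0, 0)"
    unfolding ranges using u(1) by blast
  have "f' y * H' v \<noteq> 0" if y: "y \<in> x_range (P ` \<Omega>)" and v: "v \<in> u_range (P ` \<Omega>)" for y v
  proof -
    obtain x u where "x \<in> x_range \<Omega>" "u \<in> u_range \<Omega>" "y = \<epsilon>5 * x + \<epsilon>2" "v = \<epsilon>6 * u + \<epsilon>3"
      using y v unfolding ranges by blast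
    then show ?thesis using nzr nz' by (simp add: image_values)
  qed
  moreover have "smooth_on (x_range (P ` \<Omega>)) f'" "smooth_on (x_range (P ` \<Omega>)) h'"
    "smooth_on (u_range (P ` \<Omega>)) H'" "smooth_on (u_range (P ` \<Omega>)) K'"
    unfolding ranges f' h' H' K'
    by (intro smooth_on_affine_compose open_x_range open_u_range open_dom sm nz')+
  ultimately show ?thesis using ex by (simp add: in_class_def)
qed

lemma fd_affine:
  fixes L :: "point \<Rightarrow> real"
  assumes "bounded_linear L"
  shows "fd (\<lambda>z. k * L z + d) z = (\<lambda>v. k * L v)" "fd (\<lambda>y. fd (\<lambda>z. k * L z + d) y w) z v = 0"
    "Ck_on 2 \<Omega> (\<lambda>z. k * L z + d)"
proof -
  have *: "fd (\<lambda>z. k * L z + d) z = (\<lambda>v. k * L v)" for z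
    by (rule fd_eqI) (auto intro!: derivative_eq_intros bounded_linear_imp_has_derivative assms)
  then show "fd (\<lambda>z. k * L z + d) z = (\<lambda>v. k * L v)" .
  show "fd (\<lambda>y. fd (\<lambda>z. k * L z + d) y w) z v = 0" unfolding * fd_const by simp
  show "Ck_on 2 \<Omega> (\<lambda>z. k * L z + d)"
    by (intro Ck_on_add Ck_on_mult Ck_on_const Ck_on_bounded_linear assms open_dom)
qed

text \<open>Second derivatives of the affine maps vanish, so u_x, u_tt and u_xx are merely scaled,
  by \<epsilon>6/\<epsilon>5, \<epsilon>6/\<epsilon>4^2 and \<epsilon>6/\<epsilon>5^2. With the
  scaled elements the new equation is the old one times the nonzero constant
  \<open>\<epsilon>6 * \<epsilon>7 / \<epsilon>5\<^sup>2\<close>.\<close>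

lemma transforms: "transforms_eq \<Omega> P (wave_eq f h H K) (wave_eq f' h' H' K')"
  unfolding transforms_eq_def
proof (intro allI impI ballI case_prodI2, elim conjE)
  fix N u N' u' and q :: "real \<times> real" and t x
  assume N: "open N" "open N'" "Ck_on 2 N u" "Ck_on 2 N' u'" and g: "maps_graph \<Omega> P N u N' u'"
    and "q \<in> N" "q = (t, x)"
  then have tx: "(t, x) \<in> N" by simp
  define \<tau> where "\<tau> z = \<epsilon>4 * fst z + \<epsilon>1" for z :: point
  define \<xi> where "\<xi> z = \<epsilon>5 * fst (snd z) + \<epsilon>2" for z :: point
  define \<upsilon> where "\<upsilon> z = \<epsilon>6 * snd (snd z) + \<epsilon>3" for z :: point
  have bl: "bounded_linear (\<lambda>z::point. fst (snd z))" "bounded_linear (\<lambda>z::point. snd (snd z))"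
    by (intro bounded_linear_fst_comp bounded_linear_snd_comp bounded_linear_ident)+
  note af = fd_affine[OF bounded_linear_fst, of \<epsilon>4 \<epsilon>1, folded \<tau>_def[abs_def]]
    fd_affine[OF bl(1), of \<epsilon>5 \<epsilon>2, folded \<xi>_def[abs_def]] fd_affine[OF bl(2), of \<epsilon>6 \<epsilon>3, folded \<upsilon>_def[abs_def]]
  have P: "\<forall>z\<in>\<Omega>. P z = (\<tau> z, \<xi> z, \<upsilon> z)" by (auto simp: P_def \<tau>_def \<xi>_def \<upsilon>_def)
  define z where "z = (t, x, u (t, x))"
  note jets = graph_jets[OF open_dom af(3,6,9) P N g tx, folded z_def]
  let ?y = "(\<epsilon>4 * t + \<epsilon>1, \<epsilon>5 * x + \<epsilon>2)"
  have yz: "(\<tau> z, \<xi> z) = ?y" by (simp add: z_def \<tau>_def \<xi>_def)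
  have mg: "(t, x, u (t, x)) \<in> \<Omega>" "?y \<in> N'" "u' ?y = \<epsilon>6 * u (t, x) + \<epsilon>3"
    using bspec[OF g[unfolded maps_graph_def] tx] by (simp_all add: P_def)
  have du: "u' differentiable (at ?y)" using Ck_on_differentiable[OF N(4) _ mg(2)] by simp
  have c1: "fd u' ?y (0, \<epsilon>5) = \<epsilon>6 * fd u (t, x) (0, 1)"
    using jets(1)[of 0 1] unfolding yz by (simp add: af(1,4,7))
  have c2: "fd (\<lambda>q. fd u' q (\<epsilon>4, 0)) ?y (\<epsilon>4, 0) = \<epsilon>6 * fd (\<lambda>q. fd u q (1, 0)) (t, x) (1, 0)"
    using jets(2)[of 1 0] linear_0[OF linear_fd[OF du]] unfolding yz af(2,5,8) by (simp add: af(1,4,7) zero_prod_def)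
  have c3: "fd (\<lambda>q. fd u' q (0, \<epsilon>5)) ?y (0, \<epsilon>5) = \<epsilon>6 * fd (\<lambda>q. fd u q (0, 1)) (t, x) (0, 1)"
    using jets(2)[of 0 1] linear_0[OF linear_fd[OF du]] unfolding yz af(2,5,8) by (simp add: af(1,4,7) zero_prod_def)
  define ux utt uxx where "ux = fd u (t, x) (0, 1)" and "utt = fd (\<lambda>q. fd u q (1, 0)) (t, x) (1, 0)"
    and "uxx = fd (\<lambda>q. fd u q (0, 1)) (t, x) (0, 1)"
  have ux': "fd u' ?y (0, 1) = \<epsilon>6 * ux / \<epsilon>5"
    using c1 linear_real_prod_expansion[OF linear_fd[OF du], of 0 \<epsilon>5] nz' by (simp add: ux_def field_simps)
  have utt': "fd (\<lambda>q. fd u' q (1, 0)) ?y (1, 0) = \<epsilon>6 * utt / \<epsilon>4\<^sup>2"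
    using c2 fd_fd_plane[OF N(2,4) mg(2), of \<epsilon>4 0] nz' by (simp add: utt_def field_simps)
  have uxx': "fd (\<lambda>q. fd u' q (0, 1)) ?y (0, 1) = \<epsilon>6 * uxx / \<epsilon>5\<^sup>2"
    using c3 fd_fd_plane[OF N(2,4) mg(2), of 0 \<epsilon>5] nz' by (simp add: uxx_def field_simps)
  have Hd: "(H has_real_derivative deriv H (u (t, x))) (at (u (t, x)))"
    by (rule smooth_on_has_real_derivative[OF _ range_mem(2)[OF mg(1)]]) (use el in \<open>simp add: in_class_def\<close>)
  have Hd': "(H' has_real_derivative \<epsilon>7 * deriv H (u (t, x)) / \<epsilon>6) (at (u' ?y))"
    unfolding mg(3) H' by (rule rescaled_derivative[OF Hd])
  have "wave_eq f' h' H' K' u' ?y \<longleftrightarrow>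
      (\<epsilon>4 ^ 2 * inverse (\<epsilon>5 ^ 2) * \<epsilon>7 * f x) * (\<epsilon>6 * utt / \<epsilon>4\<^sup>2) =
      (\<epsilon>7 * deriv H (u (t, x)) / \<epsilon>6) * (\<epsilon>6 * ux / \<epsilon>5)\<^sup>2 + (\<epsilon>7 * H (u (t, x))) * (\<epsilon>6 * uxx / \<epsilon>5\<^sup>2)
      + (inverse \<epsilon>8 * h x) * (inverse \<epsilon>5 * \<epsilon>7 * \<epsilon>8 * K (u (t, x))) * (\<epsilon>6 * ux / \<epsilon>5)"
    unfolding wave_eq_iff_jet[OF N(2,4) mg(2) Hd'] ux' utt' uxx' mg(3) image_values ..
  also have "\<dots> \<longleftrightarrow> (\<epsilon>6 * \<epsilon>7 / \<epsilon>5\<^sup>2) * (f x * utt) = (\<epsilon>6 * \<epsilon>7 / \<epsilon>5\<^sup>2) *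
      (deriv H (u (t, x)) * ux\<^sup>2 + H (u (t, x)) * uxx + h x * K (u (t, x)) * ux)"
  proof -
    have "(\<epsilon>4 ^ 2 * inverse (\<epsilon>5 ^ 2) * \<epsilon>7 * f x) * (\<epsilon>6 * utt / \<epsilon>4\<^sup>2) = (\<epsilon>6 * \<epsilon>7 / \<epsilon>5\<^sup>2) * (f x * utt)"
      using nz' by (simp add: field_simps)
    moreover have "(\<epsilon>7 * deriv H (u (t, x)) / \<epsilon>6) * (\<epsilon>6 * ux / \<epsilon>5)\<^sup>2 = (\<epsilon>6 * \<epsilon>7 / \<epsilon>5\<^sup>2) * (deriv H (u (t, x)) * ux\<^sup>2)"
      using nz' by (simp add: field_simps power2_eq_square)
    moreover have "(\<epsilon>7 * H (u (t, x))) * (\<epsilon>6 * uxx / \<epsilon>5\<^sup>2) = (\<epsilon>6 * \<epsilon>7 / \<epsilon>5\<^sup>2) * (H (u (t, x)) * uxx)"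
      by simp
    moreover have "(inverse \<epsilon>8 * h x) * (inverse \<epsilon>5 * \<epsilon>7 * \<epsilon>8 * K (u (t, x))) * (\<epsilon>6 * ux / \<epsilon>5)
        = (\<epsilon>6 * \<epsilon>7 / \<epsilon>5\<^sup>2) * (h x * K (u (t, x)) * ux)"
      using nz' by (simp add: field_simps power2_eq_square)
    ultimately show ?thesis by (simp only: distrib_left)
  qed
  also have "\<dots> \<longleftrightarrow> f x * utt = deriv H (u (t, x)) * ux\<^sup>2 + H (u (t, x)) * uxx + h x * K (u (t, x)) * ux"
    using nz' by simp
  also have "\<dots> \<longleftrightarrow> wave_eq f h H K u (t, x)"
    unfolding wave_eq_iff_jet[OF N(1,3) tx Hd] ux_def utt_def uxx_def ..
  finally have "wave_eq f h H K u (t, x) = wave_eq f' h' H' K' u' ?y" by simp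
  then show "wave_eq f h H K u (t, x) = wave_eq f' h' H' K' u' (t', x')" if "P (t, x, u (t, x)) = (t', y)" "y = (x', v)" for t' y x' v
    using that by (simp add: P_def)
qed

end

lemma mem_usual_equivalence_group:
  assumes T: "\<And>t x u f h H K. (t, x, u) \<in> \<Omega> \<Longrightarrow> T ((t, x, u), (f, h, H, K)) =
             ((\<epsilon>4 * t + \<epsilon>1, \<epsilon>5 * x + \<epsilon>2, \<epsilon>6 * u + \<epsilon>3),
              (\<epsilon>4 ^ 2 * inverse (\<epsilon>5 ^ 2) * \<epsilon>7 * f, inverse \<epsilon>8 * h, \<epsilon>7 * H, inverse \<epsilon>5 * \<epsilon>7 * \<epsilon>8 * K))"
  shows "T \<in> usual_equivalence_group \<Omega>"
proof -
  have "nondegenerate (\<Omega> \<times> UNIV) T"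
  proof (rule nondegenerate_translated_bijection[where w = "((\<epsilon>1, \<epsilon>2, \<epsilon>3), 0)" and
        L = "diag_map \<epsilon>4 \<epsilon>5 \<epsilon>6 (\<epsilon>4 ^ 2 * inverse (\<epsilon>5 ^ 2) * \<epsilon>7) (inverse \<epsilon>8) \<epsilon>7 (inverse \<epsilon>5 * \<epsilon>7 * \<epsilon>8)"])
    show "open (\<Omega> \<times> (UNIV :: elts set))" by (intro open_Times open_dom open_UNIV)
    show "bij (diag_map \<epsilon>4 \<epsilon>5 \<epsilon>6 (\<epsilon>4 ^ 2 * inverse (\<epsilon>5 ^ 2) * \<epsilon>7) (inverse \<epsilon>8) \<epsilon>7 (inverse \<epsilon>5 * \<epsilon>7 * \<epsilon>8))"
      using nz' by (intro bij_diag_map) auto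
  qed (rule bounded_linear_diag_map, auto simp: T diag_map_def zero_prod_def)
  moreover have "projects_to \<Omega> T P"
    by (auto simp: projects_to_def T P_def)
  moreover have "\<exists>f' h' H' K'. in_class (P ` \<Omega>) f' h' H' K' \<and>
            (\<forall>(t, x, u)\<in>\<Omega>. case P (t, x, u) of (t', x', u') \<Rightarrow>
               snd (T ((t, x, u), (f x, h x, H u, K u))) = (f' x', h' x', H' u', K' u')) \<and>
            transforms_eq \<Omega> P (wave_eq f h H K) (wave_eq f' h' H' K')" if el: "in_class \<Omega> f h H K" for f h H K
  proof (intro exI conjI)
    show "in_class (P ` \<Omega>) (\<lambda>y. \<epsilon>4 ^ 2 * inverse (\<epsilon>5 ^ 2) * \<epsilon>7 * f ((y - \<epsilon>2) / \<epsilon>5)) (\<lambda>y. inverse \<epsilon>8 * h ((y - \<epsilon>2) / \<epsilon>5))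
        (\<lambda>v. \<epsilon>7 * H ((v - \<epsilon>3) / \<epsilon>6)) (\<lambda>v. inverse \<epsilon>5 * \<epsilon>7 * \<epsilon>8 * K ((v - \<epsilon>3) / \<epsilon>6))"
      by (rule in_class_image[OF el refl refl refl refl])
    show "transforms_eq \<Omega> P (wave_eq f h H K) (wave_eq (\<lambda>y. \<epsilon>4 ^ 2 * inverse (\<epsilon>5 ^ 2) * \<epsilon>7 * f ((y - \<epsilon>2) / \<epsilon>5))
        (\<lambda>y. inverse \<epsilon>8 * h ((y - \<epsilon>2) / \<epsilon>5)) (\<lambda>v. \<epsilon>7 * H ((v - \<epsilon>3) / \<epsilon>6)) (\<lambda>v. inverse \<epsilon>5 * \<epsilon>7 * \<epsilon>8 * K ((v - \<epsilon>3) / \<epsilon>6)))"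
      by (rule transforms[OF el refl refl refl refl])
  qed (use nz' in \<open>auto simp: T P_def\<close>)
  ultimately show ?thesis unfolding usual_equivalence_group_def by blast
qed

end

section \<open>The two inclusions\<close>

lemma equivalence_transformationI:
  assumes "open \<Omega>" "connected \<Omega>" "\<Omega> \<noteq> {}" "T \<in> usual_equivalence_group \<Omega>"
  obtains P where "equivalence_transformation \<Omega> T P"
  using assms unfolding usual_equivalence_group_def equivalence_transformation_def by blast

theorem theorem3:
  fixes \<Omega> :: "(real \<times> real \<times> real) set"
  assumes "open \<Omega>" and "connected \<Omega>" and "\<Omega> \<noteq> {}"
  shows "usual_equivalence_group \<Omega> =
    {T. \<exists>\<epsilon>1 \<epsilon>2 \<epsilon>3 \<epsilon>4 \<epsilon>5 \<epsilon>6 \<epsilon>7 \<epsilon>8 :: real.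
        \<epsilon>4 * \<epsilon>5 * \<epsilon>6 * \<epsilon>7 * \<epsilon>8 \<noteq> 0 \<and>
        (\<forall>(t, x, u)\<in>\<Omega>. \<forall>f h H K.
           T ((t, x, u), (f, h, H, K)) =
             ((\<epsilon>4 * t + \<epsilon>1, \<epsilon>5 * x + \<epsilon>2, \<epsilon>6 * u + \<epsilon>3),
              (\<epsilon>4 ^ 2 * inverse (\<epsilon>5 ^ 2) * \<epsilon>7 * f,
               inverse \<epsilon>8 * h,
               \<epsilon>7 * H,
               inverse \<epsilon>5 * \<epsilon>7 * \<epsilon>8 * K)))}"
  (is "_ = ?G")
proof (intro equalityI subsetI)
  fix T assume "T \<in> usual_equivalence_group \<Omega>"
  then obtain P where "equivalence_transformation \<Omega> T P"
    using equivalence_transformationI assms by blast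
  from equivalence_transformation.canonical_form[OF this] show "T \<in> ?G" by simp
next
  fix T assume "T \<in> ?G"
  then obtain \<epsilon>1 \<epsilon>2 \<epsilon>3 \<epsilon>4 \<epsilon>5 \<epsilon>6 \<epsilon>7 \<epsilon>8 where nz: "\<epsilon>4 * \<epsilon>5 * \<epsilon>6 * \<epsilon>7 * \<epsilon>8 \<noteq> 0"
    and T: "\<forall>(t, x, u)\<in>\<Omega>. \<forall>f h H K.
           T ((t, x, u), (f, h, H, K)) =
             ((\<epsilon>4 * t + \<epsilon>1, \<epsilon>5 * x + \<epsilon>2, \<epsilon>6 * u + \<epsilon>3),
              (\<epsilon>4 ^ 2 * inverse (\<epsilon>5 ^ 2) * \<epsilon>7 * f, inverse \<epsilon>8 * h, \<epsilon>7 * H, inverse \<epsilon>5 * \<epsilon>7 * \<epsilon>8 * K))"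
    by (elim CollectE exE conjE)
  interpret affine_change \<Omega> \<epsilon>1 \<epsilon>2 \<epsilon>3 \<epsilon>4 \<epsilon>5 \<epsilon>6 \<epsilon>7 \<epsilon>8
    using assms(1) nz by unfold_locales
  show "T \<in> usual_equivalence_group \<Omega>"
    by (rule mem_usual_equivalence_group) (use T in auto)
qed

end
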